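(* Let $\ell \geq 5$ be a prime and let $\epsilon > 0$. Then there exists $C > 0$ such that for all $X \geq 1$, $$\sum_{\substack{0 < d < X \\ d \text{ squarefree}}} h_\ell(d) \leq C X^{\frac{3}{2} - \frac{3}{2\ell + 2} + \epsilon}.$$
   Context: For a squarefree integer $d$ and a prime $\ell$, $h_\ell(d)$ denotes the cardinality of the $\ell$-torsion subgroup $\mathrm{Cl}(\mathbb{Q}(\sqrt{d}))[\ell]$ of the ideal class group of $\mathbb{Q}(\sqrt{d})$. *)

theory Defs
  imports
    Complex_Main
    "HOL-Computational_Algebra.Computational_Algebra"
    "HOL-Algebra.Coset"
begin

text \<open>
  Number fields are taken as subfields \<open>K\<close> of the complex numbers, given by their underlying sets.
\<close>

definition quadratic_field :: "int \<Rightarrow> complex set" where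
  "quadratic_field d = {of_rat a + of_rat b * csqrt (of_int d) | a b. True}"

definition integers_of :: "complex set \<Rightarrow> complex set" where
  "integers_of K = {x \<in> K. algebraic_int x}"

text \<open>
  Closure under negation is not listed, since it follows from closure under multiplication by
  the algebraic integer \<open>-1\<close>.
\<close>

definition fractional_ideal :: "complex set \<Rightarrow> complex set \<Rightarrow> bool" where
  "fractional_ideal K I \<longleftrightarrow>
     I \<subseteq> K \<and> 0 \<in> I \<and> I \<noteq> {0} \<and>
     (\<forall>x\<in>I. \<forall>y\<in>I. x + y \<in> I) \<and>
     (\<forall>r\<in>integers_of K. \<forall>x\<in>I. r * x \<in> I) \<and>
     (\<exists>c\<in>integers_of K. c \<noteq> 0 \<and> (\<forall>x\<in>I. c * x \<in> integers_of K))"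

definition ideal_mult :: "complex set \<Rightarrow> complex set \<Rightarrow> complex set" where
  "ideal_mult I J =
     {(\<Sum>k<n. x k * y k) | (n::nat) x y. \<forall>k<n. x k \<in> I \<and> y k \<in> J}"

definition fractional_ideal_group :: "complex set \<Rightarrow> complex set monoid" where
  "fractional_ideal_group K =
     \<lparr>carrier = {I. fractional_ideal K I}, mult = ideal_mult, one = integers_of K\<rparr>"

definition principal_fractional_ideals :: "complex set \<Rightarrow> complex set set" where
  "principal_fractional_ideals K = {(\<lambda>r. a * r) ` integers_of K | a. a \<in> K \<and> a \<noteq> 0}"

definition class_group :: "complex set \<Rightarrow> complex set set monoid" where
  "class_group K = fractional_ideal_group K Mod principal_fractional_ideals K"

definition torsion_subgroup :: "('a, 'b) monoid_scheme \<Rightarrow> nat \<Rightarrow> 'a set" where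
  "torsion_subgroup G n = {c \<in> carrier G. c [^]\<^bsub>G\<^esub> n = \<one>\<^bsub>G\<^esub>}"

definition class_torsion :: "nat \<Rightarrow> int \<Rightarrow> nat" where
  "class_torsion l d = card (torsion_subgroup (class_group (quadratic_field d)) l)"

end

theory Submission
  imports Defs "HOL-Analysis.Convex" "HOL-Analysis.Harmonic_Numbers" "HOL-Number_Theory.Cong"
    "HOL-Real_Asymp.Real_Asymp"
begin

text \<open>
  Let \<open>Z = X\<^sup>\<theta>\<close> with \<open>\<theta> = 3/(2l+2)\<close>. For an \<open>l\<close>-torsion class \<open>c\<close> pick an ideal \<open>I\<close> in \<open>c\<close>
  with \<open>I\<^sup>l = (\<alpha>)\<close>, and for a prime \<open>p \<le> Z\<close> that splits in the field let \<open>P\<close> be a prime ideal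
  above \<open>p\<close>. Using \<open>|\<alpha>|\<close> and \<open>|\<alpha>'|\<close> as metrics (so that the units play no role), let \<open>x\<close> be a shortest
  vector of \<open>IP\<close>. Then \<open>IP/x\<close> is one of \<open>O(d\<^bsup>1/2+\<epsilon>\<^esup>)\<close> reduced modules, and the ratio of the
  two metrics at \<open>x\<close> lies in one of \<open>O(log d)\<close> dyadic ranges. If \<open>(c, p)\<close> and \<open>(c', q)\<close> share both
  data, then \<open>P\<^sup>l\<close> and \<open>Q\<^sup>l\<close> differ by a small principal factor, which gives a small solution
  of \<open>u\<^sup>2 - d v\<^sup>2 = \<plusminus>4(pq)\<^sup>l\<close>; for \<open>p = q\<close> it forces \<open>c = c'\<close>. By Cauchy--Schwarz,
  \<open>h\<^sub>l(d) M\<^sup>2 \<le> d\<^bsup>1/2+\<epsilon>\<^esup> (M + E)\<close>, where \<open>M\<close> is the number of split primes up to \<open>Z\<close> and \<open>E\<close> the number of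
  pairs \<open>p \<noteq> q\<close> admitting such a solution.

  A variance bound for quadratic characters shows that \<open>M\<close> is of the expected size for all but
  \<open>O(X/Z)\<close> of the \<open>d \<le> X\<close>, and the exceptions are covered by \<open>h\<^sub>l(d) \<le> d\<^bsup>1/2+\<epsilon>\<^esup>\<close>. Summed over
  \<open>d\<close>, the numbers \<open>E\<close> are bounded by counting the roots \<open>u\<close> of \<open>u\<^sup>2 = \<plusminus>4(pq)\<^sup>l\<close> modulo
  \<open>v\<^sup>2\<close>. The resulting bound \<open>X\<^bsup>3/2\<^esup>/Z + X + Z\<^sup>l\<close>, up to \<open>X\<^sup>\<epsilon>\<close>, is optimal for the above \<open>Z\<close>.
\<close>

subsection \<open>Products of additive subsets of the complex numbers\<close>

text \<open>A generator of a principal ideal carries no size information, since the units of a real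
  quadratic field are infinitely many and can be very large. Scaling \<open>x\<close> at each
  embedding by the size of \<alpha> repairs this. If (I, P) with minimum x and (I', Q) with minimum
  x' share a cell, then b = \<alpha> x'^l / (\<alpha>' x^l) carries P^l onto Q^l, its norm is
  +-(q/p)^l, and the common dyadic range makes |b| and |b'| agree up to a factor 2. Hence b p^l is
  an algebraic integer both of whose conjugates have size about (pq)^(l/2), and no unit had to be
  controlled.

  The prime above p is taken in Z[sqrt d] as (p, r + sqrt d), which has the same shape for every d
  modulo 4. As l is odd, (pq)^l is not a square for p \<noteq> q, so v = 0 is impossible in the
  resulting equation. Its v is then at most V = O(Z^l / sqrt X), each v admits about sqrt X / v + 1
  values of d in a dyadic range once v is coprime to p and q wherever they divide the right-hand
  side, and the total per pair is sqrt X + V up to X^\<epsilon>. The bound h \<le>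
  d^(1/2+\<epsilon>) for exceptional d is the same argument with the single ideal p = 1.\<close>

definition add_closed :: "complex set \<Rightarrow> bool" where
  "add_closed S \<longleftrightarrow> 0 \<in> S \<and> (\<forall>x\<in>S. \<forall>y\<in>S. x + y \<in> S)"

lemma add_closed_sum:
  assumes "add_closed S" "\<And>k. k < (n::nat) \<Longrightarrow> f k \<in> S"
  shows "(\<Sum>k<n. f k) \<in> S"
  using assms(2) by (induction n) (use assms(1) in \<open>auto simp: add_closed_def\<close>)

lemma ideal_mult_memI: "x \<in> I \<Longrightarrow> y \<in> J \<Longrightarrow> x * y \<in> ideal_mult I J"
  unfolding ideal_mult_def
  by (rule CollectI, rule exI[of _ 1], rule exI[of _ "\<lambda>_. x"], rule exI[of _ "\<lambda>_. y"]) auto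

lemma ideal_mult_subset:
  assumes "add_closed S" "\<And>x y. x \<in> I \<Longrightarrow> y \<in> J \<Longrightarrow> x * y \<in> S"
  shows "ideal_mult I J \<subseteq> S"
  using add_closed_sum[OF assms(1)] assms(2) by (force simp: ideal_mult_def)

lemma add_closed_ideal_mult: "add_closed (ideal_mult I J)"
  unfolding add_closed_def
proof (intro conjI ballI)
  show "0 \<in> ideal_mult I J"
    unfolding ideal_mult_def by (rule CollectI, rule exI[of _ 0]) auto
next
  fix a b assume "a \<in> ideal_mult I J" "b \<in> ideal_mult I J"
  then have *: "\<exists>(n::nat) x y. a = (\<Sum>k<n. x k * y k) \<and> (\<forall>k<n. x k \<in> I \<and> y k \<in> J)"
    "\<exists>(n::nat) x y. b = (\<Sum>k<n. x k * y k) \<and> (\<forall>k<n. x k \<in> I \<and> y k \<in> J)"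
    by (simp_all add: ideal_mult_def)
  obtain n :: nat and x y where a: "a = (\<Sum>k<n. x k * y k)" "\<forall>k<n. x k \<in> I \<and> y k \<in> J"
    using *(1) by metis
  obtain m :: nat and x' y' where b: "b = (\<Sum>k<m. x' k * y' k)" "\<forall>k<m. x' k \<in> I \<and> y' k \<in> J"
    using *(2) by metis
  let ?x = "\<lambda>k. if k < n then x k else x' (k - n)"
  let ?y = "\<lambda>k. if k < n then y k else y' (k - n)"
  have "(\<Sum>k<n + m. ?x k * ?y k) = a + b"
  proof -
    have split: "(\<Sum>k<n + m. g k) = (\<Sum>k<n. g k) + (\<Sum>k<m. g (n + k))" for g :: "nat \<Rightarrow> complex"
      by (induction m) (simp_all add: add.assoc)
    show ?thesis unfolding a(1) b(1) split by simp
  qed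
  moreover have "\<forall>k<n + m. ?x k \<in> I \<and> ?y k \<in> J" using a(2) b(2) by auto
  ultimately show "a + b \<in> ideal_mult I J"
    unfolding ideal_mult_def by (intro CollectI exI[of _ "n + m"] exI[of _ ?x] exI[of _ ?y]) auto
qed

lemma ideal_mult_comm: "ideal_mult I J = ideal_mult J I"
proof -
  have "ideal_mult I J \<subseteq> ideal_mult J I" for I J
    by (rule ideal_mult_subset[OF add_closed_ideal_mult]) (metis ideal_mult_memI mult.commute)
  then show ?thesis by blast
qed

lemma add_closed_vimage: "add_closed S \<Longrightarrow> add_closed {z. z * w \<in> S}"
  by (auto simp: add_closed_def distrib_right)

text \<open>For fixed \<open>w\<close> the set of \<open>z\<close> with \<open>z * w\<close> in the
  target is add-closed, so only products \<open>x * y\<close> with \<open>x \<in> I\<close> and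
  \<open>y \<in> J\<close> need testing. The opposite inclusion is the same one read through
  commutativity.\<close>

lemma ideal_mult_assoc: "ideal_mult (ideal_mult I J) L = ideal_mult I (ideal_mult J L)"
proof -
  have *: "ideal_mult (ideal_mult I J) L \<subseteq> ideal_mult I (ideal_mult J L)" for I J L
  proof (rule ideal_mult_subset[OF add_closed_ideal_mult])
    fix z w assume "z \<in> ideal_mult I J" "w \<in> L"
    have "ideal_mult I J \<subseteq> {z. z * w \<in> ideal_mult I (ideal_mult J L)}"
      by (rule ideal_mult_subset[OF add_closed_vimage[OF add_closed_ideal_mult]])
         (simp add: ideal_mult_memI \<open>w \<in> L\<close> mult.assoc)
    then show "z * w \<in> ideal_mult I (ideal_mult J L)" using \<open>z \<in> ideal_mult I J\<close> by blast
  qed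
  have "ideal_mult I (ideal_mult J L) = ideal_mult (ideal_mult L J) I"
    by (metis ideal_mult_comm)
  also have "\<dots> \<subseteq> ideal_mult L (ideal_mult J I)" by (rule *)
  also have "\<dots> = ideal_mult (ideal_mult I J) L" by (metis ideal_mult_comm)
  finally show ?thesis using * by blast
qed

lemma ideal_mult_scale: "ideal_mult ((*) a ` I) J = (*) a ` ideal_mult I J"
proof
  show "ideal_mult ((*) a ` I) J \<subseteq> (*) a ` ideal_mult I J"
  proof (rule ideal_mult_subset)
    show "add_closed ((*) a ` ideal_mult I J)"
      using add_closed_ideal_mult[of I J] unfolding add_closed_def
      by (auto simp: image_iff) (metis distrib_left)
  qed (auto simp: mult.assoc ideal_mult_memI)
  have "ideal_mult I J \<subseteq> {z. z * a \<in> ideal_mult ((*) a ` I) J}"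
    by (rule ideal_mult_subset[OF add_closed_vimage[OF add_closed_ideal_mult]])
       (metis ideal_mult_memI image_eqI mem_Collect_eq mult.assoc mult.commute)
  then show "(*) a ` ideal_mult I J \<subseteq> ideal_mult ((*) a ` I) J" by (auto simp: mult.commute)
qed

lemma ideal_mult_scale_right: "ideal_mult I ((*) a ` J) = (*) a ` ideal_mult I J"
  by (metis ideal_mult_comm ideal_mult_scale)

lemma ideal_mult_absorb:
  assumes "add_closed I" "1 \<in> S" "\<And>r x. r \<in> S \<Longrightarrow> x \<in> I \<Longrightarrow> r * x \<in> I"
  shows "ideal_mult S I = I"
proof
  show "ideal_mult S I \<subseteq> I" by (rule ideal_mult_subset) (use assms in auto)
  show "I \<subseteq> ideal_mult S I" using ideal_mult_memI[OF assms(2), of _ I] by auto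
qed

subsection \<open>Real quadratic fields\<close>

locale real_quadratic =
  fixes d :: int
  assumes d_gt: "d > 1" and sqf: "squarefree d"
begin

abbreviation K where "K \<equiv> quadratic_field d"
abbreviation OK where "OK \<equiv> integers_of K"

definition s :: complex where "s = csqrt (of_int d)"
definition el :: "rat \<Rightarrow> rat \<Rightarrow> complex" where "el a b = of_rat a + of_rat b * s"
text \<open>The nontrivial automorphism of \<open>K\<close>. The description is unique because
  \<open>s\<close> is irrational (\<open>el_inj\<close>); outside \<open>K\<close> the value is
  unspecified, which is why the lemmas on \<open>cj\<close> carry membership premises.\<close>

definition cj :: "complex \<Rightarrow> complex" where
  "cj x = (THE y. \<exists>a b. x = el a b \<and> y = el a (- b))"

lemma s_sq: "s * s = of_int d" 
  unfolding s_def by (metis power2_csqrt power2_eq_square)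

lemma s_real: "s = complex_of_real (sqrt (of_int d))"
proof -
  have "csqrt (complex_of_real (of_int d)) = complex_of_real (sqrt (of_int d))"
    using d_gt by (intro csqrt_of_real) auto
  then show ?thesis by (simp add: s_def)
qed

lemma norm_s: "norm s = sqrt (of_int d)"
  using d_gt by (simp add: s_real)

lemma s_irrational: "s \<notin> \<rat>"
proof
  assume "s \<in> \<rat>"
  moreover have "algebraic_int s" unfolding s_def by (intro algebraic_int_csqrt) auto
  ultimately have "s \<in> \<int>" by (intro rational_algebraic_int_is_int)
  then obtain n where n: "s = of_int n" by (auto elim: Ints_cases)
  then have "(of_int (n * n) :: complex) = of_int d" using s_sq by simp
  then have nd: "n\<^sup>2 = d" unfolding of_int_eq_iff by (simp add: power2_eq_square)
  then have "n\<^sup>2 dvd d" by simp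
  then have "n dvd 1" using sqf squarefreeD by blast
  then have "d = 1" using nd by (auto simp: abs_square_eq_1)
  then show False using d_gt by simp
qed

lemma el_eq_0: "el a b = 0 \<longleftrightarrow> a = 0 \<and> b = 0"
proof
  assume *: "el a b = 0"
  have "b = 0"
  proof (rule ccontr)
    assume "b \<noteq> 0"
    then have "s = - of_rat a / of_rat b" using * by (simp add: el_def field_simps add_eq_0_iff)
    then show False using s_irrational by auto
  qed
  then show "a = 0 \<and> b = 0" using * by (simp add: el_def)
qed (simp add: el_def)

lemma el_add: "el a b + el a' b' = el (a + a') (b + b')"
  by (simp add: el_def of_rat_add algebra_simps)
lemma el_minus: "- el a b = el (- a) (- b)"
  by (simp add: el_def of_rat_minus algebra_simps)
lemma el_diff: "el a b - el a' b' = el (a - a') (b - b')"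
  by (simp add: el_def of_rat_diff algebra_simps)
lemma el_mult: "el a b * el a' b' = el (a * a' + of_int d * b * b') (a * b' + b * a')"
proof -
  have "el a b * el a' b' = of_rat a * of_rat a' + of_rat b * of_rat b' * (s * s)
     + (of_rat a * of_rat b' + of_rat b * of_rat a') * s"
    by (simp add: el_def algebra_simps)
  then show ?thesis unfolding s_sq by (simp add: el_def of_rat_add of_rat_mult)
qed
lemma el_inj: "el a b = el a' b' \<longleftrightarrow> a = a' \<and> b = b'"
  using el_eq_0[of "a - a'" "b - b'"] el_diff[of a b a' b'] by auto

lemma K_iff: "x \<in> K \<longleftrightarrow> (\<exists>a b. x = el a b)"
  by (auto simp: quadratic_field_def el_def s_def)

lemma el_K [simp]: "el a b \<in> K" by (auto simp: K_iff)

lemma cj_el [simp]: "cj (el a b) = el a (- b)"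
  unfolding cj_def by (rule the_equality) (auto simp: el_inj)

lemma of_int_el: "of_int n = el (of_int n) 0" by (simp add: el_def)
lemma of_rat_el: "of_rat n = el n 0" by (simp add: el_def)
lemma s_el: "s = el 0 1" by (simp add: el_def)

lemma K_closed [intro, simp]:
  "x \<in> K \<Longrightarrow> y \<in> K \<Longrightarrow> x + y \<in> K" "x \<in> K \<Longrightarrow> y \<in> K \<Longrightarrow> x * y \<in> K" "x \<in> K \<Longrightarrow> - x \<in> K"
  "x \<in> K \<Longrightarrow> y \<in> K \<Longrightarrow> x - y \<in> K"
  "of_int n \<in> K" "s \<in> K" "x \<in> K \<Longrightarrow> cj x \<in> K" "0 \<in> K" "1 \<in> K" "of_nat m \<in> K" "of_rat a \<in> K"
proof -
  show "0 \<in> K" "1 \<in> K" "of_nat m \<in> K" using el_K[of 0 0] el_K[of 1 0] el_K[of "of_nat m" 0]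
    by (auto simp: el_def)
qed (auto simp: K_iff el_add el_mult el_minus el_diff of_int_el of_rat_el s_el el_inj)

lemma cj_ring:
  "x \<in> K \<Longrightarrow> y \<in> K \<Longrightarrow> cj (x + y) = cj x + cj y"
  "x \<in> K \<Longrightarrow> y \<in> K \<Longrightarrow> cj (x * y) = cj x * cj y"
  "x \<in> K \<Longrightarrow> y \<in> K \<Longrightarrow> cj (x - y) = cj x - cj y"
  "x \<in> K \<Longrightarrow> cj (- x) = - cj x"
  by (auto simp: K_iff el_add el_mult el_minus el_diff)

lemma cj_cj [simp]: "x \<in> K \<Longrightarrow> cj (cj x) = x" by (auto simp: K_iff)

lemma cj_const [simp]: "cj (of_int n) = of_int n" "cj (of_rat a) = of_rat a" "cj 0 = 0" "cj 1 = 1" "cj s = - s"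
  "cj (of_nat m) = of_nat m"
proof -
  show "cj (of_int n) = of_int n" "cj (of_rat a) = of_rat a" "cj s = - s" 
    by (simp_all add: of_int_el of_rat_el) (simp add: s_el el_minus)
  show "cj 0 = 0" "cj 1 = 1" "cj (of_nat m) = of_nat m" using cj_el[of 0 0] cj_el[of 1 0] cj_el[of "of_nat m" 0]
    by (simp_all add: el_def)
qed

lemma cj_power: "x \<in> K \<Longrightarrow> x ^ n \<in> K \<and> cj (x ^ n) = cj x ^ n"
  by (induction n) (auto simp: cj_ring)

lemma cj_eq_0 [simp]: "x \<in> K \<Longrightarrow> cj x = 0 \<longleftrightarrow> x = 0"
  by (auto simp: K_iff el_eq_0)

lemma norm_el: "el a b * cj (el a b) = of_rat (a\<^sup>2 - of_int d * b\<^sup>2)"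
  by (simp add: el_mult of_rat_el power2_eq_square algebra_simps)

lemma norm_rat: "x \<in> K \<Longrightarrow> \<exists>q. x * cj x = of_rat q"
  by (metis K_iff norm_el)

lemma K_inverse [intro, simp]: "x \<in> K \<Longrightarrow> inverse x \<in> K"
proof -
  assume x: "x \<in> K"
  then obtain q where q: "x * cj x = of_rat q" using norm_rat by blast
  show ?thesis
  proof (cases "x = 0")
    case False
    then have "of_rat q \<noteq> (0::complex)" using q x by (metis cj_eq_0 mult_eq_0_iff)
    then have "x * (cj x * of_rat (inverse q)) = 1"
      by (simp add: q of_rat_inverse mult.assoc[symmetric])
    then have "inverse x = cj x * of_rat (inverse q)" by (rule inverse_unique)
    then show ?thesis using x by simp
  qed simp
qed

lemma K_divide [intro, simp]: "x \<in> K \<Longrightarrow> y \<in> K \<Longrightarrow> x / y \<in> K"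
  by (simp add: divide_inverse)

lemma cj_inverse: "x \<in> K \<Longrightarrow> cj (inverse x) = inverse (cj x)"
proof (cases "x = 0")
  case False
  assume x: "x \<in> K"
  have "cj x * cj (inverse x) = cj (x * inverse x)" using x by (simp add: cj_ring)
  then show ?thesis using False x by (simp add: field_simps)
qed simp

lemma cj_divide: "x \<in> K \<Longrightarrow> y \<in> K \<Longrightarrow> cj (x / y) = cj x / cj y"
  by (simp add: divide_inverse cj_ring cj_inverse)

end

section \<open>The ring of integers of a real quadratic field\<close>

text \<open>With \<open>q = a / b\<close> in lowest terms, \<open>b ^ n\<close> divides
  \<open>D\<close> for every \<open>n\<close>, which is impossible for \<open>b \<ge> 2\<close> once
  2^n exceeds |D|. It takes the place of minimal polynomials in showing that algebraic integers have
  integral norm.\<close>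

lemma rat_int_of_power_denom:
  fixes q :: rat and D :: int
  assumes "D \<noteq> 0" "\<And>n. \<exists>m::int. of_int D * q ^ n = of_int m"
  shows "\<exists>m::int. q = of_int m"
proof -
  obtain a b where ab: "quotient_of q = (a, b)" by (cases "quotient_of q")
  have b: "b > 0" and cop: "coprime a b" and q: "q = of_int a / of_int b"
    using quotient_of_denom_pos[OF ab] quotient_of_coprime[OF ab] quotient_of_div[OF ab] by auto
  have dv: "b ^ n dvd D" for n
  proof -
    obtain m where m: "of_int D * q ^ n = of_int m" using assms(2) by blast
    then have "(of_int (D * a ^ n) :: rat) = of_int (m * b ^ n)"
      using b by (simp add: q power_divide field_simps)
    then have "D * a ^ n = m * b ^ n" unfolding of_int_eq_iff .
    then have "b ^ n dvd D * a ^ n" by simp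
    moreover have "coprime (b ^ n) (a ^ n)" using cop by (simp add: coprime_commute)
    ultimately show ?thesis by (simp add: coprime_dvd_mult_left_iff)
  qed
  have "b = 1"
  proof (rule ccontr)
    assume "b \<noteq> 1"
    then have "b \<ge> 2" using b by simp
    define n where "n = nat \<bar>D\<bar>"
    have "b ^ n \<le> \<bar>D\<bar>" using dv[of n] assms(1) dvd_imp_le_int[of D "b ^ n"] b by simp
    moreover have "(2::int) ^ n \<le> b ^ n" using \<open>b \<ge> 2\<close> by (intro power_mono) auto
    moreover have "int n < 2 ^ n" using of_nat_less_two_power[of n, where 'a = int] by simp
    ultimately show False by (simp add: n_def)
  qed
  then show ?thesis using q by auto
qed

context real_quadratic begin

text \<open>The order Z[sqrt d], of index 1 or 2 in the maximal order. Its elements have integer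
  coordinates, so denominators and ideal generators can be written over it without distinguishing
  \<open>d\<close> modulo 4.\<close>

definition R :: "complex set" where "R = {of_int u + of_int v * s | u v. True}"

lemma R_memI: "of_int u + of_int v * s \<in> R" by (auto simp: R_def)

lemma R_add: "x \<in> R \<Longrightarrow> y \<in> R \<Longrightarrow> x + y \<in> R"
proof -
  assume "x \<in> R" "y \<in> R"
  then obtain u v u' v' where "x = of_int u + of_int v * s" "y = of_int u' + of_int v' * s"
    by (auto simp: R_def)
  then have "x + y = of_int (u + u') + of_int (v + v') * s" by (simp add: algebra_simps)
  then show ?thesis using R_memI by metis
qed

lemma R_mult: "x \<in> R \<Longrightarrow> y \<in> R \<Longrightarrow> x * y \<in> R"
proof -
  assume "x \<in> R" "y \<in> R"
  then obtain u v u' v' where *: "x = of_int u + of_int v * s" "y = of_int u' + of_int v' * s"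
    by (auto simp: R_def)
  have "x * y = of_int u * of_int u' + of_int v * of_int v' * (s * s) + (of_int u * of_int v' + of_int v * of_int u') * s"
    by (simp add: * algebra_simps)
  then have "x * y = of_int (u * u' + v * v' * d) + of_int (u * v' + v * u') * s"
    by (simp add: s_sq)
  then show ?thesis using R_memI by metis
qed

lemma R_consts [simp]: "of_int n \<in> R" "0 \<in> R" "1 \<in> R" "s \<in> R"
  using R_memI[of n 0] R_memI[of 0 0] R_memI[of 1 0] R_memI[of 0 1] by auto

lemma R_minus: "x \<in> R \<Longrightarrow> - x \<in> R"
  using R_mult[of "of_int (- 1)" x] R_consts(1)[of "- 1"] by simp

lemma R_sub_K: "R \<subseteq> K" by (auto simp: R_def)

lemma R_sum: "(\<And>i. i \<in> A \<Longrightarrow> f i \<in> R) \<Longrightarrow> sum f A \<in> R"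
  by (induction A rule: infinite_finite_induct) (auto intro: R_add)

lemma K_denominator:
  assumes "x \<in> K"
  obtains m :: int where "m > 0" "of_int m * x \<in> R"
proof -
  obtain a b where x: "x = el a b" using assms K_iff by auto
  obtain p q where pq: "quotient_of a = (p, q)" by (cases "quotient_of a")
  obtain p' q' where pq': "quotient_of b = (p', q')" by (cases "quotient_of b")
  have q: "q > 0" "q' > 0" and ab: "a = of_int p / of_int q" "b = of_int p' / of_int q'"
    using quotient_of_denom_pos[OF pq] quotient_of_denom_pos[OF pq'] quotient_of_div[OF pq] quotient_of_div[OF pq'] by auto
  have "of_int (q * q') * x = of_int (p * q') + of_int (p' * q) * s"
    using q by (simp add: x el_def ab of_rat_divide field_simps)
  then have "of_int (q * q') * x \<in> R" using R_memI by metis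
  then show ?thesis using that[of "q * q'"] q by simp
qed

lemma K_common_denominator:
  assumes "\<And>i. i < (n::nat) \<Longrightarrow> f i \<in> K"
  shows "\<exists>m::int. m > 0 \<and> (\<forall>i<n. of_int m * f i \<in> R)"
  using assms
proof (induction n)
  case 0
  show ?case by (rule exI[of _ 1]) auto
next
  case (Suc n)
  then obtain m :: int where m: "m > 0" "\<forall>i<n. of_int m * f i \<in> R" by auto
  obtain m' where m': "m' > 0" "of_int m' * f n \<in> R" using K_denominator[of "f n"] Suc.prems by auto
  have "of_int (m * m') * f i \<in> R" if "i < Suc n" for i
  proof (cases "i = n")
    case True
    have eq: "of_int (m * m') * f i = of_int m * (of_int m' * f n)" by (simp add: True mult.assoc)
    show ?thesis unfolding eq by (intro R_mult m' R_consts)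
  next
    case False
    have eq: "of_int (m * m') * f i = of_int m' * (of_int m * f i)" by simp
    show ?thesis unfolding eq by (rule R_mult[OF R_consts(1)]) (use m that False in auto)
  qed
  then show ?case using m m' by (intro exI[of _ "m * m'"]) auto
qed

text \<open>A monic integral equation of degree \<open>k\<close> expresses \<open>x ^ k\<close>
  through lower powers, so a common denominator of the first \<open>k\<close> powers clears all of
  them.\<close>

lemma algebraic_int_powers:
  assumes "x \<in> K" "algebraic_int x"
  shows "\<exists>m::int. m > 0 \<and> (\<forall>n. of_int m * x ^ n \<in> R)"
proof -
  obtain p where p: "lead_coeff p = 1" "\<forall>i. coeff p i \<in> \<int>" "poly p x = 0"
    using assms(2) by (auto simp: algebraic_int.simps)
  define k where "k = degree p"
  obtain m :: int where m: "m > 0" "\<forall>i<k. of_int m * x ^ i \<in> R"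
    using K_common_denominator[of k "\<lambda>i. x ^ i"] cj_power[OF assms(1)] by auto
  have "(\<Sum>i\<le>k. coeff p i * x ^ i) = 0" using p(3) by (simp add: poly_altdef k_def)
  then have xk: "x ^ k = - (\<Sum>i<k. coeff p i * x ^ i)"
    using p(1) by (simp add: k_def lessThan_Suc_atMost[symmetric] add_eq_0_iff2)
  have "of_int m * x ^ n \<in> R" for n
  proof (induction n rule: less_induct)
    case (less n)
    show ?case
    proof (cases "n < k")
      case False
      then have "x ^ n = x ^ k * x ^ (n - k)" by (simp add: power_add[symmetric])
      also have "\<dots> = - (\<Sum>i<k. coeff p i * x ^ (i + (n - k)))"
        by (simp add: xk sum_distrib_right power_add mult.assoc)
      finally have "of_int m * x ^ n = - (\<Sum>i<k. coeff p i * (of_int m * x ^ (i + (n - k))))"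
        by (simp add: sum_distrib_left mult_ac)
      moreover have "coeff p i * (of_int m * x ^ (i + (n - k))) \<in> R" if "i < k" for i
      proof (rule R_mult)
        show "coeff p i \<in> R" using p(2) by (metis Ints_cases R_consts(1))
        show "of_int m * x ^ (i + (n - k)) \<in> R" using less[of "i + (n - k)"] that False by simp
      qed
      ultimately show ?thesis by (metis (no_types, lifting) R_minus R_sum lessThan_iff)
    qed (use m in auto)
  qed
  then show ?thesis using m by blast
qed

lemma R_norm_int: "x \<in> R \<Longrightarrow> \<exists>m. x * cj x = of_int m"
proof -
  assume "x \<in> R"
  then obtain u v where x: "x = of_int u + of_int v * s" by (auto simp: R_def)
  have "x * cj x = of_int u * of_int u - of_int v * of_int v * (s * s)"
    by (simp add: x cj_ring algebra_simps)
  also have "\<dots> = of_int (u * u - v * v * d)" by (simp add: s_sq)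
  finally show ?thesis by blast
qed

text \<open>Each \<open>of_int m * x ^ n\<close> lies in \<open>R\<close> and so has integral norm,
  namely m^2 times the \<open>n\<close>-th power of the norm of \<open>x\<close>. A rational number
  all of whose powers share a denominator is an integer.\<close>

lemma OK_norm_int: 
  assumes "x \<in> K" "algebraic_int x"
  shows "\<exists>m. x * cj x = of_int m"
proof -
  obtain m :: int where m: "m > 0" "\<And>n. of_int m * x ^ n \<in> R" using algebraic_int_powers[OF assms] by auto
  obtain q where q: "x * cj x = of_rat q" using norm_rat assms by blast
  have "\<exists>r::int. of_int (m * m) * q ^ n = of_int r" for n
  proof -
    obtain r where r: "(of_int m * x ^ n) * cj (of_int m * x ^ n) = of_int r" using R_norm_int[OF m(2)] by blast
    have "(of_int m * x ^ n) * cj (of_int m * x ^ n) = of_int (m * m) * (x * cj x) ^ n"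
      using cj_power[OF assms(1), of n] by (simp add: cj_ring power_mult_distrib mult_ac)
    then have "of_int (m * m) * (of_rat q :: complex) ^ n = of_int r" using q r by simp
    then have "(of_rat (of_int (m * m) * q ^ n) :: complex) = of_rat (of_int r)"
      by (simp add: of_rat_mult of_rat_power)
    then show ?thesis unfolding of_rat_eq_iff by blast
  qed
  then obtain r where "q = of_int r" using rat_int_of_power_denom[of "m * m" q] m(1) by auto
  then show ?thesis using q by (auto intro!: exI[of _ r])
qed

text \<open>The trace equals N(x + 1) - N(x) - 1, so integrality of norms suffices.\<close>

lemma OK_trace_int:
  assumes "x \<in> K" "algebraic_int x"
  shows "\<exists>m. x + cj x = of_int m"
proof -
  have "algebraic_int (x + 1)"
    by (rule algebraic_int_root[OF assms(2), of "[:-1, 1:]"]) (auto simp: coeff_pCons split: nat.splits)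
  then obtain a where a: "(x + 1) * cj (x + 1) = of_int a" using OK_norm_int[of "x + 1"] assms by auto
  obtain b where b: "x * cj x = of_int b" using OK_norm_int assms by blast
  have "x + cj x = (x + 1) * cj (x + 1) - x * cj x - 1" using assms by (simp add: cj_ring algebra_simps)
  also have "\<dots> = of_int (a - b - 1)" by (simp add: a b)
  finally show ?thesis by blast
qed

lemma half_norm: "(of_int u + of_int v * s) * (of_int u - of_int v * s) = of_int (u\<^sup>2 - d * v\<^sup>2)"
proof -
  have "(of_int u + of_int v * s) * (of_int u - of_int v * s) = of_int u * of_int u - of_int v * of_int v * (s * s)"
    by (simp add: algebra_simps)
  then show ?thesis by (simp add: s_sq power2_eq_square algebra_simps)
qed

lemma cj_half: "cj ((of_int u + of_int v * s) / 2) = (of_int u - of_int v * s) / 2"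
proof -
  have eq: "(of_int u + of_int v * s) / 2 = el (of_int u / 2) (of_int v / 2)"
    by (simp add: el_def of_rat_divide field_simps)
  show ?thesis unfolding eq cj_el by (simp add: el_def of_rat_divide of_rat_minus field_simps)
qed

text \<open>Integral trace and norm give half-integer coordinates when \<open>d\<close> is
  squarefree. Keeping the congruence modulo 4 as a condition covers every residue of
  \<open>d\<close> modulo 4 at once.\<close>

lemma OK_iff: "x \<in> OK \<longleftrightarrow> (\<exists>u v. x = (of_int u + of_int v * s) / 2 \<and> 4 dvd u\<^sup>2 - d * v\<^sup>2)"
proof
  assume "x \<in> OK"
  then have x: "x \<in> K" "algebraic_int x" by (auto simp: integers_of_def)
  obtain a b where ab: "x = el a b" using x K_iff by auto
  obtain u where u: "x + cj x = of_int u" using OK_trace_int x by blast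
  obtain n where n: "x * cj x = of_int n" using OK_norm_int x by blast
  have "(of_rat (2 * a) :: complex) = of_rat (of_int u)"
    using u unfolding ab cj_el by (simp add: el_def of_rat_mult of_rat_minus)
  then have a: "2 * a = of_int u" unfolding of_rat_eq_iff .
  have "(of_rat (a\<^sup>2 - of_int d * b\<^sup>2) :: complex) = of_rat (of_int n)"
    using n unfolding ab norm_el by simp
  then have "a\<^sup>2 - of_int d * b\<^sup>2 = of_int n" unfolding of_rat_eq_iff .
  then have b0: "(2 * a)\<^sup>2 - of_int d * (2 * b)\<^sup>2 = of_int (4 * n)" by (simp add: power2_eq_square algebra_simps)
  then have b1: "of_int d * (2 * b)\<^sup>2 = of_int (u\<^sup>2 - 4 * n)" unfolding a by simp
  \<comment> \<open>The square of the denominator of \<open>2 * b\<close> divides \<open>d\<close>,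
    so squarefreeness makes \<open>2 * b\<close> an integer.\<close>
  obtain p q where pq: "quotient_of (2 * b) = (p, q)" by (cases "quotient_of (2 * b)")
  have q: "q > 0" "coprime p q" "2 * b = of_int p / of_int q"
    using quotient_of_denom_pos[OF pq] quotient_of_coprime[OF pq] quotient_of_div[OF pq] by auto
  have "(of_int (d * p\<^sup>2) :: rat) = of_int ((u\<^sup>2 - 4 * n) * q\<^sup>2)"
    using b1[unfolded q(3)] q(1) by (simp add: power_divide divide_eq_eq)
  then have "d * p\<^sup>2 = (u\<^sup>2 - 4 * n) * q\<^sup>2" unfolding of_int_eq_iff .
  then have "q\<^sup>2 dvd d * p\<^sup>2" by simp
  moreover have "coprime (q\<^sup>2) (p\<^sup>2)" using q(2) by (simp add: coprime_commute)
  ultimately have "q\<^sup>2 dvd d" by (simp add: coprime_dvd_mult_left_iff)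
  then have "q dvd 1" using sqf squarefreeD by blast
  then have "q = 1" using q(1) by simp
  then have b: "2 * b = of_int p" using q by simp
  have "(of_int (u\<^sup>2 - d * p\<^sup>2) :: rat) = of_int (4 * n)" using b0 unfolding a b by simp
  then have "4 dvd u\<^sup>2 - d * p\<^sup>2" unfolding of_int_eq_iff by simp
  moreover have ab2: "a = of_int u / 2" "b = of_int p / 2" using a b by auto
  have "x = (of_int u + of_int p * s) / 2" unfolding ab ab2 by (simp add: el_def of_rat_divide add_divide_distrib)
  ultimately show "\<exists>u v. x = (of_int u + of_int v * s) / 2 \<and> 4 dvd u\<^sup>2 - d * v\<^sup>2" by blast
next
  assume "\<exists>u v. x = (of_int u + of_int v * s) / 2 \<and> 4 dvd u\<^sup>2 - d * v\<^sup>2"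
  then obtain u v n where x: "x = (of_int u + of_int v * s) / 2" and n: "u\<^sup>2 - d * v\<^sup>2 = 4 * n" by (auto elim: dvdE)
  have "x = el (of_int u / 2) (of_int v / 2)" by (simp add: x el_def of_rat_divide field_simps)
  then have "x \<in> K" by simp
  moreover have "algebraic_int x"
  proof (rule algebraic_int.intros)
    let ?p = "[:of_int n, - of_int u, 1:] :: complex poly"
    have "x * (of_int u - x) = of_int (u\<^sup>2 - d * v\<^sup>2) / 4"
      unfolding half_norm[symmetric] by (simp add: x field_simps)
    then have "x * (of_int u - x) = of_int n" unfolding n by simp
    then show "poly ?p x = 0" by (simp add: algebra_simps)
    show "lead_coeff ?p = 1" by simp
    show "\<forall>i. coeff ?p i \<in> \<int>" by (auto simp: coeff_pCons split: nat.splits)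
  qed
  ultimately show "x \<in> OK" by (simp add: integers_of_def)
qed

lemma OK_sub_K: "OK \<subseteq> K" by (auto simp: integers_of_def)

lemma R_sub_OK: "R \<subseteq> OK"
proof
  fix x assume "x \<in> R"
  then obtain u v where "x = of_int u + of_int v * s" by (auto simp: R_def)
  then have "x = (of_int (2 * u) + of_int (2 * v) * s) / 2" by simp
  moreover have "4 dvd (2 * u)\<^sup>2 - d * (2 * v)\<^sup>2" by (simp add: power_mult_distrib)
  ultimately show "x \<in> OK" unfolding OK_iff by blast
qed

lemma square_mod_4: "4 dvd (u::int)\<^sup>2 \<and> even u \<or> 4 dvd u\<^sup>2 - 1 \<and> odd u"
proof (cases "even u")
  case True
  then obtain w where "u = 2 * w" by (auto elim: evenE)
  then show ?thesis by (simp add: power_mult_distrib)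
next
  case False
  then obtain w where "u = 2 * w + 1" by (auto elim: oddE)
  then have "u\<^sup>2 - 1 = 4 * (w\<^sup>2 + w)" by (simp add: power2_eq_square algebra_simps)
  then show ?thesis using False by simp
qed

text \<open>A squarefree \<open>d\<close> is not divisible by 4, so for even \<open>d\<close> the
  congruence forces both coordinates to be even. These parities make the cross terms even in sums
  and products of elements of \<open>OK\<close>.\<close>

lemma OK_parity:
  assumes "4 dvd u\<^sup>2 - d * v\<^sup>2"
  shows "even u \<and> even v \<or> odd d \<and> (even u \<longleftrightarrow> even v)"
proof -
  have d4: "\<not> 4 dvd d" using sqf squarefreeD[of d 2] by auto
  have "2 dvd (4::int)" by simp
  then have ev: "even (u\<^sup>2 - d * v\<^sup>2)" using assms by (rule dvd_trans)
  show ?thesis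
  proof (cases "even d")
    case True
    then have eu: "even u" using ev by simp
    then have "4 dvd u\<^sup>2" using square_mod_4[of u] by auto
    then have "4 dvd u\<^sup>2 - (u\<^sup>2 - d * v\<^sup>2)" using assms by (rule dvd_diff)
    then have dv: "4 dvd d * v\<^sup>2" by simp
    have "even v"
    proof (rule ccontr)
      assume "odd v"
      then have "4 dvd v\<^sup>2 - 1" using square_mod_4[of v] by auto
      then have "4 dvd d * (v\<^sup>2 - 1)" by simp
      then have "4 dvd d * v\<^sup>2 - d * (v\<^sup>2 - 1)" using dv by (rule dvd_diff[rotated])
      then have "4 dvd d" by (simp add: algebra_simps)
      then show False using d4 by simp
    qed
    then show ?thesis using eu by simp
  next
    case False
    then show ?thesis using ev by simp
  qed
qed

lemma OK_add: assumes "x \<in> OK" "y \<in> OK" shows "x + y \<in> OK"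
proof -
  obtain u v where x: "x = (of_int u + of_int v * s) / 2" "4 dvd u\<^sup>2 - d * v\<^sup>2" using assms OK_iff by auto
  obtain u' v' where y: "y = (of_int u' + of_int v' * s) / 2" "4 dvd u'\<^sup>2 - d * v'\<^sup>2" using assms OK_iff by auto
  have "even (u * u' - d * v * v')" using OK_parity[OF x(2)] OK_parity[OF y(2)] by auto
  then obtain t where t: "u * u' - d * v * v' = 2 * t" by (rule evenE)
  have "(u + u')\<^sup>2 - d * (v + v')\<^sup>2 = (u\<^sup>2 - d * v\<^sup>2) + (u'\<^sup>2 - d * v'\<^sup>2) + 2 * (u * u' - d * v * v')"
    by (simp add: power2_eq_square algebra_simps)
  then have "4 dvd (u + u')\<^sup>2 - d * (v + v')\<^sup>2" using x(2) y(2) by (simp add: t)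
  moreover have "x + y = (of_int (u + u') + of_int (v + v') * s) / 2" by (simp add: x y field_simps)
  ultimately show ?thesis unfolding OK_iff by blast
qed

lemma OK_mult: assumes "x \<in> OK" "y \<in> OK" shows "x * y \<in> OK"
proof -
  obtain u v where x: "x = (of_int u + of_int v * s) / 2" "4 dvd u\<^sup>2 - d * v\<^sup>2" using assms OK_iff by auto
  obtain u' v' where y: "y = (of_int u' + of_int v' * s) / 2" "4 dvd u'\<^sup>2 - d * v'\<^sup>2" using assms OK_iff by auto
  have "even (u * u' + d * v * v')" "even (u * v' + v * u')"
    using OK_parity[OF x(2)] OK_parity[OF y(2)] by auto
  then obtain a b where ab: "u * u' + d * v * v' = 2 * a" "u * v' + v * u' = 2 * b" by (metis evenE)
  have "4 * (a\<^sup>2 - d * b\<^sup>2) = (2 * a)\<^sup>2 - d * (2 * b)\<^sup>2" by (simp add: power_mult_distrib)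
  also have "\<dots> = (u\<^sup>2 - d * v\<^sup>2) * (u'\<^sup>2 - d * v'\<^sup>2)"
    unfolding ab[symmetric] by (simp add: power2_eq_square algebra_simps)
  finally have n: "4 * (a\<^sup>2 - d * b\<^sup>2) = (u\<^sup>2 - d * v\<^sup>2) * (u'\<^sup>2 - d * v'\<^sup>2)" .
  have "4 * 4 dvd (u\<^sup>2 - d * v\<^sup>2) * (u'\<^sup>2 - d * v'\<^sup>2)" using x(2) y(2) by (rule mult_dvd_mono)
  then have "4 * 4 dvd 4 * (a\<^sup>2 - d * b\<^sup>2)" using n by simp
  then have "4 dvd a\<^sup>2 - d * b\<^sup>2" by (subst (asm) dvd_mult_cancel_left) auto
  moreover have "x * y = (of_int (2 * a) + of_int (2 * b) * s) / 4"
  proof -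
    have "x * y = (of_int u * of_int u' + of_int v * of_int v' * (s * s)
       + (of_int u * of_int v' + of_int v * of_int u') * s) / 4" by (simp add: x y field_simps)
    then show ?thesis unfolding s_sq ab[symmetric] by (simp add: algebra_simps)
  qed
  moreover have "(of_int (2 * a) + of_int (2 * b) * s) / 4 = (of_int a + of_int b * s) / 2"
    by (simp add: field_simps)
  ultimately show ?thesis unfolding OK_iff by metis
qed

lemma OK_cj: "x \<in> OK \<Longrightarrow> cj x \<in> OK"
proof -
  assume "x \<in> OK"
  then obtain u v where x: "x = (of_int u + of_int v * s) / 2" "4 dvd u\<^sup>2 - d * v\<^sup>2" using OK_iff by auto
  have "cj x = (of_int u + of_int (- v) * s) / 2" by (simp add: x cj_half)
  moreover have "4 dvd u\<^sup>2 - d * (- v)\<^sup>2" using x by simp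
  ultimately show ?thesis unfolding OK_iff by blast
qed

lemma OK_consts [simp]: "of_int n \<in> OK" "0 \<in> OK" "1 \<in> OK" "s \<in> OK"
  using R_sub_OK R_consts by blast+

lemma OK_add_closed: "add_closed OK" by (simp add: add_closed_def OK_add)

lemma OK_rational: assumes "of_rat q \<in> OK" shows "\<exists>n::int. q = of_int n"
proof -
  have "(of_rat q :: complex) \<in> \<int>"
    using assms by (intro rational_algebraic_int_is_int) (auto simp: integers_of_def)
  then obtain n :: int where "(of_rat q :: complex) = of_rat (of_int n)" by (auto elim: Ints_cases)
  then show ?thesis unfolding of_rat_eq_iff by blast
qed

end

section \<open>Ideals above split primes and their powers\<close>

text \<open>\<open>r\<close> is a square root of \<open>d\<close> modulo \<open>p\<close>;
  coprimality with \<open>2 * r\<close> excludes \<open>p = 2\<close> and ramified primes. The value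
  \<open>p = 1\<close> qualifies as well, and this is how the trivial bound on the torsion
  arises.\<close>

definition split_pair :: "int \<Rightarrow> int \<Rightarrow> int \<Rightarrow> bool" where
  "split_pair d p r \<longleftrightarrow> p > 0 \<and> p dvd r\<^sup>2 - d \<and> coprime p (2 * r)"

context real_quadratic begin

text \<open>For \<open>p\<close> an odd split prime and \<open>r\<^sup>2 = d\<close> modulo \<open>p\<close>, this is the ideal of \<open>\<int>[\<surd>d]\<close> of norm \<open>p\<close>; \<open>p = 1\<close> gives \<open>\<int>[\<surd>d]\<close> itself.\<close>

definition pideal :: "int \<Rightarrow> int \<Rightarrow> complex set" where
  "pideal p r = {of_int p * x + (of_int r + s) * y | x y. x \<in> R \<and> y \<in> R}"

lemma pideal_R: "x \<in> R \<Longrightarrow> a \<in> pideal p r \<Longrightarrow> x * a \<in> pideal p r"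
proof -
  assume "x \<in> R" "a \<in> pideal p r"
  then obtain y z where *: "a = of_int p * y + (of_int r + s) * z" "y \<in> R" "z \<in> R" by (auto simp: pideal_def)
  then have "x * a = of_int p * (x * y) + (of_int r + s) * (x * z)" by (simp add: algebra_simps)
  then show ?thesis unfolding pideal_def using * \<open>x \<in> R\<close> R_mult by blast
qed

lemma pideal_memI: "of_int p \<in> pideal p r" "of_int r + s \<in> pideal p r"
proof -
  have "of_int p = of_int p * 1 + (of_int r + s) * 0" "of_int r + s = of_int p * 0 + (of_int r + s) * 1" by auto
  then show "of_int p \<in> pideal p r" "of_int r + s \<in> pideal p r"
    unfolding pideal_def using R_consts(2,3) by blast+
qed

lemma pideal_sub_R: "pideal p r \<subseteq> R"
  by (auto simp: pideal_def intro!: R_add R_mult)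

lemma cj_R: "x \<in> R \<Longrightarrow> cj x \<in> R"
proof -
  assume "x \<in> R"
  then obtain u v where "x = of_int u + of_int v * s" by (auto simp: R_def)
  then have "cj x = of_int u + of_int (- v) * s" by (simp add: cj_ring)
  then show ?thesis using R_memI by metis
qed

text \<open>The products of generators are p^2, p(r + s), p(r - s) and r^2 - d, all divisible by p.
  Conversely the product contains p^2 and p * 2r, whose greatest common divisor is p because p is
  coprime to 2r.\<close>

lemma pideal_mult_cj:
  assumes "split_pair d p r"
  shows "ideal_mult (pideal p r) (cj ` pideal p r) = (*) (of_int p) ` R"
proof
  obtain m where m: "r\<^sup>2 - d = p * m" using assms by (auto simp: split_pair_def elim: dvdE)
  have rs: "(of_int r + s) * (of_int r - s) = of_int p * of_int m"
  proof -
    have "(of_int r + s) * (of_int r - s) = of_int r * of_int r - s * s" by (simp add: algebra_simps)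
    then show ?thesis unfolding s_sq using m by (simp add: power2_eq_square flip: of_int_mult of_int_diff)
  qed
  have ac: "add_closed ((*) (of_int p) ` R)"
    unfolding add_closed_def
  proof (intro conjI ballI)
    show "0 \<in> (*) (of_int p) ` R" using R_consts(2) by (metis image_eqI mult_zero_right)
    fix x y assume "x \<in> (*) (of_int p) ` R" "y \<in> (*) (of_int p) ` R"
    then show "x + y \<in> (*) (of_int p) ` R" by (auto simp: distrib_left[symmetric] intro!: imageI R_add)
  qed
  show "ideal_mult (pideal p r) (cj ` pideal p r) \<subseteq> (*) (of_int p) ` R"
  proof (rule ideal_mult_subset[OF ac])
    fix a b assume "a \<in> pideal p r" "b \<in> cj ` pideal p r"
    then obtain x y x' y' where *: "a = of_int p * x + (of_int r + s) * y" 
      "b = cj (of_int p * x' + (of_int r + s) * y')"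
      "x \<in> R" "y \<in> R" "x' \<in> R" "y' \<in> R" by (auto simp: pideal_def)
    have K: "x' \<in> K" "y' \<in> K" using * R_sub_K by auto
    have b: "b = of_int p * cj x' + (of_int r - s) * cj y'" using * K by (simp add: cj_ring)
    have "a * b = of_int p * (x * (of_int p * cj x' + (of_int r - s) * cj y') + (of_int r + s) * y * cj x')
      + ((of_int r + s) * (of_int r - s)) * (y * cj y')" by (simp add: *(1) b algebra_simps)
    also have "\<dots> = of_int p * (x * (of_int p * cj x' + (of_int r - s) * cj y') + (of_int r + s) * y * cj x')
      + (of_int p * of_int m) * (y * cj y')" by (simp only: rs)
    also have "\<dots> = of_int p * (x * b + (of_int r + s) * y * cj x' + of_int m * (y * cj y'))"
      by (simp add: b algebra_simps)
    finally have ab: "a * b = of_int p * (x * b + (of_int r + s) * y * cj x' + of_int m * (y * cj y'))" .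
    have "of_int r - s = cj (of_int r + s)" by (simp add: cj_ring)
    then have "of_int r - s \<in> R" using cj_R R_add by simp
    then have "x * b + (of_int r + s) * y * cj x' + of_int m * (y * cj y') \<in> R"
      unfolding b using * by (intro R_add R_mult cj_R R_consts) auto
    then show "a * b \<in> (*) (of_int p) ` R" unfolding ab by blast
  qed
  let ?P = "ideal_mult (pideal p r) (cj ` pideal p r)"
  have acP: "add_closed ?P" by (rule add_closed_ideal_mult)
  have Rx: "z * x \<in> ?P" if "z \<in> R" "x \<in> ?P" for z x
  proof -
    have "?P \<subseteq> {x. x * z \<in> ?P}"
    proof (rule ideal_mult_subset[OF add_closed_vimage[OF acP]])
      fix x y assume "x \<in> pideal p r" "y \<in> cj ` pideal p r"
      then have "(z * x) * y \<in> ?P" using pideal_R that by (intro ideal_mult_memI) auto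
      then show "x * y \<in> {x. x * z \<in> ?P}" by (simp add: mult_ac)
    qed
    then show ?thesis using that by (auto simp: mult.commute)
  qed
  have cjp: "of_int p \<in> cj ` pideal p r" "of_int r - s \<in> cj ` pideal p r"
    using imageI[OF pideal_memI(1), of cj] imageI[OF pideal_memI(2), of cj] by (auto simp: cj_ring)
  have 1: "of_int p * of_int p \<in> ?P" using pideal_memI cjp by (intro ideal_mult_memI)
  have 2: "(of_int r + s) * of_int p + of_int p * (of_int r - s) \<in> ?P"
    using acP ideal_mult_memI[OF pideal_memI(2) cjp(1)] ideal_mult_memI[OF pideal_memI(1) cjp(2)]
    by (auto simp: add_closed_def)
  have "coprime p (2 * r)" using assms by (simp add: split_pair_def)
  then obtain x y where xy: "x * p + y * (2 * r) = 1" by (metis bezout_int coprime_imp_gcd_eq_1)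
  have "of_int x * (of_int p * of_int p) + of_int y * ((of_int r + s) * of_int p + of_int p * (of_int r - s)) \<in> ?P"
    using Rx[OF R_consts(1) 1] Rx[OF R_consts(1) 2] acP by (auto simp: add_closed_def)
  also have "of_int x * (of_int p * of_int p) + of_int y * ((of_int r + s) * of_int p + of_int p * (of_int r - s))
     = of_int p * of_int (x * p + y * (2 * r))" by (simp add: algebra_simps)
  finally have "of_int p \<in> ?P" using xy by simp
  then show "(*) (of_int p) ` R \<subseteq> ?P" using Rx by (auto simp: mult.commute)
qed

text \<open>The exponent \<open>0\<close> gives the unit of the group of fractional ideals, so \<open>ipow\<close> of a
  \<open>\<int>[\<surd>d]\<close>-module is automatically a module over the maximal order.\<close>

fun ipow :: "complex set \<Rightarrow> nat \<Rightarrow> complex set" where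
  "ipow I 0 = OK" | "ipow I (Suc n) = ideal_mult (ipow I n) I"

lemma scale_scale: "(*) a ` (*) b ` S = (*) (a * b) ` (S :: complex set)"
  by (simp add: image_image mult.assoc)

lemma OK_OK: "ideal_mult OK OK = OK"
  by (rule ideal_mult_absorb) (auto simp: OK_add_closed OK_mult)

lemma R_OK: "ideal_mult OK R = OK"
  unfolding ideal_mult_comm[of OK]
  by (rule ideal_mult_absorb) (use R_sub_OK in \<open>auto simp: OK_add_closed OK_mult\<close>)

lemma ipow_mult: "ipow (ideal_mult I J) n = ideal_mult (ipow I n) (ipow J n)"
proof (induction n)
  case (Suc n)
  then show ?case by (simp add: ideal_mult_assoc) (metis ideal_mult_assoc ideal_mult_comm)
qed (simp add: OK_OK)

lemma ipow_scale: "ipow ((*) a ` I) n = (*) (a ^ n) ` ipow I n"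
proof (induction n)
  case (Suc n)
  show ?case
    unfolding ipow.simps Suc ideal_mult_scale ideal_mult_scale_right image_image power_Suc
    by (simp add: mult.left_commute mult.assoc)
qed simp

lemma ipow_R: "ipow R n = OK"
  by (induction n) (simp_all add: R_OK)

lemma OK_ipow: "ideal_mult OK (ipow I n) = ipow I n"
  by (induction n) (simp_all add: OK_OK ideal_mult_assoc[symmetric])

lemma cj_OK: "cj ` OK = OK"
proof
  show "cj ` OK \<subseteq> OK" using OK_cj by auto
  show "OK \<subseteq> cj ` OK"
  proof
    fix x assume "x \<in> OK"
    then show "x \<in> cj ` OK" using OK_sub_K OK_cj by (metis cj_cj image_eqI subsetD)
  qed
qed

lemma K_add_closed: "add_closed K" by (simp add: add_closed_def)

lemma ideal_mult_K: "I \<subseteq> K \<Longrightarrow> J \<subseteq> K \<Longrightarrow> ideal_mult I J \<subseteq> K"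
  by (rule ideal_mult_subset[OF K_add_closed]) auto

lemma ipow_K: "I \<subseteq> K \<Longrightarrow> ipow I n \<subseteq> K"
  by (induction n) (auto simp: OK_sub_K ideal_mult_K)

lemma add_closed_cj: "add_closed S \<Longrightarrow> S \<subseteq> K \<Longrightarrow> add_closed (cj ` S)"
  unfolding add_closed_def
proof (intro conjI ballI; elim conjE)
  assume S: "S \<subseteq> K"
  assume "0 \<in> S"
  then show "0 \<in> cj ` S" by (metis cj_const(3) image_eqI)
next
  fix x y assume S: "S \<subseteq> K" "\<forall>x\<in>S. \<forall>y\<in>S. x + y \<in> S" and xy: "x \<in> cj ` S" "y \<in> cj ` S"
  from xy obtain a b where ab: "x = cj a" "y = cj b" "a \<in> S" "b \<in> S" by auto
  then have "x + y = cj (a + b)" using S by (subst cj_ring) auto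
  then show "x + y \<in> cj ` S" using S ab by blast
qed

lemma cj_ideal_mult: 
  assumes "I \<subseteq> K" "J \<subseteq> K"
  shows "cj ` ideal_mult I J = ideal_mult (cj ` I) (cj ` J)"
proof -
  have *: "ideal_mult (cj ` I) (cj ` J) \<subseteq> cj ` ideal_mult I J" if "I \<subseteq> K" "J \<subseteq> K" for I J
  proof (rule ideal_mult_subset)
    show "add_closed (cj ` ideal_mult I J)"
      by (intro add_closed_cj add_closed_ideal_mult ideal_mult_K that)
    fix x y assume "x \<in> cj ` I" "y \<in> cj ` J"
    then obtain a b where ab: "x = cj a" "y = cj b" "a \<in> I" "b \<in> J" by auto
    then have "x * y = cj (a * b)" using that by (subst cj_ring) auto
    then show "x * y \<in> cj ` ideal_mult I J" using ab ideal_mult_memI by blast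
  qed
  have cc: "cj ` cj ` S = S" if "S \<subseteq> K" for S
    using that by (force simp: image_image)
  have cK: "cj ` S \<subseteq> K" if "S \<subseteq> K" for S using that by auto
  have "ideal_mult I J = ideal_mult (cj ` cj ` I) (cj ` cj ` J)" by (simp add: cc assms)
  also have "\<dots> \<subseteq> cj ` ideal_mult (cj ` I) (cj ` J)" by (intro * cK assms)
  finally have "cj ` ideal_mult I J \<subseteq> cj ` cj ` ideal_mult (cj ` I) (cj ` J)" by blast
  also have "\<dots> = ideal_mult (cj ` I) (cj ` J)" by (intro cc ideal_mult_K cK assms)
  finally show ?thesis using *[OF assms] by blast
qed

lemma cj_ipow: "I \<subseteq> K \<Longrightarrow> cj ` ipow I n = ipow (cj ` I) n"
  by (induction n) (auto simp: cj_OK cj_ideal_mult ipow_K)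

lemma cj_scale: "a \<in> K \<Longrightarrow> S \<subseteq> K \<Longrightarrow> cj ` (*) a ` S = (*) (cj a) ` cj ` S"
  by (force simp: image_image cj_ring intro!: image_cong)

lemma pideal_K: "pideal p r \<subseteq> K" using pideal_sub_R R_sub_K by blast

lemma ipow_pideal_cj:
  assumes "split_pair d p r"
  shows "ideal_mult (ipow (pideal p r) n) (cj ` ipow (pideal p r) n) = (*) (of_int p ^ n) ` OK"
  by (simp add: cj_ipow pideal_K ipow_mult[symmetric] pideal_mult_cj[OF assms] ipow_scale ipow_R)

text \<open>Multiplying each side of \<open>eq\<close> by its conjugate turns it into an equality of
  ideals generated by rational numbers, q^n and N(b) p^n. These agree up to sign, which gives the
  absolute norm of b p^n.\<close>

lemma collision_norm:
  assumes b: "b \<in> K" and sp: "split_pair d p r" "split_pair d q t"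
    and eq: "(*) b ` ipow (pideal p r) n = ipow (pideal q t) n"
  shows "b * of_int p ^ n \<in> OK"
    and "norm (b * of_int p ^ n) * norm (cj (b * of_int p ^ n)) = real_of_int (p * q) ^ n"
proof -
  have pm: "of_int p ^ k \<in> ipow (pideal p r) k" for k
    by (induction k) (auto simp: mult.commute[of "of_int p"] intro!: ideal_mult_memI pideal_memI)
  have "ipow (pideal q t) k \<subseteq> OK" for k
  proof (induction k)
    case (Suc k)
    have "pideal q t \<subseteq> OK" using pideal_sub_R R_sub_OK by blast
    then show ?case unfolding ipow.simps
      by (intro ideal_mult_subset[OF OK_add_closed] OK_mult) (use Suc in blast)+
  qed simp
  then show "b * of_int p ^ n \<in> OK" using eq pm[of n] by blast
  have p0: "p > 0" "q > 0" using sp by (auto simp: split_pair_def)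
  let ?P = "ipow (pideal p r) n" and ?Q = "ipow (pideal q t) n"
  obtain y where y: "b * cj b = of_rat y" using norm_rat b by blast
  have PK: "?P \<subseteq> K" by (intro ipow_K pideal_K)
  have "(*) (of_int q ^ n) ` OK = ideal_mult ?Q (cj ` ?Q)" using ipow_pideal_cj[OF sp(2)] by simp
  also have "\<dots> = ideal_mult ((*) b ` ?P) ((*) (cj b) ` cj ` ?P)"
    unfolding eq[symmetric] by (simp add: cj_scale b PK)
  also have "\<dots> = (*) (b * cj b) ` ideal_mult ?P (cj ` ?P)"
    by (simp only: ideal_mult_scale ideal_mult_scale_right scale_scale mult.commute)
  also have "\<dots> = (*) (of_rat y * of_int p ^ n) ` OK"
    by (simp add: ipow_pideal_cj[OF sp(1)] image_image mult_ac y)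
  finally have E: "(*) (of_int q ^ n) ` OK = (*) (of_rat y * of_int p ^ n) ` OK" .
  \<comment> \<open>Both \<open>w\<close> and its inverse turn out to be rational algebraic
    integers, so \<open>w\<close> is 1 or -1.\<close>
  define w where "w = y * of_int p ^ n / of_int q ^ n"
  have w: "of_rat w * of_int q ^ n = (of_rat y * of_int p ^ n :: complex)"
    using p0 by (simp add: w_def of_rat_divide of_rat_mult of_rat_power)
  have "of_rat w \<in> OK"
  proof -
    have "of_rat y * of_int p ^ n * 1 \<in> (*) (of_int q ^ n) ` OK" unfolding E by (rule imageI) simp
    then obtain z where "z \<in> OK" "of_rat w * of_int q ^ n = of_int q ^ n * z" using w by auto
    then show ?thesis using p0 by auto
  qed
  then obtain n1 where n1: "w = of_int n1" using OK_rational by blast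
  have "of_int q ^ n * 1 \<in> (*) (of_rat y * of_int p ^ n) ` OK" unfolding E[symmetric] by (rule imageI) simp
  then obtain z where z: "z \<in> OK" "of_int q ^ n = of_rat w * of_int q ^ n * z" using w by auto
  then have wz: "of_rat w * z = 1" using p0 by (simp add: mult_ac) 
  then have "z = inverse (of_rat w)" by (metis inverse_unique)
  then have "of_rat (inverse w) \<in> OK" using z by (simp add: of_rat_inverse)
  then obtain n2 where n2: "inverse w = of_int n2" using OK_rational by blast
  have "w \<noteq> 0" using wz by auto
  then have "w * inverse w = 1" by simp
  then have "(of_int (n1 * n2) :: rat) = of_int 1" using n1 n2 by simp
  then have "n1 * n2 = 1" unfolding of_int_eq_iff .
  then have "\<bar>n1\<bar> = 1" by (metis abs_one abs_zmult_eq_1)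
  then have nw: "norm (of_rat w :: complex) = 1" by (simp add: n1 flip: of_int_abs)
  have "cj (b * of_int p ^ n) = cj b * of_int p ^ n" using b cj_power[of "of_int p" n] by (simp add: cj_ring)
  then have "(b * of_int p ^ n) * cj (b * of_int p ^ n) = (b * cj b) * of_int p ^ n * of_int p ^ n"
    by (simp add: mult_ac)
  also have "\<dots> = of_rat w * of_int q ^ n * of_int p ^ n" unfolding y w by simp
  finally have "norm (b * of_int p ^ n) * norm (cj (b * of_int p ^ n)) = norm (of_rat w * of_int q ^ n * of_int p ^ n :: complex)"
    by (simp only: norm_mult[symmetric])
  then show "norm (b * of_int p ^ n) * norm (cj (b * of_int p ^ n)) = real_of_int (p * q) ^ n"
    using p0 nw by (simp add: norm_mult norm_power power_mult_distrib mult_ac)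
qed

end

section \<open>Reduced modules and binary quadratic forms\<close>

text \<open>A pair stands for the form k x^2 + 2b xy + ((b^2 - d)/k) y^2 of discriminant 4d, taken
  up to the shift of b by multiples of k. The bound k \<le> 2 sqrt d is the one that reducedness
  provides.\<close>

definition forms :: "int \<Rightarrow> (int \<times> int) set" where
  "forms d = {(k, b). 1 \<le> k \<and> k\<^sup>2 \<le> 4 * d \<and> 0 \<le> b \<and> b < k \<and> k dvd d - b\<^sup>2}"

context real_quadratic begin

definition module :: "complex set \<Rightarrow> bool" where
  "module J \<longleftrightarrow> J \<subseteq> K \<and> add_closed J \<and> (\<forall>r\<in>R. \<forall>x\<in>J. r * x \<in> J) \<and> (\<exists>x\<in>J. x \<noteq> 0) \<and>
     (\<exists>c\<in>OK. c \<noteq> 0 \<and> (\<forall>x\<in>J. c * x \<in> OK))"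

lemma module_ideal_mult:
  assumes "fractional_ideal K I" "p > 0"
  shows "module (ideal_mult I (pideal p r))"
proof -
  have IK: "I \<subseteq> K" and ac: "add_closed I" and OI: "\<And>r x. r \<in> OK \<Longrightarrow> x \<in> I \<Longrightarrow> r * x \<in> I" and "I \<noteq> {0}" "0 \<in> I"
    using assms by (auto simp: fractional_ideal_def add_closed_def)
  obtain c where c: "c \<in> OK" "c \<noteq> 0" "\<And>x. x \<in> I \<Longrightarrow> c * x \<in> OK"
    using assms(1) unfolding fractional_ideal_def by blast
  obtain x where x: "x \<in> I" "x \<noteq> 0" using \<open>I \<noteq> {0}\<close> \<open>0 \<in> I\<close> by blast
  have sub: "ideal_mult I (pideal p r) \<subseteq> I"
    by (rule ideal_mult_subset[OF ac]) (metis OI R_sub_OK mult.commute pideal_sub_R subsetD)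
  let ?J = "ideal_mult I (pideal p r)"
  have "x * of_int p \<in> ?J" by (intro ideal_mult_memI x pideal_memI)
  moreover have "x * of_int p \<noteq> 0" using x assms by simp
  moreover have "z * y \<in> ?J" if "z \<in> R" "y \<in> ?J" for z y
  proof -
    have "?J \<subseteq> {y. y * z \<in> ?J}"
    proof (rule ideal_mult_subset[OF add_closed_vimage[OF add_closed_ideal_mult]])
      fix a b assume "a \<in> I" "b \<in> pideal p r"
      then have "(z * a) * b \<in> ?J" using OI R_sub_OK that by (intro ideal_mult_memI) auto
      then show "a * b \<in> {y. y * z \<in> ?J}" by (simp add: mult_ac)
    qed
    then show ?thesis using that by (auto simp: mult.commute)
  qed
  ultimately show ?thesis unfolding module_def
    using add_closed_ideal_mult IK sub c by blast
qed

lemma finite_OK_bounded: "finite {x \<in> OK. norm x \<le> B \<and> norm (cj x) \<le> B}"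
proof -
  define N where "N = \<lceil>2 * B\<rceil>"
  have "{x \<in> OK. norm x \<le> B \<and> norm (cj x) \<le> B} \<subseteq>
    (\<lambda>(u, v). (of_int u + of_int v * s) / 2) ` ({- N..N} \<times> {- N..N})"
  proof (clarsimp)
    fix x assume x: "x \<in> OK" "norm x \<le> B" "norm (cj x) \<le> B"
    obtain u v where uv: "x = (of_int u + of_int v * s) / 2" using x OK_iff by auto
    have "of_int u = x + cj x" by (simp add: uv cj_half field_simps)
    then have "\<bar>real_of_int u\<bar> \<le> 2 * B" using norm_triangle_ineq[of x "cj x"] x by (metis norm_of_int add_mono mult_2 order_trans)
    then have u: "u \<in> {- N..N}" unfolding N_def by (simp add: abs_le_iff) linarith
    have "of_int v * s = x - cj x" by (simp add: uv cj_half field_simps)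
    then have "norm (of_int v * s) \<le> 2 * B" using norm_triangle_ineq4[of x "cj x"] x by (metis add_mono mult_2 order_trans)
    then have "\<bar>real_of_int v\<bar> * sqrt (real_of_int d) \<le> 2 * B" by (simp add: norm_mult norm_s)
    moreover have "\<bar>real_of_int v\<bar> * 1 \<le> \<bar>real_of_int v\<bar> * sqrt (real_of_int d)"
      using d_gt by (intro mult_left_mono) auto
    ultimately have "\<bar>real_of_int v\<bar> \<le> 2 * B" by simp
    then have v: "v \<in> {- N..N}" unfolding N_def by (simp add: abs_le_iff) linarith
    show "x \<in> (\<lambda>(u, v). (of_int u + of_int v * s) / 2) ` ({- N..N} \<times> {- N..N})"
      using u v uv by (intro image_eqI[of _ _ "(u, v)"]) auto
  qed
  then show ?thesis by (rule finite_subset) auto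
qed

text \<open>The \<open>l\<close>-th power of a sup norm over the two real embeddings, where the
  scale at each embedding is the \<open>l\<close>-th root of the size of \<alpha> there. Staying
  with \<open>l\<close>-th powers avoids extracting that root.\<close>

definition weight :: "nat \<Rightarrow> complex \<Rightarrow> complex \<Rightarrow> real" where
  "weight l \<alpha> y = max (norm y ^ l / norm \<alpha>) (norm (cj y) ^ l / norm (cj \<alpha>))"

lemma power_le_imp_le_max: "x \<ge> 0 \<Longrightarrow> l \<ge> 1 \<Longrightarrow> x ^ l \<le> M \<Longrightarrow> x \<le> max 1 (M::real)"
  by (metis linorder_le_cases max.coboundedI1 max.coboundedI2 order_trans power_increasing power_one_right)

lemma exists_minimal:
  assumes J: "module J" and l: "l \<ge> 1" and a: "\<alpha> \<in> K" "\<alpha> \<noteq> 0"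
  shows "\<exists>x\<in>J. x \<noteq> 0 \<and> (\<forall>y\<in>J. y \<noteq> 0 \<longrightarrow> weight l \<alpha> x \<le> weight l \<alpha> y)"
proof -
  obtain c where c: "c \<in> OK" "c \<noteq> 0" "\<And>x. x \<in> J \<Longrightarrow> c * x \<in> OK" using J by (auto simp: module_def)
  have JK: "J \<subseteq> K" using J by (auto simp: module_def)
  obtain y0 where y0: "y0 \<in> J" "y0 \<noteq> 0" using J by (auto simp: module_def)
  define S where "S = {y \<in> J. y \<noteq> 0 \<and> weight l \<alpha> y \<le> weight l \<alpha> y0}"
  \<comment> \<open>\<open>max 1\<close> stands in for an \<open>l\<close>-th root: t^l \<le> m
    implies t \<le> max 1 m, and a crude bound is enough for finiteness.\<close>
  define M where "M = max 1 (weight l \<alpha> y0 * max (norm \<alpha>) (norm (cj \<alpha>)))"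
  define B where "B = max (norm c) (norm (cj c)) * M"
  have na: "norm \<alpha> > 0" "norm (cj \<alpha>) > 0" using a by auto
  have w0: "weight l \<alpha> y0 \<ge> 0" using na by (auto simp: weight_def le_max_iff_disj)
  have "(*) c ` S \<subseteq> {x \<in> OK. norm x \<le> B \<and> norm (cj x) \<le> B}"
  proof clarsimp
    fix y assume "y \<in> S"
    then have y: "y \<in> J" "weight l \<alpha> y \<le> weight l \<alpha> y0" by (auto simp: S_def)
    then have "norm y ^ l \<le> weight l \<alpha> y0 * norm \<alpha>" "norm (cj y) ^ l \<le> weight l \<alpha> y0 * norm (cj \<alpha>)"
      using na by (auto simp: weight_def[of _ _ y] divide_le_eq)
    moreover have "weight l \<alpha> y0 * norm \<alpha> \<le> weight l \<alpha> y0 * max (norm \<alpha>) (norm (cj \<alpha>))"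
      "weight l \<alpha> y0 * norm (cj \<alpha>) \<le> weight l \<alpha> y0 * max (norm \<alpha>) (norm (cj \<alpha>))"
      using w0 by (auto intro!: mult_left_mono)
    ultimately have "norm y \<le> M" "norm (cj y) \<le> M"
      unfolding M_def by (meson l norm_ge_zero order_trans power_le_imp_le_max)+
    moreover have "M \<ge> 0" by (auto simp: M_def)
    moreover have "cj (c * y) = cj c * cj y" using c y JK OK_sub_K by (intro cj_ring) auto
    ultimately show "c * y \<in> OK \<and> norm (c * y) \<le> B \<and> norm (cj (c * y)) \<le> B"
      using c(3)[OF y(1)] unfolding B_def by (auto simp: norm_mult le_max_iff_disj intro!: mult_mono)
  qed
  then have "finite ((*) c ` S)" using finite_OK_bounded finite_subset by blast
  then have fin: "finite S" by (rule finite_imageD) (use c in \<open>auto simp: inj_on_def\<close>)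
  have "S \<noteq> {}" using y0 by (auto simp: S_def)
  then have "Min (weight l \<alpha> ` S) \<in> weight l \<alpha> ` S" using fin by (intro Min_in) auto
  then obtain x where x: "x \<in> S" "weight l \<alpha> x = Min (weight l \<alpha> ` S)" by (metis imageE)
  have "weight l \<alpha> x \<le> weight l \<alpha> y" if "y \<in> J" "y \<noteq> 0" for y
  proof (cases "y \<in> S")
    case True
    then show ?thesis unfolding x(2) using fin by (intro Min_le) auto
  next
    case False
    then show ?thesis using x(1) that by (auto simp: S_def)
  qed
  then show ?thesis using x by (auto simp: S_def)
qed

lemma module_scale:
  assumes "module J" "a \<in> K" "a \<noteq> 0"
  shows "module ((*) a ` J)"
proof -
  have J: "J \<subseteq> K" "add_closed J" "\<And>r x. r\<in>R \<Longrightarrow> x\<in>J \<Longrightarrow> r * x \<in> J" using assms by (auto simp: module_def)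
  obtain x where x: "x \<in> J" "x \<noteq> 0" using assms by (auto simp: module_def)
  obtain c where c: "c \<in> OK" "c \<noteq> 0" "\<And>x. x \<in> J \<Longrightarrow> c * x \<in> OK" using assms by (auto simp: module_def)
  obtain m where m: "m > 0" "of_int m * inverse a \<in> R" using K_denominator[of "inverse a"] assms by auto
  show ?thesis unfolding module_def
  proof (intro conjI)
    show "(*) a ` J \<subseteq> K" using J(1) assms by auto
    show "add_closed ((*) a ` J)" using J(2) unfolding add_closed_def
      by (auto simp: distrib_left[symmetric])
    show "\<forall>r\<in>R. \<forall>x\<in>(*) a ` J. r * x \<in> (*) a ` J"
      using J(3) by (auto simp: mult.left_commute)
    show "\<exists>x\<in>(*) a ` J. x \<noteq> 0" using x assms by auto
    let ?c = "(of_int m * inverse a) * c"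
    have "?c \<in> OK" by (rule OK_mult) (use m R_sub_OK c in auto)
    moreover have "?c \<noteq> 0" using m c assms by simp
    moreover have "?c * x \<in> OK" if x: "x \<in> (*) a ` J" for x
    proof -
      obtain y where y: "x = a * y" "y \<in> J" using x by auto
      have eq: "?c * x = of_int m * (c * y)" using assms by (simp add: y)
      show ?thesis unfolding eq using c y by (simp add: OK_mult)
    qed
    ultimately show "\<exists>c\<in>OK. c \<noteq> 0 \<and> (\<forall>x\<in>(*) a ` J. c * x \<in> OK)" by blast
  qed
qed

text \<open>\<open>1\<close> is a minimum of the lattice \<open>F\<close> in the sense of Lagrange
  and Voronoi: the open unit box of the two embeddings meets \<open>F\<close> only in
  \<open>0\<close>.\<close>

definition reduced :: "complex set \<Rightarrow> bool" where
  "reduced F \<longleftrightarrow> module F \<and> 1 \<in> F \<and> (\<forall>f\<in>F. norm f < 1 \<longrightarrow> norm (cj f) < 1 \<longrightarrow> f = 0)"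

definition form_module :: "int \<Rightarrow> int \<Rightarrow> complex set" where
  "form_module k b = {of_int m + of_int n * ((of_int b + s) / of_int k) | m n. True}"

lemma norm_of_rat: "norm (of_rat t :: complex) = \<bar>of_rat t :: real\<bar>"
  by (cases t) (simp add: of_rat_rat norm_divide)

text \<open>Reducedness makes the rational elements of \<open>F\<close> integers, so
  \<open>F\<close> is spanned by 1 and one element (b + s)/k. Divisibility of d - b^2 by k expresses
  closure under multiplication by \<open>s\<close>, and the size of \<open>k\<close> comes from
  reducedness again.\<close>

lemma reduced_form:
  assumes F: "reduced F"
  shows "\<exists>(k, b) \<in> forms d. F = form_module k b"
proof -
  have FK: "F \<subseteq> K" and ac: "add_closed F" and FR: "\<And>r x. r\<in>R \<Longrightarrow> x\<in>F \<Longrightarrow> r * x \<in> F" and F1: "1 \<in> F"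
    and red: "\<And>f. f \<in> F \<Longrightarrow> norm f < 1 \<Longrightarrow> norm (cj f) < 1 \<Longrightarrow> f = 0"
    using F by (auto simp: reduced_def module_def)
  obtain c where c: "c \<in> OK" "c \<noteq> 0" "\<And>x. x \<in> F \<Longrightarrow> c * x \<in> OK" using F by (auto simp: reduced_def module_def)
  have Fadd: "x + y \<in> F" if "x \<in> F" "y \<in> F" for x y using ac that by (auto simp: add_closed_def)
  have Fdiff: "x - y \<in> F" if "x \<in> F" "y \<in> F" for x y
    using Fadd[OF that(1) FR[OF R_minus[OF R_consts(3)] that(2)]] by simp
  have FZ: "of_int n \<in> F" for n using FR[OF R_consts(1) F1] by simp
  \<comment> \<open>The fractional part of a rational element of \<open>F\<close> is its own
    conjugate and is smaller than 1, so it vanishes.\<close>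
  have FQ: "\<exists>n::int. t = of_int n" if "of_rat t \<in> F" for t
  proof -
    let ?f = "of_rat (frac t) :: complex"
    have "?f = of_rat t - of_int \<lfloor>t\<rfloor>" by (simp add: frac_def of_rat_diff)
    then have "?f \<in> F" using Fdiff[OF that FZ] by simp
    moreover have "norm ?f < 1"
    proof -
      have "norm ?f = \<bar>of_rat (frac t) :: real\<bar>" by (rule norm_of_rat)
      then show ?thesis using frac_lt_1[of t] frac_ge_0[of t] by (metis abs_of_nonneg of_rat_less_1_iff zero_le_of_rat_iff)
    qed
    ultimately have "?f = 0" using red[of ?f] unfolding cj_const(2) by blast
    then have "frac t = 0" by simp
    then show ?thesis by (auto simp: frac_eq_0_iff elim: Ints_cases)
  qed
  obtain n0 where n0: "c * cj c = of_int n0" using OK_norm_int c by (auto simp: integers_of_def)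
  define N where "N = 2 * n0"
  have cK: "c \<in> K" using c OK_sub_K by auto
  have N0: "N \<noteq> 0" using n0 c cK by (auto simp: N_def)
  have NF: "\<exists>u v. f = (of_int u + of_int v * s) / of_int N" if f: "f \<in> F" for f
  proof -
    have "cj c * (c * f) \<in> OK" by (rule OK_mult) (use c OK_cj f in auto)
    then obtain u v where "cj c * (c * f) = (of_int u + of_int v * s) / 2" unfolding OK_iff by auto
    then have "of_int n0 * f = (of_int u + of_int v * s) / 2" unfolding n0[symmetric] by (simp only: mult_ac)
    then have "f = (of_int u + of_int v * s) / of_int N" using N0 by (simp add: N_def field_simps)
    then show ?thesis by blast
  qed
  \<comment> \<open>\<open>V\<close> collects the numerators of the \<open>s\<close>-coordinates
    over the common denominator \<open>N\<close>. It is a subgroup of the integers, and its least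
    positive element supplies the second basis vector.\<close>
  define V where "V = {v. \<exists>u. (of_int u + of_int v * s) / of_int N \<in> F}"
  have sF: "s \<in> F" using FR[OF R_consts(4) F1] by simp
  have Vdiff: "x - n * y \<in> V" if "x \<in> V" "y \<in> V" for x y n
  proof -
    obtain u w where uw: "(of_int u + of_int x * s) / of_int N \<in> F" "(of_int w + of_int y * s) / of_int N \<in> F"
      using \<open>x \<in> V\<close> \<open>y \<in> V\<close> by (auto simp: V_def)
    have "(of_int u + of_int x * s) / of_int N - of_int n * ((of_int w + of_int y * s) / of_int N)
      = (of_int (u - n * w) + of_int (x - n * y) * s) / of_int N" using N0 by (simp add: field_simps)
    then have "(of_int (u - n * w) + of_int (x - n * y) * s) / of_int N \<in> F"
      using Fdiff[OF uw(1) FR[OF R_consts(1) uw(2)]] by metis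
    then show ?thesis unfolding V_def by blast
  qed
  have "(of_int 0 + of_int N * s) / of_int N \<in> F" using sF N0 by simp
  then have NV: "N \<in> V" unfolding V_def by blast
  have V0: "0 \<in> V" using Vdiff[OF NV NV, of 1] by simp
  have absV: "\<bar>N\<bar> \<in> V" using NV Vdiff[OF V0 NV, of 1] by (auto simp: abs_if)
  define v0 where "v0 = int (LEAST n. n > 0 \<and> int n \<in> V)"
  have "\<exists>n>0. int n \<in> V" using absV N0 by (intro exI[of _ "nat \<bar>N\<bar>"]) auto
  then have v0: "v0 > 0" "v0 \<in> V" unfolding v0_def using LeastI_ex[of "\<lambda>n. n > 0 \<and> int n \<in> V"] by auto
  have v0min: "v0 \<le> v" if "v > 0" "v \<in> V" for v
    using Least_le[of "\<lambda>n. n > 0 \<and> int n \<in> V" "nat v"] that by (auto simp: v0_def)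
  have Vdvd: "v0 dvd v" if "v \<in> V" for v
  proof -
    have "v mod v0 \<in> V" using Vdiff[OF that v0(2), of "v div v0"] by (simp add: minus_div_mult_eq_mod)
    then have "\<not> v mod v0 > 0" using v0min[of "v mod v0"] v0 pos_mod_bound[of v0 v] by linarith
    then have "v mod v0 = 0" using v0 pos_mod_sign[of v0 v] by linarith
    then show ?thesis by (simp add: dvd_eq_mod_eq_0)
  qed
  obtain k' where k': "N = v0 * k'" using Vdvd[OF NV] by (auto elim: dvdE)
  obtain u0 where u0: "(of_int u0 + of_int v0 * s) / of_int N \<in> F" using v0 by (auto simp: V_def)
  \<comment> \<open>The sign of \<open>k'\<close> is moved into the numerator so that the
    \<open>s\<close>-coordinate of \<theta> is 1/k with \<open>k\<close> positive.\<close>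
  define \<theta> where "\<theta> = (of_int (sgn k' * u0) + of_int (sgn k' * v0) * s) / of_int N"
  define k where "k = \<bar>k'\<bar>"
  have k'0: "k' \<noteq> 0" using k' N0 by auto
  have k0: "k > 0" using k'0 by (simp add: k_def)
  have sk: "sgn k' * k' = k" "sgn k' * sgn k' = 1" using k'0 by (auto simp: k_def sgn_if)
  have th: "\<theta> = of_int (sgn k') * ((of_int u0 + of_int v0 * s) / of_int N)"
    by (simp add: \<theta>_def field_simps)
  have thF: "\<theta> \<in> F" unfolding th by (rule FR[OF R_consts(1) u0])
  have kth: "of_int k * \<theta> = of_rat (of_int (k * sgn k' * u0) / of_int N) + s"
  proof -
    have e1: "k * (sgn k' * v0) = N" using k' sk by (metis mult.commute mult.left_commute mult.assoc mult.right_neutral)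
    have "of_int k * \<theta> = (of_int (k * (sgn k' * u0)) + of_int (k * (sgn k' * v0)) * s) / of_int N"
      by (simp add: \<theta>_def algebra_simps)
    also have "\<dots> = of_int (k * (sgn k' * u0)) / of_int N + s" unfolding e1 using N0 by (simp add: field_simps)
    finally show ?thesis by (simp add: of_rat_divide of_rat_mult mult.assoc)
  qed
  have "of_int k * \<theta> - s \<in> F" using Fdiff[OF FR[OF R_consts(1) thF] sF] .
  then have "of_rat (of_int (k * sgn k' * u0) / of_int N) \<in> F" unfolding kth by simp
  then obtain b' where b': "of_int (k * sgn k' * u0) / of_int N = (of_int b' :: rat)" using FQ by blast
  have th2: "\<theta> = (of_int b' + s) / of_int k"
    using kth[unfolded b'] k0 by (simp add: field_simps)
  define b where "b = b' mod k"
  define \<phi> where "\<phi> = (of_int b + s) / of_int k"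
  have phi: "\<phi> = \<theta> - of_int (b' div k)"
  proof -
    have "(of_int b' :: complex) = of_int (k * (b' div k) + b)" unfolding b_def by simp
    then show ?thesis unfolding th2 \<phi>_def using k0 by (simp add: field_simps)
  qed
  have phiF: "\<phi> \<in> F" unfolding phi using Fdiff thF FZ by blast
  have "F = form_module k b"
  proof
    show "form_module k b \<subseteq> F"
      unfolding form_module_def \<phi>_def[symmetric] using Fadd FZ FR[OF R_consts(1) phiF] by auto
    show "F \<subseteq> form_module k b"
    proof
      fix f assume f: "f \<in> F"
      obtain u v where uv: "f = (of_int u + of_int v * s) / of_int N" using NF f by blast
      then have "v \<in> V" using f V_def by blast
      then obtain n' where n': "v = v0 * n'" using Vdvd by (auto elim: dvdE)
      define n where "n = n' * sgn k'"
      have "f - of_int n * \<theta> = of_rat (of_int (u - n * sgn k' * u0) / of_int N)"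
      proof -
        have e: "n * sgn k' * v0 = v" unfolding n_def n' using sk by (metis mult.assoc mult.commute mult.right_neutral)
        have "f - of_int n * \<theta> = (of_int (u - n * sgn k' * u0) + of_int (v - n * sgn k' * v0) * s) / of_int N"
          unfolding uv \<theta>_def using N0 by (simp add: field_simps)
        then show ?thesis unfolding e by (simp add: of_rat_divide of_rat_diff of_rat_mult)
      qed
      moreover have "f - of_int n * \<theta> \<in> F" using Fdiff[OF f FR[OF R_consts(1) thF]] .
      ultimately obtain m where m: "f - of_int n * \<theta> = of_int m" using FQ by (metis of_rat_of_int_eq)
      have "f = of_int (m + n * (b' div k)) + of_int n * \<phi>" using m by (simp add: phi algebra_simps)
      then show "f \<in> form_module k b" unfolding form_module_def \<phi>_def by blast
    qed
  qed
  moreover have "(k, b) \<in> forms d"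
  proof -
    have bk: "0 \<le> b" "b < k" using k0 by (auto simp: b_def)
    \<comment> \<open>(s - b) \<phi> = (d - b^2)/k is a rational element of \<open>F\<close>, hence
      an integer.\<close>
    have "s * \<phi> - of_int b * \<phi> \<in> F" by (intro Fdiff FR R_consts phiF)
    moreover have "s * \<phi> - of_int b * \<phi> = of_rat (of_int (d - b\<^sup>2) / of_int k)"
    proof -
      have "s * \<phi> - of_int b * \<phi> = (s * s - of_int b * of_int b) / of_int k" using k0 by (simp add: \<phi>_def field_simps)
      then show ?thesis unfolding s_sq by (simp add: of_rat_divide of_rat_diff of_rat_mult power2_eq_square)
    qed
    ultimately obtain m where "of_int (d - b\<^sup>2) / of_int k = (of_int m :: rat)" using FQ by metis
    then have "(of_int (d - b\<^sup>2) :: rat) = of_int (m * k)" using k0 by (simp add: field_simps)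
    then have "d - b\<^sup>2 = m * k" unfolding of_int_eq_iff .
    then have dv: "k dvd d - b\<^sup>2" by simp
    \<comment> \<open>Otherwise the conjugates of \<phi> differ by 2 sqrt(d)/k < 1, and subtracting
      the ceiling of the smaller one puts both into (-1, 1). Reducedness would make both zero, yet
      they are distinct.\<close>
    have "real_of_int k \<le> 2 * sqrt (real_of_int d)"
    proof (rule ccontr)
      assume "\<not> ?thesis"
      then have lt: "2 * sqrt (real_of_int d) / real_of_int k < 1" using k0 by simp
      define x y where "x = (of_int b + sqrt (of_int d)) / real_of_int k" and "y = (of_int b - sqrt (of_int d)) / real_of_int k"
      define n where "n = \<lceil>y\<rceil>"
      let ?f = "\<phi> - of_int n"
      have xy: "x - y < 1" "x - y > 0" using lt k0 d_gt by (auto simp: x_def y_def diff_divide_distrib[symmetric])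
      have f: "?f = of_real (x - of_int n)" by (simp add: \<phi>_def x_def s_real)
      have "cj \<phi> = (of_int b - s) / of_int k" by (simp add: \<phi>_def cj_divide cj_ring)
      then have f': "cj ?f = of_real (y - of_int n)"
        using phiF FK by (simp add: cj_ring y_def s_real subset_iff)
      have "real_of_int n - 1 < y" "y \<le> of_int n" unfolding n_def by linarith+
      then have xy1: "\<bar>x - of_int n\<bar> < 1" "\<bar>y - of_int n\<bar> < 1" using xy by auto
      have "norm ?f < 1" unfolding f norm_of_real real_norm_def by (rule xy1)
      moreover have "norm (cj ?f) < 1" unfolding f' norm_of_real real_norm_def by (rule xy1)
      moreover have "?f \<in> F" using Fdiff phiF FZ by blast
      ultimately have "?f = 0" using red by blast
      then have "complex_of_real (x - of_int n) = 0" "complex_of_real (y - of_int n) = 0"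
        using f f' by (metis, metis cj_const(3))
      then have "x - of_int n = 0" "y - of_int n = 0" unfolding of_real_eq_0_iff .
      then show False using xy by simp
    qed
    then have "(real_of_int k)\<^sup>2 \<le> (2 * sqrt (real_of_int d))\<^sup>2" using k0 by (intro power_mono) auto
    then have "real_of_int (k\<^sup>2) \<le> real_of_int (4 * d)" using d_gt by (simp add: power_mult_distrib)
    then have "k\<^sup>2 \<le> 4 * d" unfolding of_int_le_iff .
    then show ?thesis using k0 bk dv by (auto simp: forms_def)
  qed
  ultimately show ?thesis by blast
qed

end

section \<open>Shortest vectors and collisions of torsion classes\<close>

text \<open>The equation satisfied by the coordinates of 2y when y is an algebraic integer of norm
  +-(pq)^l; the size bounds say that its two conjugates are comparable.\<close>

definition norm_solvable :: "int \<Rightarrow> nat \<Rightarrow> int \<Rightarrow> int \<Rightarrow> bool" where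
  "norm_solvable d l p q \<longleftrightarrow>
     (\<exists>u v. \<bar>u\<^sup>2 - d * v\<^sup>2\<bar> = 4 * (p * q) ^ l \<and> u\<^sup>2 \<le> 8 * (p * q) ^ l \<and> d * v\<^sup>2 \<le> 8 * (p * q) ^ l)"

context real_quadratic begin

text \<open>After division by a minimum \<open>x\<close>, an element below 1 at both embeddings
  would have smaller weight than \<open>x\<close>. The comparison of \<open>A\<close> and
  \<open>B\<close> limits the number of dyadic ranges to O(l log d).\<close>

lemma minimal_reduced:
  assumes J: "module J" and l: "l \<ge> 1" and a: "\<alpha> \<in> K" "\<alpha> \<noteq> 0" and x: "x \<in> J" "x \<noteq> 0"
    and min: "\<forall>y\<in>J. y \<noteq> 0 \<longrightarrow> weight l \<alpha> x \<le> weight l \<alpha> y"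
  defines "A \<equiv> norm x ^ l / norm \<alpha>" and "B \<equiv> norm (cj x) ^ l / norm (cj \<alpha>)"
  shows "reduced ((*) (inverse x) ` J)"
    and "A > 0" "B > 0" "A \<le> B * (2 * sqrt (of_int d)) ^ l" "B \<le> A * (2 * sqrt (of_int d)) ^ l"
proof -
  let ?F = "(*) (inverse x) ` J"
  have xK: "x \<in> K" and JK: "J \<subseteq> K" using J x by (auto simp: module_def)
  have mF: "module ?F" using J x xK by (intro module_scale) auto
  show A: "A > 0" and B: "B > 0" using x xK a by (auto simp: A_def B_def)
  have key: "max A B \<le> max (norm f ^ l * A) (norm (cj f) ^ l * B)" if f: "f \<in> ?F" "f \<noteq> 0" for f
  proof -
    obtain y where y: "y \<in> J" "f = inverse x * y" using f by auto
    then have yf: "y = f * x" using x by simp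
    have fK: "f \<in> K" using y JK xK by auto
    have "y \<noteq> 0" using yf f x by simp
    then have "weight l \<alpha> x \<le> weight l \<alpha> y" using min y by blast
    then show ?thesis using fK xK
      by (simp add: weight_def A_def B_def yf cj_ring norm_mult power_mult_distrib)
  qed
  have F1: "1 \<in> ?F" using x by (intro image_eqI[of _ _ x]) auto
  have pl: "t ^ l < 1" if "0 \<le> t" "t < 1" for t :: real
    using that l by (simp add: power_less_one_iff)
  show "reduced ?F"
    unfolding reduced_def
  proof (intro conjI mF F1 ballI impI)
    fix f assume f: "f \<in> ?F" "norm f < 1" "norm (cj f) < 1"
    show "f = 0"
    proof (rule ccontr)
      assume "f \<noteq> 0"
      have "norm f ^ l * A < 1 * A" "norm (cj f) ^ l * B < 1 * B"
        using A B pl f by (intro mult_strict_right_mono; simp)+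
      then show False using key[OF f(1) \<open>f \<noteq> 0\<close>] by (auto simp: max_def split: if_splits)
    qed
  qed
  \<comment> \<open>\<open>s - of_int g\<close> is below 1 at one embedding and at most 2 sqrt d at
    the other, and \<open>s + of_int g\<close> the other way round. Testing minimality against these
    two elements bounds each of \<open>A\<close> and \<open>B\<close> by (2 sqrt d)^l times the
    other.\<close>
  define g where "g = \<lfloor>sqrt (real_of_int d)\<rfloor>"
  have sd: "sqrt (real_of_int d) > 1" using d_gt by simp
  have g: "real_of_int g \<le> sqrt (of_int d)" "sqrt (of_int d) < real_of_int g + 1" "real_of_int g \<ge> 0"
    unfolding g_def using sd by linarith+
  have FR: "\<And>r x. r\<in>R \<Longrightarrow> x\<in>?F \<Longrightarrow> r * x \<in> ?F" using mF by (auto simp: module_def)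
  have "s - of_int g \<in> ?F"
    using FR[OF _ F1, of "s - of_int g"] R_memI[of "- g" 1] by simp
  moreover have "s + of_int g \<in> ?F"
    using FR[OF _ F1, of "s + of_int g"] R_memI[of "g" 1] by (simp add: add.commute)
  moreover have n1: "norm (s - of_int g) < 1"
  proof -
    have "s - of_int g = of_real (sqrt (of_int d) - of_int g)" by (simp add: s_real)
    then show ?thesis unfolding norm_of_real real_norm_def using g by (simp only: norm_of_real real_norm_def) 
  qed
  moreover have n2: "norm (s + of_int g) \<le> 2 * sqrt (of_int d)"
  proof -
    have "s + of_int g = of_real (sqrt (of_int d) + of_int g)" by (simp add: s_real)
    then show ?thesis using g by (simp only: norm_of_real real_norm_def)
  qed
  moreover have "norm (cj (s - of_int g)) = norm (s + of_int g)" 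
  proof -
    have "cj (s - of_int g) = - (s + of_int g)" by (simp add: cj_ring)
    then show ?thesis by (simp only: norm_minus_cancel)
  qed
  moreover have "norm (cj (s + of_int g)) = norm (s - of_int g)"
  proof -
    have "cj (s + of_int g) = - (s - of_int g)" by (simp add: cj_ring)
    then show ?thesis by (simp only: norm_minus_cancel)
  qed
  moreover have "s - of_int g \<noteq> 0" "s + of_int g \<noteq> 0"
    using s_irrational by (metis Rats_of_int eq_iff_diff_eq_0, metis Rats_minus_iff Rats_of_int add_eq_0_iff2)
  ultimately have k1: "max A B \<le> max (norm (s - of_int g) ^ l * A) (norm (s + of_int g) ^ l * B)"
    and k2: "max A B \<le> max (norm (s + of_int g) ^ l * A) (norm (s - of_int g) ^ l * B)"
    using key[of "s - of_int g"] key[of "s + of_int g"] by (auto simp only:)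
  have p1: "norm (s - of_int g) ^ l < 1" using pl n1 by simp
  have p2: "norm (s + of_int g) ^ l \<le> (2 * sqrt (of_int d)) ^ l" using n2 by (intro power_mono) auto
  have "norm (s - of_int g) ^ l * A < 1 * A" "norm (s - of_int g) ^ l * B < 1 * B"
    using p1 A B by (intro mult_strict_right_mono; simp)+
  moreover have "norm (s + of_int g) ^ l * A \<le> (2 * sqrt (of_int d)) ^ l * A" "norm (s + of_int g) ^ l * B \<le> (2 * sqrt (of_int d)) ^ l * B"
    using p2 A B by (intro mult_right_mono; simp)+
  ultimately show "A \<le> B * (2 * sqrt (of_int d)) ^ l" "B \<le> A * (2 * sqrt (of_int d)) ^ l"
    using k1 k2 by (auto simp: mult.commute)
qed

text \<open>A class is a coset of the principal ideals, and iterated set products of cosets contain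
  the corresponding powers of a representative. So I^l lies in the \<open>l\<close>-th power of the
  class, which is the set of principal ideals itself.\<close>

lemma torsion_representative:
  assumes "c \<in> torsion_subgroup (class_group K) l"
  shows "\<exists>I \<alpha>. fractional_ideal K I \<and> c = {(*) a ` I | a. a \<in> K \<and> a \<noteq> 0} \<and> \<alpha> \<in> K \<and> \<alpha> \<noteq> 0 \<and> ipow I l = (*) \<alpha> ` OK"
proof -
  let ?G = "fractional_ideal_group K" and ?H = "principal_fractional_ideals K"
  have c: "c \<in> carrier (?G Mod ?H)" "c [^]\<^bsub>?G Mod ?H\<^esub> l = \<one>\<^bsub>?G Mod ?H\<^esub>"
    using assms by (auto simp: torsion_subgroup_def class_group_def)
  then obtain I where I: "fractional_ideal K I" "c = ?H #>\<^bsub>?G\<^esub> I"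
    by (auto simp: FactGroup_def RCOSETS_def fractional_ideal_group_def)
  have ab: "ideal_mult OK I = I"
    by (rule ideal_mult_absorb) (use I(1) in \<open>auto simp: fractional_ideal_def add_closed_def\<close>)
  have c2: "c = {(*) a ` I | a. a \<in> K \<and> a \<noteq> 0}"
  proof -
    have "c = (\<Union>h\<in>?H. {ideal_mult h I})"
      unfolding I(2) r_coset_def by (simp add: fractional_ideal_group_def)
    also have "\<dots> = {ideal_mult ((*) a ` OK) I | a. a \<in> K \<and> a \<noteq> 0}"
      unfolding principal_fractional_ideals_def by blast
    finally show ?thesis by (simp add: ideal_mult_scale ab)
  qed
  have Ic: "I \<in> c" unfolding c2 by (rule CollectI, rule exI[of _ 1]) auto
  have "ipow I n \<in> c [^]\<^bsub>?G Mod ?H\<^esub> n" for n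
  proof (induction n)
    case 0
    have "OK = (*) 1 ` OK" by simp
    then have "OK \<in> ?H" unfolding principal_fractional_ideals_def using K_closed(9) one_neq_zero by blast
    then show ?case by (simp add: nat_pow_def FactGroup_def)
  next
    case (Suc n)
    then show ?case using Ic
      by (auto simp: nat_pow_def FactGroup_def set_mult_def fractional_ideal_group_def)
  qed
  then have "ipow I l \<in> ?H" using c(2) by (auto simp: FactGroup_def)
  then show ?thesis using I(1) c2 unfolding principal_fractional_ideals_def by blast
qed

text \<open>For y = b p^l and P = (pq)^l, conjugates within a factor 2 and |y y'| = P give |y|^2,
  |y'|^2 \<le> 2P, hence (|y| + |y'|)^2 \<le> 8P. This bounds both u = y + y' and v sqrt d = y - y',
  while u^2 - d v^2 = 4 y y'.\<close>

lemma collision_solution: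
  assumes b: "b \<in> K" "b \<noteq> 0" and sp: "split_pair d p r" "split_pair d q t"
    and eq: "(*) b ` ipow (pideal p r) l = ipow (pideal q t) l"
    and ratio: "norm b \<le> 2 * norm (cj b)" "norm (cj b) \<le> 2 * norm b"
  shows "norm_solvable d l p q"
proof -
  define y where "y = b * of_int p ^ l"
  have yO: "y \<in> OK" and yn: "norm y * norm (cj y) = real_of_int (p * q) ^ l"
    using collision_norm[OF b(1) sp eq] by (simp_all add: y_def)
  have p0: "p > 0" "q > 0" using sp by (auto simp: split_pair_def)
  have "cj y = cj b * of_int p ^ l" using b cj_power[of "of_int p" l] by (simp add: cj_ring y_def)
  then have r: "norm y \<le> 2 * norm (cj y)" "norm (cj y) \<le> 2 * norm y"
    using ratio p0 by (auto simp: y_def norm_mult norm_power)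
  obtain u v where uv: "y = (of_int u + of_int v * s) / 2" using yO OK_iff by auto
  have cy: "cj y = (of_int u - of_int v * s) / 2" unfolding uv cj_half ..
  define P where "P = (p * q) ^ l"
  have yn': "norm y * norm (cj y) = real_of_int P" using yn by (simp add: P_def)
  have sq: "(norm y)\<^sup>2 \<le> 2 * real_of_int P" "(norm (cj y))\<^sup>2 \<le> 2 * real_of_int P"
    using mult_left_mono[OF r(1), of "norm y"] mult_left_mono[OF r(2), of "norm (cj y)"] yn'
    by (simp_all add: power2_eq_square mult_ac)
  have sum: "(norm y + norm (cj y))\<^sup>2 \<le> 8 * real_of_int P"
  proof -
    have "0 \<le> (norm y - norm (cj y))\<^sup>2" by simp
    then have "(norm y + norm (cj y))\<^sup>2 \<le> 2 * (norm y)\<^sup>2 + 2 * (norm (cj y))\<^sup>2"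
      by (simp add: power2_eq_square algebra_simps)
    then show ?thesis using sq by simp
  qed
  have "of_int u = y + cj y" by (simp add: uv cj_half field_simps)
  then have "\<bar>real_of_int u\<bar> \<le> norm y + norm (cj y)" using norm_triangle_ineq[of y "cj y"] by (metis norm_of_int)
  then have "\<bar>real_of_int u\<bar>\<^sup>2 \<le> (norm y + norm (cj y))\<^sup>2" by (intro power_mono) auto
  then have "real_of_int (u\<^sup>2) \<le> real_of_int (8 * P)" using sum by simp
  then have u: "u\<^sup>2 \<le> 8 * P" unfolding of_int_le_iff .
  have "of_int v * s = y - cj y" by (simp add: uv cj_half field_simps)
  then have "norm (of_int v * s) \<le> norm y + norm (cj y)" using norm_triangle_ineq4[of y "cj y"] by metis
  then have "(norm (of_int v * s))\<^sup>2 \<le> (norm y + norm (cj y))\<^sup>2" by (intro power_mono) auto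
  then have "real_of_int (d * v\<^sup>2) \<le> real_of_int (8 * P)" 
    using sum d_gt by (simp add: norm_mult norm_s power_mult_distrib mult.commute)
  then have v: "d * v\<^sup>2 \<le> 8 * P" unfolding of_int_le_iff .
  have e: "of_int u + of_int v * s = 2 * y" "of_int u - of_int v * s = 2 * cj y"
    unfolding cy by (simp_all add: uv)
  have "of_int (u\<^sup>2 - d * v\<^sup>2) = 4 * (y * cj y)"
    unfolding half_norm[symmetric] e by simp
  then have "norm (of_int (u\<^sup>2 - d * v\<^sup>2) :: complex) = 4 * real_of_int P"
    using yn' by (simp add: norm_mult)
  then have "real_of_int \<bar>u\<^sup>2 - d * v\<^sup>2\<bar> = real_of_int (4 * P)" by (simp only: norm_of_int)
  then have "\<bar>u\<^sup>2 - d * v\<^sup>2\<bar> = 4 * P" unfolding of_int_eq_iff .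
  then show ?thesis unfolding norm_solvable_def using u v P_def by blast
qed

end

text \<open>Pairs \<open>(c, p)\<close> in a common cell with the same \<open>p\<close> coincide; the bound is Cauchy--Schwarz
  applied to the sizes of the cells.\<close>

lemma cell_counting:
  fixes f :: "'a \<Rightarrow> 'b \<Rightarrow> 'c"
  assumes fin: "finite A" "finite P" "finite T" and fT: "\<And>c p. c \<in> A \<Longrightarrow> p \<in> P \<Longrightarrow> f c p \<in> T"
    and inj: "\<And>c c' p. c \<in> A \<Longrightarrow> c' \<in> A \<Longrightarrow> p \<in> P \<Longrightarrow> f c p = f c' p \<Longrightarrow> c = c'"
    and E: "\<And>c c' p q. c \<in> A \<Longrightarrow> c' \<in> A \<Longrightarrow> p \<in> P \<Longrightarrow> q \<in> P \<Longrightarrow> p \<noteq> q \<Longrightarrow> f c p = f c' q \<Longrightarrow> E p q"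
  shows "card A * (card P)\<^sup>2 \<le> card T * (card P + card {(p, q) \<in> P \<times> P. p \<noteq> q \<and> E p q})"
proof (cases "card A = 0")
  case False
  define N where "N t = {cp \<in> A \<times> P. f (fst cp) (snd cp) = t}" for t
  define W where "W = {(p, q) \<in> P \<times> P. p \<noteq> q \<and> E p q}"
  have finN: "finite (N t)" for t using fin by (auto simp: N_def)
  have finW: "finite W" by (rule finite_subset[of _ "P \<times> P"]) (use fin in \<open>auto simp: W_def\<close>)
  have "A \<times> P = (\<Union>t\<in>T. N t)" using fT by (auto simp: N_def)
  then have c1: "card A * card P = (\<Sum>t\<in>T. card (N t))"
    unfolding card_cartesian_product[symmetric] using fin finN
    by (simp only:) (intro card_UN_disjoint; auto simp: N_def)
  have "(\<Sum>t\<in>T. (card (N t))\<^sup>2) = card (\<Union>t\<in>T. N t \<times> N t)"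
    using fin finN by (subst card_UN_disjoint) (auto simp: N_def card_cartesian_product power2_eq_square)
  also have "\<dots> \<le> card (A \<times> (Inl ` P \<union> Inr ` W))"
  proof (rule card_inj_on_le)
    \<comment> \<open>Only the first class is recorded: in a common cell, \<open>c'\<close> is
      determined by \<open>q\<close> and the cell, because pairs with equal second entry have equal
      classes.\<close>
    let ?g = "\<lambda>((c, p), (c', q)). (c, if p = q then Inl p else Inr (p, q))"
    show "inj_on ?g (\<Union>t\<in>T. N t \<times> N t)"
      by (rule inj_onI) (auto simp: N_def split: if_splits intro: inj)
    show "?g ` (\<Union>t\<in>T. N t \<times> N t) \<subseteq> A \<times> (Inl ` P \<union> Inr ` W)"
    proof (rule image_subsetI)
      fix z assume "z \<in> (\<Union>t\<in>T. N t \<times> N t)"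
      then obtain t c p c' q where z: "z = ((c, p), (c', q))" "(c, p) \<in> N t" "(c', q) \<in> N t" by auto
      then have *: "c \<in> A" "c' \<in> A" "p \<in> P" "q \<in> P" "f c p = f c' q" by (auto simp: N_def)
      show "?g z \<in> A \<times> (Inl ` P \<union> Inr ` W)"
        unfolding z(1) using * E[of c c' p q] by (cases "p = q") (auto simp: W_def)
    qed
    show "finite (A \<times> (Inl ` P \<union> Inr ` W))" using fin finW by auto
  qed
  also have "\<dots> = card A * (card P + card W)"
    using fin finW by (subst card_cartesian_product, subst card_Un_disjoint) (auto simp: card_image)
  finally have c2: "(\<Sum>t\<in>T. (card (N t))\<^sup>2) \<le> card A * (card P + card W)" .
  have "(\<Sum>t\<in>T. real (card (N t)))\<^sup>2 \<le> (\<Sum>t\<in>T. (real (card (N t)))\<^sup>2) * real (card T)"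
    by (rule sum_squared_le_sum_of_squares)
  then have "real ((\<Sum>t\<in>T. card (N t))\<^sup>2) \<le> real ((\<Sum>t\<in>T. (card (N t))\<^sup>2) * card T)" by simp
  then have "(card A * card P)\<^sup>2 \<le> (\<Sum>t\<in>T. (card (N t))\<^sup>2) * card T"
    unfolding of_nat_le_iff c1 .
  also have "\<dots> \<le> card A * (card P + card W) * card T" using c2 by (rule mult_right_mono) simp
  finally have "card A * (card A * (card P)\<^sup>2) \<le> card A * (card T * (card P + card W))"
    by (simp add: power2_eq_square mult_ac)
  then show ?thesis using False unfolding W_def by simp
qed simp

lemma log_floor_eq_ratio:
  fixes x y :: real
  assumes "x > 0" "y > 0" "\<lfloor>log 2 x\<rfloor> = \<lfloor>log 2 y\<rfloor>"
  shows "x \<le> 2 * y"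
proof -
  have "log 2 x \<le> log 2 y + 1" using assms(3) by linarith
  also have "\<dots> = log 2 (2 * y)" using assms by (simp add: log_mult)
  finally show ?thesis using assms by simp
qed

lemma log_floor_bounds:
  fixes x y :: real
  assumes "x > 0" "y > 0" "x \<le> y * 2 ^ n" "y \<le> x * 2 ^ n"
  shows "\<lfloor>log 2 (x / y)\<rfloor> \<in> {- int n..int n}"
proof -
  have "log 2 (x / y) \<le> log 2 (2 ^ n)" using assms by (subst log_le_cancel_iff) (auto simp: field_simps)
  moreover have "log 2 (y / x) \<le> log 2 (2 ^ n)" using assms by (subst log_le_cancel_iff) (auto simp: field_simps)
  ultimately have "log 2 (x / y) \<le> real n" "- real n \<le> log 2 (x / y)" using assms by (auto simp: log_divide log_nat_power)
  then show ?thesis by simp linarith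
qed

context real_quadratic begin

lemma finite_forms: "finite (forms d)"
proof (rule finite_subset)
  show "forms d \<subseteq> {0..4 * d} \<times> {0..4 * d}"
  proof clarify
    fix k b assume "(k, b) \<in> forms d"
    then have *: "1 \<le> k" "k\<^sup>2 \<le> 4 * d" "0 \<le> b" "b < k" by (auto simp: forms_def)
    have "k \<le> k\<^sup>2" using * by (simp add: self_le_power)
    then show "k \<in> {0..4 * d} \<and> b \<in> {0..4 * d}" using * by auto
  qed
qed auto

text \<open>Multiplication by the conjugate ideal turns the common factor \<open>pideal p r\<close>
  into the scalar \<open>p\<close>, which can be divided out.\<close>

lemma cancel_pideal:
  assumes I: "fractional_ideal K I" "fractional_ideal K I'" and sp: "split_pair d p r"
    and xK: "x \<in> K" "x \<noteq> 0" "x' \<in> K" "x' \<noteq> 0"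
    and eq: "(*) (inverse x) ` ideal_mult I (pideal p r) = (*) (inverse x') ` ideal_mult I' (pideal p r)"
  shows "I' = (*) (x' / x) ` I"
proof -
  let ?P = "pideal p r" and ?p = "of_int p :: complex"
  have p0: "?p \<noteq> 0" using sp by (auto simp: split_pair_def)
  have IR: "ideal_mult J R = J" if "fractional_ideal K J" for J
    unfolding ideal_mult_comm[of J]
    by (rule ideal_mult_absorb) (use that R_sub_OK in \<open>auto simp: fractional_ideal_def add_closed_def\<close>)
  have *: "ideal_mult ((*) (inverse x) ` ideal_mult J ?P) (cj ` ?P) = (*) (inverse x * ?p) ` J" if "fractional_ideal K J" for J x
    by (simp only: ideal_mult_scale ideal_mult_assoc pideal_mult_cj[OF sp] ideal_mult_scale_right IR[OF that] scale_scale)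
  have "(*) (inverse x * ?p) ` I = (*) (inverse x' * ?p) ` I'"
    using *[OF I(1), of x] *[OF I(2), of x'] eq by simp
  then have "(*) (x' * inverse ?p) ` (*) (inverse x * ?p) ` I = (*) (x' * inverse ?p) ` (*) (inverse x' * ?p) ` I'"
    by simp
  moreover have "x' * inverse ?p * (inverse x * ?p) = x' / x" "x' * inverse ?p * (inverse x' * ?p) = 1"
    using xK p0 by (simp_all add: field_simps)
  ultimately show ?thesis unfolding scale_scale by simp
qed

text \<open>Taking \<open>l\<close>-th powers turns I and I' into the scalars \<alpha> and \<alpha>'
  times \<open>OK\<close>, and \<open>OK\<close> is absorbed by \<open>ipow\<close>; what remains is
  a relation between the powers of the two prime ideals.\<close>

lemma collision_ipow:
  assumes a: "\<alpha> \<noteq> 0" "\<alpha>' \<noteq> 0" "x \<noteq> 0" "x' \<noteq> 0"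
    and I: "ipow I l = (*) \<alpha> ` OK" "ipow I' l = (*) \<alpha>' ` OK"
    and eq: "(*) (inverse x) ` ideal_mult I P = (*) (inverse x') ` ideal_mult I' Q"
  shows "(*) (\<alpha> * x' ^ l / (\<alpha>' * x ^ l)) ` ipow P l = ipow Q l"
proof -
  have *: "ipow ((*) (inverse x) ` ideal_mult J N) l = (*) (inverse x ^ l * \<beta>) ` ipow N l"
    if "ipow J l = (*) \<beta> ` OK" for J N \<beta> x
    by (simp only: ipow_scale ipow_mult that ideal_mult_scale OK_ipow scale_scale)
  have "(*) (inverse x ^ l * \<alpha>) ` ipow P l = (*) (inverse x' ^ l * \<alpha>') ` ipow Q l"
    unfolding *[OF I(1), symmetric] *[OF I(2), symmetric] eq ..
  then have "(*) (x' ^ l * inverse \<alpha>') ` (*) (inverse x ^ l * \<alpha>) ` ipow P l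
     = (*) (x' ^ l * inverse \<alpha>') ` (*) (inverse x' ^ l * \<alpha>') ` ipow Q l" by simp
  moreover have "x' ^ l * inverse \<alpha>' * (inverse x ^ l * \<alpha>) = \<alpha> * x' ^ l / (\<alpha>' * x ^ l)"
    "x' ^ l * inverse \<alpha>' * (inverse x' ^ l * \<alpha>') = 1"
    using a by (simp_all add: field_simps)
  ultimately show ?thesis unfolding scale_scale by simp
qed

text \<open>A cell is a reduced module together with the integer part of the binary logarithm of the
  ratio of the two metrics at the minimum. That logarithm is at most l L in absolute value, which
  leaves 2 l L + 1 possible integers.\<close>

theorem class_torsion_bound:
  assumes l: "l \<ge> 1" and P: "finite P" "\<And>p. p \<in> P \<Longrightarrow> split_pair d p (r p)"
    and L: "2 * sqrt (real_of_int d) \<le> 2 ^ L"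
  shows "class_torsion l d * (card P)\<^sup>2 \<le>
     card (forms d) * (2 * l * L + 1) * (card P + card {(p, q) \<in> P \<times> P. p \<noteq> q \<and> norm_solvable d l p q})"
proof (cases "finite (torsion_subgroup (class_group K) l)")
  \<comment> \<open>An infinite torsion subgroup would have \<open>card\<close> equal to \<open>0\<close>, so finiteness of the class group is not needed.\<close>
  case True
  define A where "A = torsion_subgroup (class_group K) l"
  define rep where "rep c I \<alpha> \<longleftrightarrow> fractional_ideal K I \<and> c = {(*) a ` I | a. a \<in> K \<and> a \<noteq> 0} \<and>
    \<alpha> \<in> K \<and> \<alpha> \<noteq> 0 \<and> ipow I l = (*) \<alpha> ` OK" for c I \<alpha>
  have "\<forall>c\<in>A. \<exists>I \<alpha>. rep c I \<alpha>"
    unfolding A_def rep_def using torsion_representative by blast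
  then obtain I \<alpha> where rep: "\<And>c. c \<in> A \<Longrightarrow> rep c (I c) (\<alpha> c)" by metis
  have I: "\<And>c. c \<in> A \<Longrightarrow> fractional_ideal K (I c)" 
    "\<And>c. c \<in> A \<Longrightarrow> c = {(*) a ` I c | a. a \<in> K \<and> a \<noteq> 0}"
    and a: "\<And>c. c \<in> A \<Longrightarrow> \<alpha> c \<in> K" "\<And>c. c \<in> A \<Longrightarrow> \<alpha> c \<noteq> 0" "\<And>c. c \<in> A \<Longrightarrow> ipow (I c) l = (*) (\<alpha> c) ` OK"
    using rep unfolding rep_def by blast+
  define J where "J c p = ideal_mult (I c) (pideal p (r p))" for c p
  have J: "module (J c p)" if "c \<in> A" "p \<in> P" for c p
    unfolding J_def using I(1)[OF that(1)] P(2)[OF that(2)] by (intro module_ideal_mult) (auto simp: split_pair_def)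
  define minimal where "minimal c p x \<longleftrightarrow> x \<in> J c p \<and> x \<noteq> 0 \<and>
    (\<forall>y\<in>J c p. y \<noteq> 0 \<longrightarrow> weight l (\<alpha> c) x \<le> weight l (\<alpha> c) y)" for c p x
  define x where "x c p = (SOME x. minimal c p x)" for c p
  have min: "minimal c p (x c p)" if "c \<in> A" "p \<in> P" for c p
    unfolding x_def
  proof (rule someI_ex)
    show "\<exists>x. minimal c p x"
      using exists_minimal[OF J[OF that] l a(1,2)[OF that(1)]] unfolding minimal_def by blast
  qed
  have x: "\<And>c p. c \<in> A \<Longrightarrow> p \<in> P \<Longrightarrow> x c p \<in> J c p" "\<And>c p. c \<in> A \<Longrightarrow> p \<in> P \<Longrightarrow> x c p \<noteq> 0"
    "\<And>c p. c \<in> A \<Longrightarrow> p \<in> P \<Longrightarrow> \<forall>y\<in>J c p. y \<noteq> 0 \<longrightarrow> weight l (\<alpha> c) (x c p) \<le> weight l (\<alpha> c) y"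
    using min unfolding minimal_def by blast+
  have xK: "x c p \<in> K" if "c \<in> A" "p \<in> P" for c p using x(1)[OF that] J[OF that] by (auto simp: module_def)
  define U where "U c p = norm (x c p) ^ l / norm (\<alpha> c)" for c p
  define V where "V c p = norm (cj (x c p)) ^ l / norm (cj (\<alpha> c))" for c p
  define F where "F c p = (*) (inverse (x c p)) ` J c p" for c p
  have mr: "reduced (F c p)" "U c p > 0" "V c p > 0" "U c p \<le> V c p * (2 * sqrt (of_int d)) ^ l"
    "V c p \<le> U c p * (2 * sqrt (of_int d)) ^ l" if cp: "c \<in> A" "p \<in> P" for c p
    using minimal_reduced[OF J[OF cp] l a(1,2)[OF cp(1)] x[OF cp], folded U_def V_def F_def] by blast+
  define f where "f c p = (F c p, \<lfloor>log 2 (V c p / U c p)\<rfloor>)" for c p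
  define T where "T = (\<lambda>(k, b). form_module k b) ` forms d \<times> {- int (L * l)..int (L * l)}"
  have finT: "finite T" using finite_forms by (simp add: T_def)
  have "card T \<le> card (forms d) * (2 * l * L + 1)"
  proof -
    have "card {- int n..int n} = 2 * n + 1" for n
      unfolding card_atLeastAtMost_int by arith
    then have "card T = card ((\<lambda>(k, b). form_module k b) ` forms d) * (2 * l * L + 1)"
      by (simp only: T_def card_cartesian_product mult_ac)
    then show ?thesis using card_image_le[OF finite_forms, of "\<lambda>(k, b). form_module k b"] by (simp only: mult_right_mono)
  qed
  moreover have "card A * (card P)\<^sup>2 \<le> card T * (card P + card {(p, q) \<in> P \<times> P. p \<noteq> q \<and> norm_solvable d l p q})"
  proof (rule cell_counting[where f = f])
    show "finite A" "finite P" "finite T" using True P finT by (auto simp: A_def)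
    show "f c p \<in> T" if cp: "c \<in> A" "p \<in> P" for c p
    proof -
      have pl: "(2 * sqrt (real_of_int d)) ^ l \<le> 2 ^ (L * l)"
        unfolding power_mult using L d_gt by (intro power_mono) auto
      have b: "U c p \<le> V c p * 2 ^ (L * l)" "V c p \<le> U c p * 2 ^ (L * l)"
        using order_trans[OF mr(4)[OF cp] mult_left_mono[OF pl]] order_trans[OF mr(5)[OF cp] mult_left_mono[OF pl]]
          mr(2,3)[OF cp] by auto
      have "\<lfloor>log 2 (V c p / U c p)\<rfloor> \<in> {- int (L * l)..int (L * l)}"
        using b mr[OF cp] by (intro log_floor_bounds) auto
      moreover have "F c p \<in> (\<lambda>(k, b). form_module k b) ` forms d"
        using reduced_form[OF mr(1)[OF cp]] by auto
      ultimately show ?thesis by (simp add: f_def T_def)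
    qed
    show "c = c'" if cp: "c \<in> A" "c' \<in> A" "p \<in> P" and eq: "f c p = f c' p" for c c' p
    proof -
      have I': "I c' = (*) (x c' p / x c p) ` I c"
        using eq by (intro cancel_pideal[OF I(1) I(1) P(2)]) (use cp xK x in \<open>auto simp: f_def F_def J_def\<close>)
      let ?t = "x c' p / x c p"
      have t: "?t \<in> K" "?t \<noteq> 0" using cp xK x by auto
      have "c' \<subseteq> c"
      proof
        fix S assume "S \<in> c'"
        then obtain b where b: "S = (*) b ` I c'" "b \<in> K" "b \<noteq> 0" using I(2)[OF cp(2)] by blast
        have "S = (*) (b * ?t) ` I c" unfolding b I' scale_scale ..
        moreover have "b * ?t \<in> K" by (rule K_closed(2)[OF b(2) t(1)])
        moreover have "b * ?t \<noteq> 0" using b t by auto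
        ultimately show "S \<in> c" using I(2)[OF cp(1)] by blast
      qed
      moreover have "c \<subseteq> c'"
      proof
        fix S assume "S \<in> c"
        then obtain b where b: "S = (*) b ` I c" "b \<in> K" "b \<noteq> 0" using I(2)[OF cp(1)] by blast
        have "S = (*) (b / ?t) ` I c'" unfolding b I' scale_scale using t by simp
        moreover have "b / ?t \<in> K" by (rule K_divide[OF b(2) t(1)])
        moreover have "b / ?t \<noteq> 0" using b t by auto
        ultimately show "S \<in> c'" using I(2)[OF cp(2)] by blast
      qed
      ultimately show ?thesis by blast
    qed
    show "norm_solvable d l p q" if cp: "c \<in> A" "c' \<in> A" "p \<in> P" "q \<in> P" and "p \<noteq> q" and eq: "f c p = f c' q" for c c' p q
    proof -
      \<comment> \<open>The conjugates of \<open>?b\<close> have sizes U'/U and V'/V, so a common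
        dyadic range for V/U and V'/U' is exactly what makes them comparable.\<close>
      let ?b = "\<alpha> c * x c' q ^ l / (\<alpha> c' * x c p ^ l)"
      have K: "\<alpha> c \<in> K" "\<alpha> c' \<in> K" "x c p \<in> K" "x c' q \<in> K" and nz: "\<alpha> c \<noteq> 0" "\<alpha> c' \<noteq> 0" "x c p \<noteq> 0" "x c' q \<noteq> 0"
        using cp a xK x by auto
      note m1 = mr[OF cp(1,3)]
      note m2 = mr[OF cp(2,4)]
      have b: "?b \<in> K" "?b \<noteq> 0" using K nz cj_power by auto
      have nb: "norm ?b = U c' q / U c p" by (simp add: U_def norm_mult norm_divide norm_power field_simps)
      have "cj ?b = cj (\<alpha> c) * cj (x c' q) ^ l / (cj (\<alpha> c') * cj (x c p) ^ l)"
        using K cj_power by (simp add: cj_divide cj_ring)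
      then have ncb: "norm (cj ?b) = V c' q / V c p" by (simp add: V_def norm_mult norm_divide norm_power field_simps)
      have r1: "V c p / U c p \<le> 2 * (V c' q / U c' q)" and r2: "V c' q / U c' q \<le> 2 * (V c p / U c p)"
      proof -
        have "\<lfloor>log 2 (V c p / U c p)\<rfloor> = \<lfloor>log 2 (V c' q / U c' q)\<rfloor>" using eq by (simp add: f_def)
        then show "V c p / U c p \<le> 2 * (V c' q / U c' q)" "V c' q / U c' q \<le> 2 * (V c p / U c p)"
          using m1(2,3) m2(2,3) by (intro log_floor_eq_ratio; simp)+
      qed
      have pos: "U c p > 0" "V c p > 0" "U c' q > 0" "V c' q > 0" using m1 m2 by auto
      show ?thesis
      proof (rule collision_solution[OF b P(2)[OF cp(3)] P(2)[OF cp(4)]])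
        show "(*) ?b ` ipow (pideal p (r p)) l = ipow (pideal q (r q)) l"
          using eq cp by (intro collision_ipow[OF nz a(3)[OF cp(1)] a(3)[OF cp(2)]]) (auto simp: f_def F_def J_def)
        show "norm ?b \<le> 2 * norm (cj ?b)" unfolding nb ncb using r1 pos by (simp add: field_simps)
        show "norm (cj ?b) \<le> 2 * norm ?b" unfolding nb ncb using r2 pos by (simp add: field_simps)
      qed
    qed
  qed
  ultimately show ?thesis unfolding class_torsion_def A_def[symmetric]
    by (meson mult_le_mono1 order_trans)
qed (simp add: class_torsion_def)

end

subsection \<open>Divisor bound and Chebyshev's lower bound\<close>

lemma card_divisors_prime_power_mult:
  fixes p m e :: nat
  assumes "prime p" "m > 0"
  shows "card {k. k dvd p ^ e * m} \<le> (e + 1) * card {k. k dvd m}"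
proof -
  have fin: "finite {k. k dvd m}" using assms by simp
  have "{k. k dvd p ^ e * m} \<subseteq> (\<lambda>(i, k). p ^ i * k) ` ({..e} \<times> {k. k dvd m})"
  proof
    fix k assume "k \<in> {k. k dvd p ^ e * m}"
    then obtain x y where xy: "k = x * y" "x dvd p ^ e" "y dvd m" using dvd_productE by blast
    then obtain i where "i \<le> e" "x = p ^ i" using divides_primepow_nat[OF assms(1)] by blast
    then show "k \<in> (\<lambda>(i, k). p ^ i * k) ` ({..e} \<times> {k. k dvd m})"
      using xy by (intro image_eqI[of _ _ "(i, y)"]) auto
  qed
  then have "card {k. k dvd p ^ e * m} \<le> card ((\<lambda>(i, k). p ^ i * k) ` ({..e} \<times> {k. k dvd m}))"
    using fin by (intro card_mono) auto
  also have "\<dots> \<le> card ({..e} \<times> {k. k dvd m})" using fin by (intro card_image_le) auto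
  finally show ?thesis by (simp add: card_cartesian_product)
qed

text \<open>Prime powers are split off one at a time. A prime p \<ge> 2^(1/\<epsilon>) has
  p^\<epsilon> \<ge> 2 and costs nothing, as e + 1 \<le> 2^e; each smaller prime costs one factor
  \<open>B\<close>.\<close>

lemma divisor_bound_aux:
  fixes \<epsilon> B :: real and P0 n :: nat
  assumes e: "\<epsilon> > 0" and P0: "2 powr (1 / \<epsilon>) \<le> real P0" and B: "B \<ge> 1" "\<And>e. real e + 1 \<le> B * 2 powr (real e * \<epsilon>)"
    and n: "n > 0"
  shows "real (card {k. k dvd n}) \<le> B ^ card {p \<in> prime_factors n. p < P0} * real n powr \<epsilon>"
  using n
proof (induction n rule: less_induct)
  case (less n)
  show ?case
  proof (cases "n = 1")
    case False
    then obtain p where p: "prime p" "p dvd n" using prime_factor_nat by blast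
    define e where "e = multiplicity p n"
    obtain m where m: "n = p ^ e * m" "\<not> p dvd m"
      using multiplicity_decompose'[of n p] less.prems p(1) unfolding e_def by (metis gr_implies_not0 not_prime_unit)
    have e1: "e \<ge> 1" using p less.prems by (simp add: e_def Suc_leI prime_multiplicity_gt_zero_iff)
    have m0: "m > 0" using m less.prems by (cases "m = 0") auto
    have p2: "p \<ge> 2" using p prime_ge_2_nat by blast
    have "m < n"
    proof -
      have "(2::nat) ^ 1 \<le> 2 ^ e" using e1 by (intro power_increasing) auto
      also have "\<dots> \<le> p ^ e" using p2 by (intro power_mono) auto
      finally show ?thesis using m0 by (simp add: m(1))
    qed
    note IH = less.IH[OF this m0]
    have pf: "prime_factors n = insert p (prime_factors m)"
      using m m0 p e1 by (simp add: prime_factors_product prime_factorization_prime_power)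
    have pm: "p \<notin> prime_factors m" using m by auto
    define S where "S k = {q \<in> prime_factors k. q < P0}" for k
    have "card {k. k dvd n} \<le> (e + 1) * card {k. k dvd m}"
      by (subst m(1)) (rule card_divisors_prime_power_mult[OF p(1) m0])
    then have "real (card {k. k dvd n}) \<le> real ((e + 1) * card {k. k dvd m})" by (rule of_nat_mono)
    then have "real (card {k. k dvd n}) \<le> (real e + 1) * real (card {k. k dvd m})" by (simp only: of_nat_mult of_nat_add of_nat_1)
    also have "\<dots> \<le> (real e + 1) * (B ^ card (S m) * real m powr \<epsilon>)"
      using IH by (intro mult_left_mono) (auto simp: S_def)
    also have "\<dots> \<le> (B ^ card (S n) * real (p ^ e) powr \<epsilon>) * real m powr \<epsilon>"
    proof -
      have "real (p ^ e) = real p powr real e" using p2 by (simp add: powr_realpow)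
      then have pe: "real (p ^ e) powr \<epsilon> = real p powr (real e * \<epsilon>)" by (simp only: powr_powr)
      have "(real e + 1) * B ^ card (S m) \<le> B ^ card (S n) * real (p ^ e) powr \<epsilon>"
      proof (cases "p < P0")
        case True
        then have "S n = insert p (S m)" "p \<notin> S m" using pf pm by (auto simp: S_def)
        then have c: "card (S n) = Suc (card (S m))" by (simp add: S_def)
        have "real e + 1 \<le> B * 2 powr (real e * \<epsilon>)" by (rule B)
        also have "\<dots> \<le> B * real p powr (real e * \<epsilon>)" using p2 B e by (intro mult_left_mono powr_mono2) auto
        finally have "(real e + 1) * B ^ card (S m) \<le> (B * real p powr (real e * \<epsilon>)) * B ^ card (S m)"
          using B(1) by (intro mult_right_mono) auto
        then show ?thesis unfolding c pe power_Suc by (simp only: mult_ac)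
      next
        case False
        then have c: "S n = S m" using pf by (auto simp: S_def)
        have "2 = (2 powr (1 / \<epsilon>)) powr \<epsilon>" using e by (simp add: powr_powr)
        also have "\<dots> \<le> real p powr \<epsilon>" using False P0 e by (intro powr_mono2) auto
        finally have 2: "2 \<le> real p powr \<epsilon>" .
        have "e + 1 \<le> 2 ^ e" by (induction e) auto
        then have "real (e + 1) \<le> real (2 ^ e)" by (rule of_nat_mono)
        then have "real e + 1 \<le> 2 ^ e" by simp
        also have "\<dots> \<le> (real p powr \<epsilon>) ^ e" using 2 by (intro power_mono) auto
        also have "\<dots> = (real p powr \<epsilon>) powr real e" using p2 by (simp add: powr_realpow)
        also have "\<dots> = real (p ^ e) powr \<epsilon>" unfolding pe powr_powr by (simp add: mult.commute)
        finally show ?thesis using B(1) by (simp add: c mult.commute)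
      qed
      then show ?thesis by (simp add: mult_right_mono mult.assoc[symmetric])
    qed
    also have "\<dots> = B ^ card (S n) * real n powr \<epsilon>" using m0 p2 by (simp add: m(1) powr_mult)
    finally show ?thesis by (simp add: S_def)
  qed simp
qed

theorem divisor_bound:
  fixes \<epsilon> :: real
  assumes "\<epsilon> > 0"
  shows "\<exists>C\<ge>1. \<forall>n>0. real (card {k::nat. k dvd n}) \<le> C * real n powr \<epsilon>"
proof -
  define P0 where "P0 = nat \<lceil>2 powr (1 / \<epsilon>)\<rceil>"
  \<comment> \<open>Chosen so that e + 1 \<le> B (1 + e \<epsilon> ln 2), where the bracket is at
    most 2^(e \<epsilon>).\<close>
  define B where "B = 1 + 1 / (\<epsilon> * ln 2)"
  have B1: "B \<ge> 1" using assms by (simp add: B_def)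
  have P0: "2 powr (1 / \<epsilon>) \<le> real P0" unfolding P0_def by linarith
  have BB: "real e + 1 \<le> B * 2 powr (real e * \<epsilon>)" for e
  proof -
    have "real e + 1 \<le> B * (1 + real e * \<epsilon> * ln 2)"
      using assms by (simp add: B_def field_simps)
    also have "\<dots> \<le> B * 2 powr (real e * \<epsilon>)"
      using B1 exp_ge_add_one_self[of "real e * \<epsilon> * ln 2"] by (intro mult_left_mono) (auto simp: powr_def)
    finally show ?thesis .
  qed
  have "real (card {k. k dvd n}) \<le> B ^ P0 * real n powr \<epsilon>" if "n > 0" for n :: nat
  proof -
    have "card {p \<in> prime_factors n. p < P0} \<le> card {..<P0}" by (intro card_mono) auto
    then have "B ^ card {p \<in> prime_factors n. p < P0} \<le> B ^ P0" using B1 by (intro power_increasing) auto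
    then have "B ^ card {p \<in> prime_factors n. p < P0} * real n powr \<epsilon> \<le> B ^ P0 * real n powr \<epsilon>"
      by (intro mult_right_mono) auto
    then show ?thesis using divisor_bound_aux[OF assms P0 B1 BB that] by linarith
  qed
  then show ?thesis using B1 by (intro exI[of _ "B ^ P0"]) auto
qed

text \<open>Leibniz's harmonic triangle: \<open>1 / (k (n choose k)) + 1 / ((k+1) (n choose (k+1))) = 1 / (k (n-1 choose k))\<close>.\<close>

lemma binomial_dvd_Lcm:
  assumes "1 \<le> k" "k \<le> n"
  shows "k * (n choose k) dvd Lcm {1..n}"
  using assms
proof (induction k arbitrary: n rule: nat_induct_at_least)
  case base
  then have "n dvd Lcm {1..n}" by (intro dvd_Lcm) simp
  then show ?case by simp
next
  case (Suc k)
  then obtain n' where n: "n = Suc n'" "k \<le> n'" by (cases n) auto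
  define L where "L = Lcm {1..n}"
  define a b c where "a = k * (n choose k)" and "b = k * (n' choose k)" and "c = Suc k * (n choose Suc k)"
  obtain k' where k': "k = Suc k'" using Suc.hyps by (cases k) auto
  have "a dvd L" unfolding a_def L_def using Suc by simp
  moreover have "b dvd L"
  proof -
    have "b dvd Lcm {1..n'}" unfolding b_def using Suc n by simp
    also have "Lcm {1..n'} dvd L" unfolding L_def n by (rule Lcm_subset) auto
    finally show ?thesis .
  qed
  ultimately obtain x y where xy: "L = a * x" "L = b * y" by (metis dvd_def)
  have ca: "c = n * (n' choose k)" unfolding c_def n by (rule Suc_times_binomial)
  have aa: "a = n * (n' choose k')" unfolding a_def n k' by (rule Suc_times_binomial)
  have ab: "a = b + k * (n' choose k')" unfolding a_def b_def n k' by (simp add: algebra_simps)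
  have "a - b = k * (n' choose k')" using ab by simp
  then have "c * (a - b) = n * (n' choose k) * (k * (n' choose k'))" by (simp only: ca)
  moreover have "a * b = n * (n' choose k') * (k * (n' choose k))" by (simp only: aa b_def)
  \<comment> \<open>The triangle relation 1/b - 1/a = 1/c cleared of denominators. With x = L/a and
    y = L/b it yields L = c (y - x), so c divides L.\<close>
  ultimately have "a * b = c * (a - b)" by (simp only: mult_ac)
  then have iab: "int a * int b = int c * (int a - int b)" using ab by (metis le_add1 of_nat_diff of_nat_mult)
  have e1: "int a * int L = int a * int b * int y" by (subst xy(2)) simp
  have e2: "int b * int L = int a * int b * int x" by (subst xy(1)) simp
  have ab0: "int a * int b \<noteq> 0" using n Suc.hyps by (simp add: a_def b_def)
  have "int a * int b * int L = int c * (int a * int L - int b * int L)"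
    unfolding iab by (simp add: algebra_simps)
  also have "\<dots> = int a * int b * (int c * (int y - int x))" unfolding e1 e2 by (simp add: algebra_simps)
  finally have "int L = int c * (int y - int x)" using ab0 by simp
  then have "int c dvd int L" by simp
  then show ?case unfolding c_def L_def by (simp only: int_dvd_int_iff)
qed

text \<open>The exact power of each prime in the least common multiple is at most N, and only primes
  up to N occur.\<close>

lemma Lcm_le_power_primes:
  assumes "N \<ge> 1"
  shows "Lcm {1..N} \<le> N ^ card {p. prime p \<and> p \<le> (N::nat)}"
proof -
  define P where "P = {p. prime p \<and> p \<le> N}"
  define e where "e p = (GREATEST e. p ^ e \<le> N)" for p
  have fin: "finite P" unfolding P_def by (rule finite_subset[of _ "{..N}"]) auto
  have bd: "k \<le> N" if "prime p" "p ^ k \<le> N" for p k :: nat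
  proof -
    have "k < 2 ^ k" by (rule less_exp)
    also have "(2::nat) ^ k \<le> p ^ k" using prime_ge_2_nat[OF that(1)] by (intro power_mono) auto
    finally show ?thesis using that(2) by simp
  qed
  have e1: "p ^ e p \<le> N" if "prime p" for p
    unfolding e_def by (rule GreatestI_nat[of "\<lambda>e. p ^ e \<le> N" 0 N]) (use bd that assms in auto)
  have e2: "k \<le> e p" if "prime p" "p ^ k \<le> N" for p k
    unfolding e_def by (rule Greatest_le_nat[of "\<lambda>e. p ^ e \<le> N" k N]) (use bd that in auto)
  have "Lcm {1..N} dvd (\<Prod>p\<in>P. p ^ e p)"
  proof (rule Lcm_least)
    fix m assume m: "m \<in> {1..N}"
    have "m = (\<Prod>p\<in>prime_factors m. p ^ multiplicity p m)" using m prime_factorization_nat[of m] by simp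
    also have "\<dots> dvd (\<Prod>p\<in>P. p ^ e p)"
    proof (rule prod_dvd_prod_subset2)
      show "finite P" by (rule fin)
      show "prime_factors m \<subseteq> P" using m by (auto simp: P_def dest!: dvd_imp_le)
      fix p assume p: "p \<in> prime_factors m"
      have "p ^ multiplicity p m \<le> m" using m by (intro dvd_imp_le multiplicity_dvd) auto
      then have "multiplicity p m \<le> e p" using p m by (intro e2) auto
      then show "p ^ multiplicity p m dvd p ^ e p" by (rule le_imp_power_dvd)
    qed
    finally show "m dvd (\<Prod>p\<in>P. p ^ e p)" .
  qed
  then have "Lcm {1..N} \<le> (\<Prod>p\<in>P. p ^ e p)"
    by (rule dvd_imp_le) (auto intro!: prod_pos simp: P_def prime_gt_0_nat)
  also have "\<dots> \<le> (\<Prod>p\<in>P. N)" by (rule prod_mono) (auto simp: P_def e1)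
  finally show ?thesis by (simp add: P_def)
qed

lemma central_binomial_ge: "2 ^ n \<le> (2 * n choose n)"
proof (induction n)
  case (Suc n)
  have "2 * 2 ^ n \<le> 2 * (2 * n choose n)" using Suc by simp
  also have "2 * n choose n \<le> Suc (2 * n) choose n" by (cases n) auto
  then have "2 * (2 * n choose n) \<le> 2 * Suc n choose Suc n" by simp
  finally show ?case by simp
qed simp

text \<open>Nair's argument: n times the central binomial coefficient divides the least common
  multiple of 1, ..., 2n, which is at most N to the number of primes up to N.\<close>

lemma two_power_le_prime_count:
  assumes "N \<ge> 1"
  shows "2 ^ (N div 2) \<le> N ^ card {p. prime p \<and> p \<le> (N::nat)}"
proof (cases "N div 2 = 0")
  case False
  define n where "n = N div 2"
  have n: "n \<ge> 1" "2 * n \<le> N" using False by (auto simp: n_def)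
  have "2 ^ n \<le> (2 * n choose n)" by (rule central_binomial_ge)
  also have "\<dots> \<le> n * (2 * n choose n)" using n by simp
  also have "\<dots> \<le> Lcm {1..2 * n}" using binomial_dvd_Lcm[of n "2 * n"] n by (intro dvd_imp_le) (auto intro: Nat.gr0I)
  also have "\<dots> \<le> Lcm {1..N}" using n by (intro dvd_imp_le Lcm_subset) (auto intro: Nat.gr0I)
  also have "\<dots> \<le> N ^ card {p. prime p \<and> p \<le> N}" by (rule Lcm_le_power_primes[OF assms])
  finally show ?thesis by (simp add: n_def)
qed (use assms in simp)

lemma odd_prime_count:
  fixes \<delta> :: real
  assumes "\<delta> > 0"
  shows "\<forall>\<^sub>F Z in at_top. real (card {p. prime p \<and> odd p \<and> real p \<le> Z}) \<ge> Z powr (1 - \<delta>)"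
proof -
  have "\<forall>\<^sub>F Z::real in at_top. (Z / 2 - 3) * ln 2 / ln Z - 1 \<ge> Z powr (1 - \<delta>)"
    using assms by real_asymp
  moreover have "\<forall>\<^sub>F Z::real in at_top. Z \<ge> 2" by (rule eventually_ge_at_top)
  ultimately show ?thesis
  proof eventually_elim
    case (elim Z)
    define N where "N = nat \<lfloor>Z\<rfloor>"
    have N: "N \<ge> 2" "real N \<le> Z" "Z < real N + 1" using elim(2) unfolding N_def by linarith+
    let ?S = "{p. prime p \<and> p \<le> N}" and ?T = "{p. prime p \<and> odd p \<and> real p \<le> Z}"
    have finT: "finite ?T" by (rule finite_subset[of _ "{..N}"]) (use N in auto)
    have "?S \<subseteq> insert 2 ?T"
    proof
      fix p assume p: "p \<in> ?S"
      show "p \<in> insert 2 ?T"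
        using p N prime_odd_nat[of p] prime_ge_2_nat[of p] by (cases "p = 2") auto
    qed
    then have "card ?S \<le> card (insert 2 ?T)" using finT by (intro card_mono) auto
    also have "\<dots> \<le> Suc (card ?T)" by (rule card_insert_le_m1[THEN order_trans]) auto
    finally have c: "real (card ?S) - 1 \<le> real (card ?T)" by simp
    have "real (2 ^ (N div 2)) \<le> real (N ^ card ?S)" using two_power_le_prime_count[of N] N by (simp only: of_nat_le_iff)
    then have "ln (2 ^ (N div 2)) \<le> ln (real N ^ card ?S)" using N by (subst ln_le_cancel_iff) auto
    then have "real (N div 2) * ln 2 \<le> real (card ?S) * ln (real N)" using N by (simp add: ln_realpow)
    also have "\<dots> \<le> real (card ?S) * ln Z" using N by (intro mult_left_mono) auto
    finally have 1: "real (N div 2) * ln 2 \<le> real (card ?S) * ln Z" .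
    \<comment> \<open>The 3 generously covers the roundings from \<open>Z\<close> to
      \<open>N\<close> and from \<open>N / 2\<close> to \<open>N div 2\<close>; the 1 subtracted in
      the asymptotic estimate accounts for the prime 2.\<close>
    have "Z / 2 - 3 \<le> real (N div 2)" using N by linarith
    then have "(Z / 2 - 3) * ln 2 \<le> real (card ?S) * ln Z" by (intro order_trans[OF mult_right_mono 1]) auto
    then have "(Z / 2 - 3) * ln 2 / ln Z \<le> real (card ?S)" using elim(2) by (simp add: field_simps)
    then show ?case using elim(1) c by linarith
  qed
qed

subsection \<open>Quadratic characters on average\<close>

text \<open>For an odd prime \<open>p\<close> this is the Legendre symbol of \<open>d\<close>: there
  are two, one or no roots according as \<open>d\<close> is a nonzero square, zero or a nonsquare
  modulo \<open>p\<close>. Defining it by a root count makes its averages a matter of double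
  counting.\<close>

definition chi :: "nat \<Rightarrow> int \<Rightarrow> real" where
  "chi p d = real (card {y \<in> {0..<int p}. int p dvd y\<^sup>2 - d}) - 1"

text \<open>A progression with step coprime to \<open>p\<close> meets every residue once, so each
  \<open>y\<close> is a root for exactly one term; the \<open>p\<close> roots in total cancel the
  \<open>p\<close> subtracted ones.\<close>

lemma chi_sum_progression:
  assumes "coprime p q" "p > 0"
  shows "(\<Sum>i<p. chi p (c + int (i * q))) = 0"
proof -
  have ex1: "card {i \<in> {..<p}. int p dvd y\<^sup>2 - (c + int (i * q))} = 1" for y
  proof -
    have co: "coprime (int q) (int p)" using assms by (simp add: coprime_commute)
    obtain x where x: "[int q * x = y\<^sup>2 - c] (mod int p)" using cong_solve_coprime_int[OF co] 
      by (metis cong_scalar_right mult.assoc mult_1)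
    define i where "i = nat (x mod int p)"
    have i: "i < p" "int i = x mod int p" using assms(2) by (auto simp: i_def nat_less_iff)
    have "[int q * int i = y\<^sup>2 - c] (mod int p)"
      using x unfolding i(2) by (simp add: Cong.cong_def mod_mult_right_eq)
    then have dv: "int p dvd y\<^sup>2 - c - int q * int i" using cong_iff_dvd_diff cong_sym by blast
    have "{i \<in> {..<p}. int p dvd y\<^sup>2 - (c + int (i * q))} = {i}"
    proof (intro equalityI subsetI)
      fix j assume "j \<in> {i \<in> {..<p}. int p dvd y\<^sup>2 - (c + int (i * q))}"
      then have j: "j < p" "int p dvd y\<^sup>2 - c - int q * int j" by (auto simp: algebra_simps)
      have "int p dvd (y\<^sup>2 - c - int q * int i) - (y\<^sup>2 - c - int q * int j)" using dv j(2) by (rule dvd_diff)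
      then have "int p dvd int q * (int j - int i)" by (simp add: algebra_simps)
      then have "int p dvd int j - int i" using co by (simp add: coprime_commute coprime_dvd_mult_right_iff)
      then have "[int j = int i] (mod int p)" by (simp add: cong_iff_dvd_diff)
      then have "j mod p = i mod p" by (simp add: Cong.cong_def flip: zmod_int)
      then show "j \<in> {i}" using i j by simp
    qed (use i dv in \<open>auto simp: algebra_simps\<close>)
    then show ?thesis by simp
  qed
  have "(\<Sum>i<p. card {y \<in> {0..<int p}. int p dvd y\<^sup>2 - (c + int (i * q))})
     = (\<Sum>i<p. \<Sum>y\<in>{0..<int p}. if int p dvd y\<^sup>2 - (c + int (i * q)) then 1 else 0)"
    by (simp add: sum.If_cases Int_def)
  also have "\<dots> = (\<Sum>y\<in>{0..<int p}. \<Sum>i<p. if int p dvd y\<^sup>2 - (c + int (i * q)) then 1 else 0)"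
    by (rule sum.swap)
  also have "\<dots> = (\<Sum>y\<in>{0..<int p}. card {i \<in> {..<p}. int p dvd y\<^sup>2 - (c + int (i * q))})"
    by (simp add: sum.If_cases Int_def)
  also have "\<dots> = p" unfolding ex1 by simp
  finally have "(\<Sum>i<p. card {y \<in> {0..<int p}. int p dvd y\<^sup>2 - (c + int (i * q))}) = p" .
  then show ?thesis by (simp add: chi_def sum_subtractf flip: of_nat_sum)
qed

lemma chi_add_mult: "chi p (d + int (p * k)) = chi p d"
proof -
  have "int p dvd y\<^sup>2 - (d + int (p * k)) \<longleftrightarrow> int p dvd y\<^sup>2 - d" for y
  proof -
    have "y\<^sup>2 - (d + int (p * k)) = (y\<^sup>2 - d) - int p * int k" by simp
    then show ?thesis by (metis dvd_diff_left_iff dvd_triv_left dvd_add_left_iff diff_add_cancel)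
  qed
  then show ?thesis by (simp add: chi_def)
qed

lemma chi_roots_le_2:
  assumes "prime p"
  shows "card {y \<in> {0..<int p}. int p dvd y\<^sup>2 - d} \<le> 2"
proof (cases "{y \<in> {0..<int p}. int p dvd y\<^sup>2 - d} = {}")
  case False
  then obtain z where z: "z \<in> {0..<int p}" "int p dvd z\<^sup>2 - d" by blast
  have "{y \<in> {0..<int p}. int p dvd y\<^sup>2 - d} \<subseteq> {z, (- z) mod int p}"
  proof
    fix y assume "y \<in> {y \<in> {0..<int p}. int p dvd y\<^sup>2 - d}"
    then have y: "y \<in> {0..<int p}" "int p dvd y\<^sup>2 - d" by auto
    have "int p dvd (y\<^sup>2 - d) - (z\<^sup>2 - d)" using dvd_diff[OF y(2) z(2)] .
    then have "int p dvd (y - z) * (y + z)" by (simp add: power2_eq_square algebra_simps)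
    then have "int p dvd y - z \<or> int p dvd y + z" using assms by (simp add: prime_dvd_mult_iff)
    then show "y \<in> {z, (- z) mod int p}"
    proof
      assume "int p dvd y - z"
      then have "y mod int p = z mod int p" by (simp add: mod_eq_dvd_iff)
      then show ?thesis using y z by simp
    next
      assume "int p dvd y + z"
      then have "y mod int p = (- z) mod int p" by (simp add: mod_eq_dvd_iff)
      then show ?thesis using y by simp
    qed
  qed
  then have "card {y \<in> {0..<int p}. int p dvd y\<^sup>2 - d} \<le> card {z, (- z) mod int p}" by (intro card_mono) auto
  also have "\<dots> \<le> 2" by (simp add: card_insert_if)
  finally show ?thesis .
qed (simp only: card.empty)

lemma abs_chi_le_1:
  assumes "prime p"
  shows "\<bar>chi p d\<bar> \<le> 1"
proof -
  have "real (card {y \<in> {0..<int p}. int p dvd y\<^sup>2 - d}) \<le> real 2"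
    using chi_roots_le_2[OF assms] by (rule of_nat_mono)
  then show ?thesis unfolding chi_def by linarith
qed

text \<open>Writing the position as j + i q, the factor at \<open>q\<close> depends on
  \<open>j\<close> alone and the sum over \<open>i\<close> of the factor at \<open>p\<close>
  vanishes.\<close>

lemma chi_chi_window:
  assumes "prime p" "prime q" "p \<noteq> q"
  shows "(\<Sum>x<p * q. chi p (a + int x) * chi q (a + int x)) = 0"
proof -
  let ?f = "\<lambda>x. chi p (a + int x) * chi q (a + int x)"
  have "(\<Sum>x<p * q. ?f x) = (\<Sum>i<p. \<Sum>x\<in>{i * q..<i * q + q}. ?f x)"
    by (rule sum.nat_group[symmetric])
  also have "\<dots> = (\<Sum>i<p. \<Sum>j<q. ?f (j + i * q))"
  proof (rule sum.cong[OF refl])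
    fix i
    show "(\<Sum>x\<in>{i * q..<i * q + q}. ?f x) = (\<Sum>j<q. ?f (j + i * q))"
      using sum.shift_bounds_nat_ivl[of ?f 0 "i * q" q] by (simp add: lessThan_atLeast0 add.commute)
  qed
  also have "\<dots> = (\<Sum>i<p. \<Sum>j<q. chi p ((a + int j) + int (i * q)) * chi q (a + int j))"
  proof (intro sum.cong refl)
    fix i j
    show "?f (j + i * q) = chi p ((a + int j) + int (i * q)) * chi q (a + int j)"
      using chi_add_mult[of q "a + int j" i] by (simp add: algebra_simps)
  qed
  also have "\<dots> = (\<Sum>j<q. chi q (a + int j) * (\<Sum>i<p. chi p ((a + int j) + int (i * q))))"
    by (subst sum.swap) (simp add: sum_distrib_left mult.commute)
  also have "\<dots> = 0"
    using assms by (simp add: chi_sum_progression primes_coprime prime_gt_0_nat del: of_nat_mult)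
  finally show ?thesis .
qed

text \<open>Complete windows of length \<open>m\<close> are removed from the front; fewer than
  \<open>m\<close> terms of size at most 1 are left.\<close>

lemma sum_le_of_zero_windows:
  fixes f :: "int \<Rightarrow> real"
  assumes f: "\<And>x. \<bar>f x\<bar> \<le> 1" and w: "\<And>a. (\<Sum>x<m. f (a + int x)) = 0" and "m > 0"
  shows "\<bar>\<Sum>x<n. f (a + int x)\<bar> \<le> real m"
proof (induction n arbitrary: a rule: less_induct)
  case (less n)
  show ?case
  proof (cases "n < m")
    case True
    have "\<bar>\<Sum>x<n. f (a + int x)\<bar> \<le> (\<Sum>x<n. \<bar>f (a + int x)\<bar>)" by (rule sum_abs)
    also have "\<dots> \<le> (\<Sum>x<n. 1)" by (intro sum_mono f)
    finally show ?thesis using True by simp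
  next
    case False
    then obtain k where k: "n = m + k" by (metis le_Suc_ex not_less)
    have "(\<Sum>x<m + k. f (a + int x)) = (\<Sum>x<m. f (a + int x)) + (\<Sum>x<k. f (a + int (m + x)))"
      by (induction k) (simp_all add: add.assoc)
    also have "\<dots> = (\<Sum>x<k. f ((a + int m) + int x))" by (simp add: w add.assoc)
    finally show ?thesis using less[of k "a + int m"] k assms(3) by simp
  qed
qed

text \<open>Diagonal terms contribute at most \<open>n\<close> each. For p \<noteq> q the product of
  characters has zero sum over windows of length pq, so an off-diagonal sum is at most pq \<le> Z^2,
  however long the interval.\<close>

lemma chi_variance:
  fixes P :: "nat set" and Z :: real
  assumes P: "finite P" "\<And>p. p \<in> P \<Longrightarrow> prime p" "\<And>p. p \<in> P \<Longrightarrow> real p \<le> Z"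
  shows "(\<Sum>x<n. (\<Sum>p\<in>P. chi p (a + int x))\<^sup>2) \<le> real (card P) * real n + (real (card P))\<^sup>2 * Z\<^sup>2"
proof -
  have "(\<Sum>x<n. (\<Sum>p\<in>P. chi p (a + int x))\<^sup>2) = (\<Sum>x<n. \<Sum>p\<in>P. \<Sum>q\<in>P. chi p (a + int x) * chi q (a + int x))"
    by (simp add: power2_eq_square sum_product)
  also have "\<dots> = (\<Sum>p\<in>P. \<Sum>x<n. \<Sum>q\<in>P. chi p (a + int x) * chi q (a + int x))" by (rule sum.swap)
  also have "\<dots> = (\<Sum>p\<in>P. \<Sum>q\<in>P. \<Sum>x<n. chi p (a + int x) * chi q (a + int x))"
    by (intro sum.cong refl sum.swap)
  also have "\<dots> \<le> (\<Sum>p\<in>P. \<Sum>q\<in>P. (if p = q then real n else 0) + Z\<^sup>2)"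
  proof (intro sum_mono)
    fix p q assume pq: "p \<in> P" "q \<in> P"
    have c1: "\<bar>chi p x * chi q x\<bar> \<le> 1" for x
      using abs_chi_le_1[OF P(2)[OF pq(1)], of x] abs_chi_le_1[OF P(2)[OF pq(2)], of x]
      by (simp add: abs_mult mult_le_one)
    show "(\<Sum>x<n. chi p (a + int x) * chi q (a + int x)) \<le> (if p = q then real n else 0) + Z\<^sup>2"
    proof (cases "p = q")
      case True
      have "(\<Sum>x<n. chi p (a + int x) * chi q (a + int x)) \<le> (\<Sum>x<n. 1)"
        using c1 by (intro sum_mono) (metis abs_le_D1)
      then show ?thesis using True by (simp add: add_increasing2)
    next
      case False
      have "\<bar>\<Sum>x<n. (\<lambda>x. chi p x * chi q x) (a + int x)\<bar> \<le> real (p * q)"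
        by (rule sum_le_of_zero_windows) (use c1 False pq P chi_chi_window prime_gt_0_nat in auto)
      also have "\<dots> = real p * real q" by simp
      also have "\<dots> \<le> Z * Z" using P(3) pq by (intro mult_mono) (auto intro: order_trans[OF of_nat_0_le_iff])
      finally show ?thesis using False by (simp add: power2_eq_square)
    qed
  qed
  also have "\<dots> = real (card P) * real n + (real (card P))\<^sup>2 * Z\<^sup>2"
    using P(1) by (simp add: sum.distrib power2_eq_square algebra_simps)
  finally show ?thesis .
qed

definition split_primes :: "nat set \<Rightarrow> int \<Rightarrow> nat set" where
  "split_primes P d = {p \<in> P. \<exists>r. int p dvd r\<^sup>2 - d \<and> coprime (int p) (2 * r)}"

lemma two_power_card_prime_divisors_le:
  fixes Q :: "nat set"
  assumes "finite Q" "\<And>p. p \<in> Q \<Longrightarrow> prime p" "\<And>p. p \<in> Q \<Longrightarrow> int p dvd d" "d > 0"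
  shows "2 ^ card Q \<le> d"
proof -
  have "(\<Prod>p\<in>Q. int p) dvd d"
    using assms(1-3)
  proof (induction Q rule: finite_induct)
    case (insert p Q)
    have "coprime (int p) (\<Prod>p\<in>Q. int p)"
      using insert by (intro prod_coprime_right) (auto intro!: primes_coprime)
    then show ?case using insert by (simp add: divides_mult)
  qed simp
  then have "(\<Prod>p\<in>Q. int p) \<le> d" using assms(4) by (rule zdvd_imp_le)
  moreover have "(\<Prod>p\<in>Q. (2::int)) \<le> (\<Prod>p\<in>Q. int p)"
    using assms(2) by (intro prod_mono) (auto dest!: prime_ge_2_nat)
  ultimately show ?thesis by simp
qed

text \<open>The left side is the total number of square roots of \<open>d\<close> over the primes in
  \<open>P\<close>. Inert primes have none and the others at most two; the prime divisors of
  \<open>d\<close> number at most log2 d.\<close>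

lemma split_primes_ge:
  assumes P: "finite P" "\<And>p. p \<in> P \<Longrightarrow> prime p \<and> odd p" and "d > 0"
  shows "real (card P) + (\<Sum>p\<in>P. chi p d) \<le> 2 * real (card (split_primes P d)) + 2 * log 2 (real_of_int d)"
proof -
  define Q where "Q = {p \<in> P. int p dvd d}"
  define N where "N p = card {y \<in> {0..<int p}. int p dvd y\<^sup>2 - d}" for p
  have finQ: "finite Q" "finite (split_primes P d)" using P by (auto simp: Q_def split_primes_def)
  have N0: "N p = 0" if p: "p \<in> P" "p \<notin> split_primes P d \<union> Q" for p
  proof -
    have "\<not> int p dvd y\<^sup>2 - d" for y
    proof
      assume y: "int p dvd y\<^sup>2 - d"
      have pr: "prime p" "odd p" using P(2) p by auto
      have "\<not> int p dvd y"
      proof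
        assume "int p dvd y"
        then have "int p dvd y\<^sup>2" by (simp add: power2_eq_square)
        then have "int p dvd y\<^sup>2 - (y\<^sup>2 - d)" using y by (rule dvd_diff)
        then show False using p by (simp add: Q_def)
      qed
      moreover have "\<not> int p dvd 2"
      proof
        assume "int p dvd 2"
        then have "int p dvd int 2" by simp
        then have "p dvd 2" by (simp only: int_dvd_int_iff)
        then have "p = 2" using pr primes_dvd_imp_eq two_is_prime_nat by blast
        then show False using pr by simp
      qed
      ultimately have "\<not> int p dvd 2 * y" using pr by (simp add: prime_dvd_mult_iff)
      then have "coprime (int p) (2 * y)" using pr by (intro prime_imp_coprime) auto
      then show False using p y by (auto simp: split_primes_def)
    qed
    then show ?thesis by (simp add: N_def)
  qed
  have "real (card P) + (\<Sum>p\<in>P. chi p d) = (\<Sum>p\<in>P. real (N p))"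
    by (simp add: chi_def N_def sum_subtractf)
  also have "\<dots> = (\<Sum>p\<in>P \<inter> (split_primes P d \<union> Q). real (N p))"
    using P(1) N0 by (intro sum.mono_neutral_right) auto
  also have "\<dots> \<le> (\<Sum>p\<in>P \<inter> (split_primes P d \<union> Q). 2)"
  proof (intro sum_mono)
    fix p assume "p \<in> P \<inter> (split_primes P d \<union> Q)"
    then have "N p \<le> 2" unfolding N_def using P(2) by (intro chi_roots_le_2) auto
    then show "real (N p) \<le> 2" by linarith
  qed
  also have "\<dots> \<le> 2 * real (card (split_primes P d \<union> Q))"
    using finQ by (simp add: card_mono)
  also have "\<dots> \<le> 2 * (real (card (split_primes P d)) + real (card Q))"
    using card_Un_le[of "split_primes P d" Q] by (simp flip: of_nat_add)
  also have "real (card Q) \<le> log 2 (real_of_int d)"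
  proof -
    have "2 ^ card Q \<le> d" using finQ P assms(3) by (intro two_power_card_prime_divisors_le) (auto simp: Q_def)
    then have "real_of_int (2 ^ card Q) \<le> real_of_int d" by (rule of_int_le_iff[THEN iffD2])
    then have "log 2 (2 ^ card Q) \<le> log 2 (real_of_int d)" using assms(3) by (subst log_le_cancel_iff) auto
    then show ?thesis by (simp add: log_nat_power)
  qed
  finally show ?thesis by simp
qed

text \<open>Chebyshev's inequality. With c = \<open>card P\<close>, fewer than c/8 split primes and
  log2 d \<le> c/8 force c plus the character sum to be at most c/2, so the sum is at most -c/2.
  Dividing the variance c n + c^2 Z^2 by (c/2)^2 gives the bound.\<close>

theorem few_bad_discriminants:
  fixes P :: "nat set" and Z :: real and a :: int
  assumes P: "finite P" "\<And>p. p \<in> P \<Longrightarrow> prime p \<and> odd p" "\<And>p. p \<in> P \<Longrightarrow> real p \<le> Z" "card P > 0"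
    and a: "a > 0" "log 2 (real_of_int a + real n) \<le> real (card P) / 8"
  shows "real (card {d \<in> {a..<a + int n}. 8 * card (split_primes P d) < card P})
     \<le> 4 * (real n / real (card P) + Z\<^sup>2)"
proof -
  define B where "B = {x \<in> {..<n}. 8 * card (split_primes P (a + int x)) < card P}"
  define c where "c = real (card P)"
  have c0: "c > 0" using P(4) by (simp add: c_def)
  have big: "(c / 2)\<^sup>2 \<le> (\<Sum>p\<in>P. chi p (a + int x))\<^sup>2" if x: "x \<in> B" for x
  proof -
    have "log 2 (real_of_int (a + int x)) \<le> log 2 (real_of_int a + real n)"
      using x a(1) by (subst log_le_cancel_iff) (auto simp: B_def)
    then have "log 2 (real_of_int (a + int x)) \<le> c / 8" using a(2) by (simp add: c_def)
    moreover have "c + (\<Sum>p\<in>P. chi p (a + int x)) \<le> 2 * real (card (split_primes P (a + int x))) + 2 * log 2 (real_of_int (a + int x))"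
      unfolding c_def using P a(1) by (intro split_primes_ge) auto
    moreover have "8 * real (card (split_primes P (a + int x))) \<le> c" using x by (simp add: B_def c_def)
    ultimately have "(\<Sum>p\<in>P. chi p (a + int x)) \<le> - (c / 2)" by linarith
    then have "\<bar>c / 2\<bar> \<le> \<bar>\<Sum>p\<in>P. chi p (a + int x)\<bar>" using c0 by linarith
    then show ?thesis by (rule abs_le_square_iff[THEN iffD1])
  qed
  have "real (card B) * (c / 2)\<^sup>2 = (\<Sum>x\<in>B. (c / 2)\<^sup>2)" by simp
  also have "\<dots> \<le> (\<Sum>x\<in>B. (\<Sum>p\<in>P. chi p (a + int x))\<^sup>2)" by (intro sum_mono big)
  also have "\<dots> \<le> (\<Sum>x<n. (\<Sum>p\<in>P. chi p (a + int x))\<^sup>2)" by (intro sum_mono2) (auto simp: B_def)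
  also have "\<dots> \<le> c * real n + c\<^sup>2 * Z\<^sup>2" unfolding c_def using P by (intro chi_variance) auto
  finally have "real (card B) * c\<^sup>2 \<le> 4 * (c * real n + c\<^sup>2 * Z\<^sup>2)" by (simp add: power_divide)
  also have "\<dots> = 4 * (real n / c + Z\<^sup>2) * c\<^sup>2" using c0 by (simp add: power2_eq_square field_simps)
  finally have "real (card B) \<le> 4 * (real n / c + Z\<^sup>2)" using c0 by simp
  moreover have "{d \<in> {a..<a + int n}. 8 * card (split_primes P d) < card P} = (\<lambda>x. a + int x) ` B"
  proof (intro equalityI subsetI)
    fix d assume d: "d \<in> {d \<in> {a..<a + int n}. 8 * card (split_primes P d) < card P}"
    then have "d = a + int (nat (d - a))" by simp
    moreover have "nat (d - a) \<in> B" using d by (auto simp: B_def)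
    ultimately show "d \<in> (\<lambda>x. a + int x) ` B" by blast
  qed (auto simp: B_def)
  then have "card {d \<in> {a..<a + int n}. 8 * card (split_primes P d) < card P} \<le> card B"
    by (simp add: card_image_le B_def)
  ultimately show ?thesis unfolding c_def by linarith
qed

subsection \<open>Counting solutions of the norm equation\<close>

lemma card_residue_class_le:
  fixes S :: "int set" and L :: real
  assumes "finite S" "k > 0" "L \<ge> 0" and cong: "\<And>u v. u \<in> S \<Longrightarrow> v \<in> S \<Longrightarrow> k dvd u - v"
    and diam: "\<And>u v. u \<in> S \<Longrightarrow> v \<in> S \<Longrightarrow> \<bar>real_of_int (u - v)\<bar> \<le> L"
  shows "real (card S) \<le> L / real_of_int k + 1"
proof (cases "S = {}")
  case False
  define m where "m = Min S"
  have m: "m \<in> S" "\<And>u. u \<in> S \<Longrightarrow> m \<le> u" using assms(1) False by (auto simp: m_def)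
  define N where "N = \<lfloor>L / real_of_int k\<rfloor>"
  have "inj_on (\<lambda>u. (u - m) div k) S"
  proof (rule inj_onI)
    fix u v assume uv: "u \<in> S" "v \<in> S" "(u - m) div k = (v - m) div k"
    have "u - m = k * ((u - m) div k)" "v - m = k * ((v - m) div k)"
      using cong[OF uv(1) m(1)] cong[OF uv(2) m(1)] by (simp_all add: dvd_mult_div_cancel)
    then show "u = v" using uv(3) by simp
  qed
  moreover have "(\<lambda>u. (u - m) div k) ` S \<subseteq> {0..N}"
  proof (rule image_subsetI)
    fix u assume u: "u \<in> S"
    then obtain t where t: "u - m = k * t" using cong[OF u m(1)] by (auto elim: dvdE)
    have "k * t \<ge> 0" using m(2)[OF u] t by simp
    then have t0: "t \<ge> 0" using assms(2) by (simp add: zero_le_mult_iff)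
    have "real_of_int k * real_of_int t \<le> L" using diam[OF u m(1)] t t0 assms(2) by simp
    then have "real_of_int t \<le> L / real_of_int k" using assms(2) by (simp add: field_simps)
    then have "t \<le> N" by (simp add: N_def le_floor_iff)
    then show "(u - m) div k \<in> {0..N}" using t t0 assms(2) by simp
  qed
  ultimately have "card S \<le> card {0..N}" by (intro card_inj_on_le) auto
  moreover have "N \<ge> 0" using assms(2,3) by (simp add: N_def)
  ultimately have "real (card S) \<le> real_of_int (N + 1)" by simp
  then show ?thesis unfolding N_def by linarith
qed (use assms in simp)

text \<open>Expanding the product of two Bezout identities leaves only multiples of \<open>m\<close>
  and one multiple of \<open>x * y\<close>.\<close>

lemma dvd_gcd_mult_gcd:
  fixes m x y :: int
  assumes "m dvd x * y"
  shows "m dvd gcd m x * gcd m y"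
proof -
  obtain a b c e where *: "a * m + b * x = gcd m x" "c * m + e * y = gcd m y" by (metis bezout_int)
  have "gcd m x * gcd m y = m * (a * (c * m + e * y) + b * x * c) + b * e * (x * y)"
    unfolding *[symmetric] by (simp add: algebra_simps)
  then show ?thesis using assms by simp
qed

text \<open>Fixing one root \<open>u\<^sub>0\<close>, every other root \<open>u\<close> is determined modulo the least common multiple of
  \<open>gcd m (u - u\<^sub>0)\<close> and \<open>gcd m (u + u\<^sub>0)\<close>, which differs from \<open>m\<close> by a bounded factor.\<close>

lemma card_square_roots_le:
  fixes S :: "int set" and A m :: int and L :: real
  assumes "finite S" "m > 0" "L \<ge> 0" and root: "\<And>u. u \<in> S \<Longrightarrow> m dvd u\<^sup>2 - A"
    and g: "gcd m (4 * A) dvd 16"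
    and diam: "\<And>u v. u \<in> S \<Longrightarrow> v \<in> S \<Longrightarrow> \<bar>real_of_int (u - v)\<bar> \<le> L"
  shows "real (card S) \<le> (real (card {k. k dvd nat m}))\<^sup>2 * (16 * L / real_of_int m + 1)"
proof (cases "S = {}")
  case False
  then obtain u0 where u0: "u0 \<in> S" by blast
  define D where "D = {k. k dvd nat m}"
  have finD: "finite D" using assms(2) by (simp add: D_def)
  define T where "T = (\<lambda>(g1, g2). {u \<in> S. gcd m (u - u0) = int g1 \<and> gcd m (u + u0) = int g2})"
  have cov: "S \<subseteq> (\<Union>g\<in>D \<times> D. T g)"
  proof
    fix u assume u: "u \<in> S"
    have mem: "nat (gcd m x) \<in> D" for x unfolding D_def using assms(2) by (simp add: nat_dvd_iff)
    have "u \<in> T (nat (gcd m (u - u0)), nat (gcd m (u + u0)))" using u by (simp add: T_def)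
    then show "u \<in> (\<Union>g\<in>D \<times> D. T g)" using mem by blast
  qed
  have "real (card (T g)) \<le> 16 * L / real_of_int m + 1" for g
  proof (cases "T g = {}")
    case False
    obtain g1 g2 where gg: "g = (g1, g2)" by (cases g)
    obtain u where u: "u \<in> S" "gcd m (u - u0) = int g1" "gcd m (u + u0) = int g2" using False by (auto simp: T_def gg)
    define k where "k = lcm (int g1) (int g2)"
    have gm: "int g1 dvd m" "int g2 dvd m" using u by (metis gcd_dvd1)+
    have gpos: "int g1 > 0" "int g2 > 0" using gm assms(2) by (auto intro!: Nat.gr0I)
    have "k \<ge> 0" "k \<noteq> 0" using gpos by (simp_all add: k_def)
    then have k0: "k > 0" by linarith
    \<comment> \<open>A common divisor of u - u0 and u + u0 divides 2 u0, hence 4 u0^2. As it also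
      divides m, which divides u0^2 - A, it divides 4A.\<close>
    have "gcd (int g1) (int g2) dvd 16"
    proof -
      let ?h = "gcd (int g1) (int g2)"
      have h: "?h dvd m" by (rule dvd_trans[OF gcd_dvd1 gm(1)])
      have "int g1 dvd u - u0" "int g2 dvd u + u0" unfolding u(2,3)[symmetric] by (rule gcd_dvd2)+
      then have "?h dvd u + u0" "?h dvd u - u0" using dvd_trans[OF gcd_dvd1] dvd_trans[OF gcd_dvd2] by blast+
      then have "?h dvd (u + u0) - (u - u0)" by (rule dvd_diff)
      then have "?h dvd 2 * u0" by simp
      then have "?h dvd 2 * u0 * (2 * u0)" by (rule dvd_mult2)
      moreover have "?h dvd 4 * (u0\<^sup>2 - A)" by (rule dvd_mult[OF dvd_trans[OF h root[OF u0]]])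
      ultimately have "?h dvd 2 * u0 * (2 * u0) - 4 * (u0\<^sup>2 - A)" by (rule dvd_diff)
      also have "2 * u0 * (2 * u0) - 4 * (u0\<^sup>2 - A) = 4 * A" by (simp add: power2_eq_square)
      finally have "?h dvd gcd m (4 * A)" using h by simp
      then show ?thesis using g dvd_trans by blast
    qed
    then have h16: "gcd (int g1) (int g2) \<le> 16" by (intro zdvd_imp_le) auto
    have "m dvd (u\<^sup>2 - A) - (u0\<^sup>2 - A)" using root[OF u(1)] root[OF u0] by (rule dvd_diff)
    also have "(u\<^sup>2 - A) - (u0\<^sup>2 - A) = (u - u0) * (u + u0)" by (simp add: power2_eq_square algebra_simps)
    finally have "m dvd int g1 * int g2" unfolding u(2,3)[symmetric] by (rule dvd_gcd_mult_gcd)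
    then have "m \<le> int g1 * int g2" using gpos by (intro zdvd_imp_le) auto
    also have "\<dots> = gcd (int g1) (int g2) * k"
      unfolding k_def gcd_int_int_eq lcm_int_int_eq of_nat_mult[symmetric] prod_gcd_lcm_nat[symmetric] ..
    also have "\<dots> \<le> 16 * k" using h16 k0 by (intro mult_right_mono) auto
    finally have mk: "real_of_int m \<le> 16 * real_of_int k" by linarith
    have "real (card (T g)) \<le> L / real_of_int k + 1"
    proof (rule card_residue_class_le)
      show "finite (T g)" using assms(1) by (auto simp: T_def gg)
      show "\<bar>real_of_int (x - y)\<bar> \<le> L" if "x \<in> T g" "y \<in> T g" for x y
        using that diam by (simp add: T_def gg)
      show "k dvd x - y" if "x \<in> T g" "y \<in> T g" for x y
      proof -
        have "int g1 dvd x - u0" "int g1 dvd y - u0" "int g2 dvd x + u0" "int g2 dvd y + u0"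
          using that gcd_dvd2[of m "x - u0"] gcd_dvd2[of m "y - u0"] gcd_dvd2[of m "x + u0"] gcd_dvd2[of m "y + u0"]
          by (simp_all add: T_def gg)
        then have "int g1 dvd (x - u0) - (y - u0)" "int g2 dvd (x + u0) - (y + u0)" by (blast intro: dvd_diff)+
        then have "int g1 dvd x - y" "int g2 dvd x - y" by simp_all
        then show ?thesis unfolding k_def by (rule lcm_least)
      qed
    qed (use k0 assms in auto)
    also have "L / real_of_int k \<le> 16 * L / real_of_int m"
      using mk k0 assms(2,3) mult_left_mono[OF mk, of L] by (simp add: field_simps)
    finally show ?thesis by simp
  qed (use assms in simp)
  then have "(\<Sum>g\<in>D \<times> D. real (card (T g))) \<le> (\<Sum>g\<in>D \<times> D. 16 * L / real_of_int m + 1)" by (intro sum_mono)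
  moreover have "real (card S) \<le> (\<Sum>g\<in>D \<times> D. real (card (T g)))"
  proof -
    have "card S \<le> card (\<Union>g\<in>D \<times> D. T g)"
      by (rule card_mono[OF _ cov]) (use finD assms(1) in \<open>auto simp: T_def\<close>)
    also have "\<dots> \<le> (\<Sum>g\<in>D \<times> D. card (T g))" by (rule card_UN_le) (use finD in auto)
    finally show ?thesis by (simp flip: of_nat_sum)
  qed
  ultimately show ?thesis unfolding D_def[symmetric] by (simp add: card_cartesian_product power2_eq_square)
qed (use assms in simp)

section \<open>The norm equation with right-hand side 4 p^a q^b\<close>

text \<open>If p divides v and the right side, it divides u, so the left side is divisible by p^2.
  An odd p not dividing m then forces a \<ge> 2, and p^2 can be cancelled.\<close>

lemma norm_eq_reduce_step:
  fixes p u v d m :: int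
  assumes p: "prime p" "odd p" and a: "a > 0" and m: "\<not> p dvd m" and pv: "p dvd v"
    and eq: "\<bar>u\<^sup>2 - d * v\<^sup>2\<bar> = 4 * p ^ a * m"
  obtains b u' v' where "a = b + 2" "v = p * v'" "\<bar>u'\<^sup>2 - d * v'\<^sup>2\<bar> = 4 * p ^ b * m"
proof -
  obtain v' where v: "v = p * v'" using pv by (auto elim: dvdE)
  have "p dvd 4 * p ^ a * m" using a by (simp add: dvd_power)
  then have "p dvd u\<^sup>2 - d * v\<^sup>2" unfolding eq[symmetric] by simp
  moreover have "p dvd d * v\<^sup>2" using pv by (simp add: power2_eq_square)
  ultimately have "p dvd (u\<^sup>2 - d * v\<^sup>2) + d * v\<^sup>2" by (rule dvd_add)
  then have "p dvd u\<^sup>2" by simp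
  then have "p dvd u" by (rule prime_dvd_power[OF p(1)])
  then obtain u' where u: "u = p * u'" by (auto elim: dvdE)
  have e: "p\<^sup>2 * \<bar>u'\<^sup>2 - d * v'\<^sup>2\<bar> = 4 * p ^ a * m"
  proof -
    have "u\<^sup>2 - d * v\<^sup>2 = p\<^sup>2 * (u'\<^sup>2 - d * v'\<^sup>2)" unfolding u v by (simp add: power_mult_distrib algebra_simps)
    then show ?thesis unfolding eq[symmetric] by (simp add: abs_mult)
  qed
  have p0: "p > 0" using p prime_gt_0_int by blast
  have "a \<noteq> 1"
  proof
    assume "a = 1"
    then have "p * (p * \<bar>u'\<^sup>2 - d * v'\<^sup>2\<bar>) = p * (4 * m)" using e by (simp add: power2_eq_square mult_ac)
    then have "p * \<bar>u'\<^sup>2 - d * v'\<^sup>2\<bar> = 4 * m" using p0 by simp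
    then have "p dvd 4 * m" by (metis dvd_triv_left)
    from prime_dvd_multD[OF p(1) this] m have "p dvd 2 ^ 2" by simp
    then have "p dvd 2" by (rule prime_dvd_power[OF p(1)])
    then have "p = 2" by (rule primes_dvd_imp_eq[OF p(1) two_is_prime])
    then show False using p by simp
  qed
  then have "2 \<le> a" using a by simp
  then obtain b where b: "a = b + 2" using le_Suc_ex[of 2 a] by (auto simp: add.commute)
  have "p\<^sup>2 * \<bar>u'\<^sup>2 - d * v'\<^sup>2\<bar> = p\<^sup>2 * (4 * p ^ b * m)" using e by (simp add: b power_add power2_eq_square mult_ac)
  then have "\<bar>u'\<^sup>2 - d * v'\<^sup>2\<bar> = 4 * p ^ b * m" using p0 by simp
  then show ?thesis using that b v by blast
qed

lemma prime_not_dvd_prime_power: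
  fixes p q :: int
  assumes "prime p" "prime q" "p \<noteq> q"
  shows "\<not> p dvd q ^ b"
proof
  assume "p dvd q ^ b"
  then have "p dvd q" by (rule prime_dvd_power[OF assms(1)])
  then have "p = q" by (rule primes_dvd_imp_eq[OF assms(1,2)])
  then show False using assms(3) by simp
qed

text \<open>Counting square roots modulo v^2 degenerates when v shares large factors with the
  right-hand side. Cancelling p and q as long as they divide both makes v coprime to it; v shrinks
  at every step, and the two exponents may drop independently.\<close>

lemma norm_eq_reduce:
  fixes p q u v d :: int
  assumes pq: "prime p" "odd p" "prime q" "odd q" "p \<noteq> q" and v: "v > 0"
    and eq: "\<bar>u\<^sup>2 - d * v\<^sup>2\<bar> = 4 * p ^ a * q ^ b"
  shows "\<exists>a' b' u' v'. a' \<le> a \<and> b' \<le> b \<and> 0 < v' \<and> v' \<le> v \<and> \<bar>u'\<^sup>2 - d * v'\<^sup>2\<bar> = 4 * p ^ a' * q ^ b' \<and>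
    coprime v' (p ^ a' * q ^ b')"
  using v eq
proof (induction "nat v" arbitrary: u v a b rule: less_induct)
  case less
  have p0: "p > 1" "q > 1" using pq prime_gt_1_int by auto
  have descend: ?case if "v = r * v'" "r > 1" "\<bar>u'\<^sup>2 - d * v'\<^sup>2\<bar> = 4 * p ^ a' * q ^ b'" "a' \<le> a" "b' \<le> b" for r v' u' a' b'
  proof -
    have v': "v' > 0" using that(1,2) less.prems(1) by (simp add: zero_less_mult_iff)
    have "v' < v" using that(1,2) v' by simp
    then have "nat v' < nat v" using v' by simp
    from less.hyps[OF this v' that(3)] obtain a'' b'' u'' v'' where "a'' \<le> a'" "b'' \<le> b'" "0 < v''" "v'' \<le> v'"
      "\<bar>u''\<^sup>2 - d * v''\<^sup>2\<bar> = 4 * p ^ a'' * q ^ b''" "coprime v'' (p ^ a'' * q ^ b'')" by blast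
    then show ?thesis using \<open>v' < v\<close> that(4,5)
      by (intro exI[of _ a''] exI[of _ b''] exI[of _ u''] exI[of _ v''] conjI) linarith+
  qed
  show ?case
  proof (cases "a > 0 \<and> p dvd v")
    case True
    obtain a' u' v' where *: "a = a' + 2" "v = p * v'" "\<bar>u'\<^sup>2 - d * v'\<^sup>2\<bar> = 4 * p ^ a' * q ^ b"
      by (rule norm_eq_reduce_step[OF pq(1,2) conjunct1[OF True] prime_not_dvd_prime_power[OF pq(1,3,5)] conjunct2[OF True] less.prems(2)])
    show ?thesis by (rule descend[OF *(2) p0(1) *(3)]) (use * in auto)
  next
    case a: False
    show ?thesis
    proof (cases "b > 0 \<and> q dvd v")
      case True
      have "\<bar>u\<^sup>2 - d * v\<^sup>2\<bar> = 4 * q ^ b * p ^ a" using less.prems(2) by (simp add: mult_ac)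
      then obtain b' u' v' where *: "b = b' + 2" "v = q * v'" "\<bar>u'\<^sup>2 - d * v'\<^sup>2\<bar> = 4 * q ^ b' * p ^ a"
        by (rule norm_eq_reduce_step[OF pq(3,4) conjunct1[OF True] prime_not_dvd_prime_power[OF pq(3,1) pq(5)[symmetric]] conjunct2[OF True]])
      have "\<bar>u'\<^sup>2 - d * v'\<^sup>2\<bar> = 4 * p ^ a * q ^ b'" using *(3) by (simp add: mult_ac)
      then show ?thesis by (rule descend[OF *(2) p0(2)]) (use * in auto)
    next
      case False
      have "coprime v (p ^ a)"
        using a pq(1) by (cases "a = 0") (auto simp: coprime_commute intro!: prime_imp_coprime)
      moreover have "coprime v (q ^ b)"
        using False pq(3) by (cases "b = 0") (auto simp: coprime_commute intro!: prime_imp_coprime)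
      ultimately have "coprime v (p ^ a * q ^ b)" by simp
      then show ?thesis using less.prems by (intro exI[of _ a] exI[of _ b] exI[of _ u] exI[of _ v]) auto
    qed
  qed
qed

text \<open>For fixed \<open>v\<close> and \<open>A\<close> the value \<open>d\<close> is determined
  by \<open>u\<close>, so it suffices to count the square roots \<open>u\<close> of \<open>A\<close>
  modulo v^2 that lie in a short range.\<close>

lemma card_norm_solutions_le:
  fixes v A :: int and Y :: real
  assumes v: "v > 0" and g: "gcd (v\<^sup>2) (4 * A) dvd 16" and Y: "Y \<ge> 0"
  defines "U \<equiv> {d. Y \<le> of_int d \<and> of_int d < 2 * Y \<and> (\<exists>u. u\<^sup>2 - d * v\<^sup>2 = A)}"
  shows "finite U" "real (card U) \<le> (real (card {k. k dvd nat (v\<^sup>2)}))\<^sup>2 * (16 * sqrt Y / of_int v + 1)"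
proof -
  show finU: "finite U"
  proof (rule finite_subset)
    show "U \<subseteq> {\<lfloor>Y\<rfloor>..\<lceil>2 * Y\<rceil>}" by (auto simp: U_def floor_le_iff le_ceiling_iff)
  qed auto
  define f where "f d = (SOME u. u \<ge> 0 \<and> u\<^sup>2 - d * v\<^sup>2 = A)" for d
  have f: "f d \<ge> 0" "(f d)\<^sup>2 - d * v\<^sup>2 = A" if dU: "d \<in> U" for d
  proof -
    have "\<exists>u. u\<^sup>2 - d * v\<^sup>2 = A" using dU by (simp add: U_def)
    then obtain u where "u\<^sup>2 - d * v\<^sup>2 = A" by blast
    then have "\<exists>u. u \<ge> 0 \<and> u\<^sup>2 - d * v\<^sup>2 = A" by (intro exI[of _ "\<bar>u\<bar>"]) simp
    then have "f d \<ge> 0 \<and> (f d)\<^sup>2 - d * v\<^sup>2 = A" unfolding f_def by (rule someI_ex)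
    then show "f d \<ge> 0" "(f d)\<^sup>2 - d * v\<^sup>2 = A" by auto
  qed
  have inj: "inj_on f U"
  proof (rule inj_onI)
    fix d e assume de: "d \<in> U" "e \<in> U" "f d = f e"
    then have "d * v\<^sup>2 = e * v\<^sup>2" using f(2)[OF de(1)] f(2)[OF de(2)] unfolding de(3) by linarith
    then show "d = e" using v by simp
  qed
  have diam0: "real_of_int (f d - f e) \<le> sqrt Y * of_int v" if de: "d \<in> U" "e \<in> U" for d e
  proof (cases "f e \<le> f d")
    case True
    \<comment> \<open>Since the chosen roots are nonnegative, the difference is at most the sum, and
      the product of the two is (d - e) v^2 \<le> Y v^2. So the roots lie within sqrt(Y) v of each
      other.\<close>
    have "(f d - f e)\<^sup>2 \<le> (f d - f e) * (f d + f e)"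
      using True f(1)[OF de(1)] f(1)[OF de(2)] by (simp add: power2_eq_square mult_left_mono)
    also have "\<dots> = (d - e) * v\<^sup>2" using f(2)[OF de(1)] f(2)[OF de(2)] by (simp add: power2_eq_square algebra_simps)
    finally have "real_of_int ((f d - f e)\<^sup>2) \<le> real_of_int ((d - e) * v\<^sup>2)" by (rule of_int_le_iff[THEN iffD2])
    also have "\<dots> = (real_of_int d - real_of_int e) * (real_of_int v)\<^sup>2" by simp
    also have "\<dots> \<le> Y * (real_of_int v)\<^sup>2" using de by (intro mult_right_mono) (auto simp: U_def)
    finally have "(real_of_int (f d - f e))\<^sup>2 \<le> (sqrt Y * of_int v)\<^sup>2" using Y by (simp add: power_mult_distrib)
    then show ?thesis by (rule power2_le_imp_le) (use Y v in auto)
  next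
    case False
    then have "real_of_int (f d - f e) \<le> 0" by simp
    also have "0 \<le> sqrt Y * of_int v" using Y v by simp
    finally show ?thesis .
  qed
  have diam: "\<bar>real_of_int (x - y)\<bar> \<le> sqrt Y * of_int v" if "x \<in> f ` U" "y \<in> f ` U" for x y
    using that diam0 by (auto simp: abs_le_iff)
  have "real (card (f ` U)) \<le> (real (card {k. k dvd nat (v\<^sup>2)}))\<^sup>2 * (16 * (sqrt Y * of_int v) / real_of_int (v\<^sup>2) + 1)"
  proof (rule card_square_roots_le[OF _ _ _ _ g])
    show "v\<^sup>2 dvd u\<^sup>2 - A" if uU: "u \<in> f ` U" for u
    proof -
      obtain d where "d \<in> U" "u = f d" using uU by blast
      then have "u\<^sup>2 - A = d * v\<^sup>2" using f(2)[of d] by simp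
      then show ?thesis by simp
    qed
  qed (use finU v Y diam in auto)
  also have "16 * (sqrt Y * of_int v) / real_of_int (v\<^sup>2) = 16 * sqrt Y / of_int v"
    using v by (simp add: power2_eq_square)
  finally show "real (card U) \<le> (real (card {k. k dvd nat (v\<^sup>2)}))\<^sup>2 * (16 * sqrt Y / of_int v + 1)"
    by (simp only: card_image[OF inj])
qed

text \<open>The exponent of the odd prime p on the right is the odd number l. This rules out v = 0,
  where the norm equation would say nothing about d.\<close>

lemma four_prod_power_not_square:
  fixes p q u :: int
  assumes "prime p" "odd p" "prime q" "p \<noteq> q" "odd l"
  shows "u\<^sup>2 \<noteq> 4 * (p * q) ^ l"
proof
  assume eq: "u\<^sup>2 = 4 * (p * q) ^ l"
  have p2: "\<not> p dvd 2 ^ 2"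
  proof
    assume "p dvd 2 ^ 2"
    then have "p dvd 2" by (rule prime_dvd_power[OF assms(1)])
    then have "p = 2" by (rule primes_dvd_imp_eq[OF assms(1) two_is_prime])
    then show False using assms(2) by simp
  qed
  have u0: "u \<noteq> 0" using eq assms by auto
  have pe: "prime_elem p" using assms(1) by (rule prime_imp_prime_elem)
  have nz: "4 * q ^ l \<noteq> 0" "p ^ l \<noteq> 0" using assms by auto
  have "\<not> p dvd 4 * q ^ l" using p2 prime_not_dvd_prime_power[OF assms(1,3,4)] assms(1) by (simp add: prime_dvd_mult_iff)
  then have "multiplicity p (4 * q ^ l) = 0" by (rule not_dvd_imp_multiplicity_0)
  moreover have "4 * (p * q) ^ l = (4 * q ^ l) * p ^ l" by (simp add: power_mult_distrib)
  ultimately have "multiplicity p (u\<^sup>2) = l"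
    using eq pe nz by (simp add: prime_elem_multiplicity_mult_distrib prime_elem_multiplicity_power_distrib multiplicity_same_power)
  moreover have "multiplicity p (u\<^sup>2) = 2 * multiplicity p u"
    using pe u0 by (simp add: prime_elem_multiplicity_power_distrib)
  ultimately have "l = 2 * multiplicity p u" by simp
  then show False using assms(5) by (metis dvd_triv_left)
qed

text \<open>With B coprime to v, only the two factors 4 can be shared: one from the norm equation
  for half-integers, one from the comparison of square roots.\<close>

lemma gcd_square_coprime:
  fixes v B \<sigma> :: int
  assumes "coprime v B" "\<sigma> = 1 \<or> \<sigma> = - 1"
  shows "gcd (v\<^sup>2) (4 * (\<sigma> * (4 * B))) dvd 16"
proof -
  let ?g = "gcd (v\<^sup>2) (4 * (\<sigma> * (4 * B)))"
  have "?g dvd v\<^sup>2" "?g dvd 4 * (\<sigma> * (4 * B))" by (rule gcd_dvd1, rule gcd_dvd2)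
  moreover have "coprime (v\<^sup>2) B" using assms(1) by simp
  ultimately have "coprime ?g B" by (meson coprime_divisors dvd_refl)
  moreover have "?g dvd (16 * \<sigma>) * B" using \<open>?g dvd 4 * (\<sigma> * (4 * B))\<close> by (simp add: mult_ac)
  ultimately have "?g dvd 16 * \<sigma>" by (simp only: coprime_dvd_mult_left_iff)
  then show ?thesis using assms(2) by auto
qed

lemma harm_le_ln: "harm n \<le> 1 + ln (1 + real n)"
proof (cases n)
  case (Suc m)
  have "harm (Suc m) - ln (real (Suc m)) \<le> harm (Suc 0) - ln (real (Suc 0))"
    using decseqD[OF decseq_harm_diff_ln, of 0 m] by simp
  then have "harm n - ln (real n) \<le> 1" by (simp add: Suc harm_expand)
  moreover have "ln (real n) \<le> ln (1 + real n)" by (simp add: Suc)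
  ultimately show ?thesis by linarith
qed (simp add: harm_def)

text \<open>Reduction only decreases v, so Y v^2 \<le> d v^2 \<le> 8 (pq)^l \<le> 8 Z^(2l) still
  bounds it; \<sigma> records the sign of the norm.\<close>

lemma norm_solvable_reduced:
  fixes p q :: nat and Z Y :: real
  assumes p: "prime p" "odd p" "prime q" "odd q" "p \<noteq> q" and pZ: "real p \<le> Z" "real q \<le> Z" and l: "odd l"
    and Y: "Y > 0" "Y \<le> of_int d"
    and sol: "norm_solvable d l (int p) (int q)"
  shows "\<exists>a b v \<sigma>. a \<le> l \<and> b \<le> l \<and> v > 0 \<and> of_int v \<le> sqrt 8 * Z ^ l / sqrt Y \<and> (\<sigma> = 1 \<or> \<sigma> = - 1) \<and>
     coprime v (int p ^ a * int q ^ b) \<and> (\<exists>u. u\<^sup>2 - d * v\<^sup>2 = \<sigma> * (4 * (int p ^ a * int q ^ b)))"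
proof -
  have pq: "prime (int p)" "odd (int p)" "prime (int q)" "odd (int q)" "int p \<noteq> int q" using p by auto
  obtain u v where uv: "\<bar>u\<^sup>2 - d * v\<^sup>2\<bar> = 4 * (int p * int q) ^ l" "d * v\<^sup>2 \<le> 8 * (int p * int q) ^ l"
    using sol by (auto simp: norm_solvable_def)
  have v0: "v \<noteq> 0"
  proof
    assume "v = 0"
    then have "u\<^sup>2 = 4 * (int p * int q) ^ l" using uv(1) by simp
    then show False using four_prod_power_not_square[OF pq(1-3,5) l] by blast
  qed
  have "\<bar>u\<^sup>2 - d * \<bar>v\<bar>\<^sup>2\<bar> = 4 * int p ^ l * int q ^ l" using uv(1) by (simp add: power_mult_distrib mult_ac)
  then obtain a b u' v' where *: "a \<le> l" "b \<le> l" "0 < v'" "v' \<le> \<bar>v\<bar>"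
    "\<bar>u'\<^sup>2 - d * v'\<^sup>2\<bar> = 4 * int p ^ a * int q ^ b" "coprime v' (int p ^ a * int q ^ b)"
    using norm_eq_reduce[OF pq, of "\<bar>v\<bar>" u d l l] v0 by auto
  have vb: "of_int v' \<le> sqrt 8 * Z ^ l / sqrt Y"
  proof -
    have "real_of_int (v'\<^sup>2) \<le> real_of_int (\<bar>v\<bar>\<^sup>2)" unfolding of_int_le_iff using *(3,4) by (intro power_mono) auto
    then have "Y * (real_of_int v')\<^sup>2 \<le> of_int d * (real_of_int v)\<^sup>2" using Y by (intro mult_mono) auto
    also have "\<dots> = real_of_int (d * v\<^sup>2)" by simp
    also have "\<dots> \<le> real_of_int (8 * (int p * int q) ^ l)" unfolding of_int_le_iff by (rule uv(2))
    also have "\<dots> = 8 * (real p * real q) ^ l" by simp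
    also have "\<dots> \<le> 8 * (Z * Z) ^ l"
      using pZ by (intro mult_left_mono power_mono mult_mono) (auto intro: order_trans[OF of_nat_0_le_iff])
    also have "\<dots> = (sqrt 8 * Z ^ l)\<^sup>2" by (simp add: power_mult_distrib power2_eq_square)
    finally have sq: "(sqrt Y * real_of_int v')\<^sup>2 \<le> (sqrt 8 * Z ^ l)\<^sup>2" using Y by (simp add: power_mult_distrib)
    have "Z \<ge> 0" using pZ(1) by (rule order_trans[OF of_nat_0_le_iff])
    then have "0 \<le> sqrt 8 * Z ^ l" by simp
    with sq have "sqrt Y * real_of_int v' \<le> sqrt 8 * Z ^ l" by (rule power2_le_imp_le)
    then show ?thesis using Y by (simp add: field_simps)
  qed
  define \<sigma> :: int where "\<sigma> = (if u'\<^sup>2 - d * v'\<^sup>2 \<ge> 0 then 1 else - 1)"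
  have "u'\<^sup>2 - d * v'\<^sup>2 = \<sigma> * (4 * (int p ^ a * int q ^ b))" using *(5) by (auto simp: \<sigma>_def abs_if mult_ac split: if_splits)
  moreover have "\<sigma> = 1 \<or> \<sigma> = - 1" by (simp add: \<sigma>_def)
  ultimately show ?thesis using * vb by blast
qed

text \<open>For each pair of primes, each choice of exponents and sign and each v, at most D^2 (16
  sqrt Y / v + 1) values of d occur. The first term sums over v \<le> V to a logarithm, the second
  to V.\<close>

theorem collision_count:
  fixes P :: "nat set" and Y Z D :: real
  assumes P: "finite P" "\<And>p. p \<in> P \<Longrightarrow> prime p \<and> odd p" "\<And>p. p \<in> P \<Longrightarrow> real p \<le> Z"
    and l: "odd l" and Y: "Y \<ge> 1" and Z: "Z \<ge> 0"
  defines "V \<equiv> sqrt 8 * Z ^ l / sqrt Y"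
  assumes D: "\<And>v. 0 < v \<Longrightarrow> of_int v \<le> V \<Longrightarrow> real (card {k. k dvd nat (v\<^sup>2)}) \<le> D"
  defines "S \<equiv> {(d, p, q). Y \<le> of_int d \<and> of_int d < 2 * Y \<and> p \<in> P \<and> q \<in> P \<and> p \<noteq> q \<and> norm_solvable d l (int p) (int q)}"
  shows "real (card S) \<le> (real (card P))\<^sup>2 * (2 * (real l + 1)\<^sup>2) * D\<^sup>2 * (16 * sqrt Y * (1 + ln (1 + V)) + V)"
proof -
  define n where "n = nat \<lfloor>V\<rfloor>"
  have V0: "V \<ge> 0" using Y Z by (simp add: V_def)
  have nV: "real n \<le> V" using V0 by (simp add: n_def)
  define W where "W = (\<lambda>(p, q, a, b, \<sigma>, v). if coprime v (int p ^ a * int q ^ b)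
     then {d. Y \<le> of_int d \<and> of_int d < 2 * Y \<and> (\<exists>u. u\<^sup>2 - d * v\<^sup>2 = \<sigma> * (4 * (int p ^ a * int q ^ b)))} else {})"
  \<comment> \<open>The exponents run separately up to \<open>l\<close> because the reduction may
    lower them by different amounts; exponents and signs together cause the factor 2 (l +
    1)^2.\<close>
  define Ix where "Ix = P \<times> P \<times> {..l} \<times> {..l} \<times> {1, - 1 :: int} \<times> {1..int n}"
  have finIx: "finite Ix" using P by (simp add: Ix_def)
  have W: "finite (W ix) \<and> real (card (W ix)) \<le> D\<^sup>2 * (16 * sqrt Y / of_int (snd (snd (snd (snd (snd ix))))) + 1)"
    if "ix \<in> Ix" for ix
  proof -
    obtain p q a b \<sigma> v where ix: "ix = (p, q, a, b, \<sigma>, v)" by (cases ix) auto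
    have v: "v > 0" "of_int v \<le> V" and s: "\<sigma> = 1 \<or> \<sigma> = - 1" using that V0 by (auto simp: ix Ix_def n_def le_nat_iff le_floor_iff)
    have v2: "16 * sqrt Y / of_int v + 1 \<ge> 0" using v Y by simp
    show ?thesis
    proof (cases "coprime v (int p ^ a * int q ^ b)")
      case True
      have "(real (card {k. k dvd nat (v\<^sup>2)}))\<^sup>2 * (16 * sqrt Y / of_int v + 1) \<le> D\<^sup>2 * (16 * sqrt Y / of_int v + 1)"
        using D[OF v] v2 by (intro mult_right_mono power_mono) auto
      then show ?thesis
        using card_norm_solutions_le[OF v(1) gcd_square_coprime[OF True s], of Y] Y True by (simp add: W_def ix)
    next
      case False
      then have "W ix = {}" unfolding W_def ix by (simp only: prod.case if_False)
      then show ?thesis using v2 by (simp add: ix)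
    qed
  qed
  define g :: "nat \<times> nat \<times> nat \<times> nat \<times> int \<times> int \<Rightarrow> int \<Rightarrow> int \<times> nat \<times> nat"
    where "g = (\<lambda>(p, q, _) d. (d, p, q))"
  have "S \<subseteq> (\<Union>ix\<in>Ix. g ix ` W ix)"
  proof
    fix x assume "x \<in> S"
    then obtain d p q where x: "x = (d, p, q)" "Y \<le> of_int d" "of_int d < 2 * Y" "p \<in> P" "q \<in> P" "p \<noteq> q"
      "norm_solvable d l (int p) (int q)" by (auto simp: S_def)
    obtain a b v \<sigma> where *: "a \<le> l" "b \<le> l" "v > 0" "of_int v \<le> V" "\<sigma> = 1 \<or> \<sigma> = - 1"
     "coprime v (int p ^ a * int q ^ b)" "\<exists>u. u\<^sup>2 - d * v\<^sup>2 = \<sigma> * (4 * (int p ^ a * int q ^ b))"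
    proof -
      have "prime p" "odd p" "prime q" "odd q" "real p \<le> Z" "real q \<le> Z" "Y > 0" using P x Y by auto
      from norm_solvable_reduced[OF this(1-4) x(6) this(5,6) l this(7) x(2,7)] show ?thesis
        unfolding V_def[symmetric] using that by blast
    qed
    have "v \<le> int n" using *(3,4) by (simp add: n_def le_floor_iff)
    then have "(p, q, a, b, \<sigma>, v) \<in> Ix" using x * by (auto simp: Ix_def)
    moreover have "d \<in> W (p, q, a, b, \<sigma>, v)" using x * by (simp add: W_def)
    then have "(d, p, q) \<in> g (p, q, a, b, \<sigma>, v) ` W (p, q, a, b, \<sigma>, v)"
      by (intro image_eqI[of _ _ d]) (simp_all add: g_def)
    ultimately show "x \<in> (\<Union>ix\<in>Ix. g ix ` W ix)" unfolding x(1) by (rule UN_I)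
  qed
  then have "card S \<le> card (\<Union>ix\<in>Ix. g ix ` W ix)" by (intro card_mono) (use finIx W in auto)
  also have "\<dots> \<le> (\<Sum>ix\<in>Ix. card (g ix ` W ix))" by (rule card_UN_le[OF finIx])
  also have "\<dots> \<le> (\<Sum>ix\<in>Ix. card (W ix))" using W by (intro sum_mono card_image_le) auto
  finally have "real (card S) \<le> (\<Sum>ix\<in>Ix. real (card (W ix)))" by (simp flip: of_nat_sum)
  also have "\<dots> \<le> (\<Sum>ix\<in>Ix. D\<^sup>2 * (16 * sqrt Y / of_int (snd (snd (snd (snd (snd ix))))) + 1))"
    using W by (intro sum_mono) auto
  also have "\<dots> = (\<Sum>p\<in>P. \<Sum>q\<in>P. \<Sum>a\<le>l. \<Sum>b\<le>l. \<Sum>\<sigma>\<in>{1, - 1 :: int}. \<Sum>v\<in>{1..int n}. D\<^sup>2 * (16 * sqrt Y / of_int v + 1))"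
    unfolding Ix_def sum.cartesian_product by (intro sum.cong refl) auto
  also have "\<dots> = (real (card P))\<^sup>2 * (2 * (real l + 1)\<^sup>2) * (\<Sum>v\<in>{1..int n}. D\<^sup>2 * (16 * sqrt Y / of_int v + 1))"
    by (simp add: power2_eq_square mult_ac add_ac)
  also have "(\<Sum>v\<in>{1..int n}. D\<^sup>2 * (16 * sqrt Y / of_int v + 1)) = D\<^sup>2 * (16 * sqrt Y * harm n + real n)"
  proof -
    have "(\<Sum>v\<in>{1..int n}. D\<^sup>2 * (16 * sqrt Y / of_int v + 1)) = (\<Sum>v\<in>{1..n}. D\<^sup>2 * (16 * sqrt Y / real v + 1))"
      by (rule sum.reindex_bij_witness[of _ int nat]) auto
    also have "\<dots> = D\<^sup>2 * (16 * sqrt Y * harm n + real n)"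
      by (simp add: harm_def sum_distrib_left[symmetric] sum.distrib divide_inverse)
    finally show ?thesis .
  qed
  also have "(real (card P))\<^sup>2 * (2 * (real l + 1)\<^sup>2) * (D\<^sup>2 * (16 * sqrt Y * harm n + real n))
     \<le> (real (card P))\<^sup>2 * (2 * (real l + 1)\<^sup>2) * (D\<^sup>2 * (16 * sqrt Y * (1 + ln (1 + V)) + V))"
  proof -
    have "harm n \<le> 1 + ln (1 + real n)" by (rule harm_le_ln)
    also have "\<dots> \<le> 1 + ln (1 + V)" using nV by simp
    finally have "harm n \<le> 1 + ln (1 + V)" .
    then show ?thesis using nV Y by (intro mult_left_mono add_mono) auto
  qed
  finally show ?thesis by (simp add: mult.assoc)
qed

subsection \<open>Averaging over dyadic ranges\<close>

text \<open>An upper bound for the number of cells, where log2(2 sqrt d) + 1 replaces the integer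
  \<open>L\<close> of \<open>class_torsion_bound\<close>.\<close>

definition torsion_factor :: "nat \<Rightarrow> int \<Rightarrow> real" where
  "torsion_factor l d = real (card (forms d)) * (2 * real l * (log 2 (2 * sqrt (of_int d)) + 1) + 1)"

lemma class_torsion_le_factor:
  assumes d: "d > 1" "squarefree d" and l: "l \<ge> 1" and P: "finite P" "\<And>p. p \<in> P \<Longrightarrow> \<exists>r. split_pair d p r"
  shows "real (class_torsion l d) * (real (card P))\<^sup>2 \<le>
     torsion_factor l d * (real (card P) + real (card {(p, q) \<in> P \<times> P. p \<noteq> q \<and> norm_solvable d l p q}))"
proof -
  interpret real_quadratic d using d by unfold_locales
  define L where "L = nat \<lceil>log 2 (2 * sqrt (real_of_int d))\<rceil>"
  have "1 * 1 \<le> 2 * sqrt (real_of_int d)" using d(1) by (intro mult_mono) auto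
  then have lg: "log 2 (2 * sqrt (real_of_int d)) \<ge> 0" using d(1) by (subst zero_le_log_cancel_iff) auto
  have L1: "log 2 (2 * sqrt (real_of_int d)) \<le> real L" unfolding L_def by (rule real_nat_ceiling_ge)
  have L2: "real L \<le> log 2 (2 * sqrt (real_of_int d)) + 1" using lg unfolding L_def by linarith
  have "2 * sqrt (real_of_int d) = 2 powr log 2 (2 * sqrt (real_of_int d))" using d(1) by simp
  also have "\<dots> \<le> 2 powr real L" using L1 by simp
  also have "\<dots> = 2 ^ L" by (simp add: powr_realpow)
  finally have L3: "2 * sqrt (real_of_int d) \<le> 2 ^ L" .
  define r where "r p = (SOME r. split_pair d p r)" for p
  have r: "split_pair d p (r p)" if "p \<in> P" for p
    unfolding r_def by (rule someI_ex) (rule P(2)[OF that])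
  define E where "E = card P + card {(p, q) \<in> P \<times> P. p \<noteq> q \<and> norm_solvable d l p q}"
  have "class_torsion l d * (card P)\<^sup>2 \<le> card (forms d) * (2 * l * L + 1) * E"
    unfolding E_def by (rule class_torsion_bound[OF l P(1) r L3])
  then have "real (class_torsion l d * (card P)\<^sup>2) \<le> real (card (forms d) * (2 * l * L + 1) * E)"
    by (rule of_nat_mono)
  also have "\<dots> = real (card (forms d)) * (2 * real l * real L + 1) * real E" by (simp add: algebra_simps)
  also have "\<dots> \<le> torsion_factor l d * real E"
    unfolding torsion_factor_def using L2 by (intro mult_right_mono mult_left_mono add_mono) auto
  finally show ?thesis by (simp add: E_def)
qed

text \<open>The single element 1, whose ideal is Z[sqrt d], leaves no pairs of distinct entries, so
  the torsion is bounded by the number of cells.\<close>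

lemma class_torsion_le_trivial:
  assumes d: "d > 1" "squarefree d" and l: "l \<ge> 1"
  shows "real (class_torsion l d) \<le> torsion_factor l d"
proof -
  have "\<exists>r. split_pair d p r" if "p \<in> {1}" for p using that by (auto simp: split_pair_def)
  moreover have "{(p, q) \<in> {1::int} \<times> {1}. p \<noteq> q \<and> norm_solvable d l p q} = {}" by auto
  ultimately show ?thesis using class_torsion_le_factor[OF d l, of "{1}"] by (simp only: card.empty) simp
qed

text \<open>At least c/8 of the c primes split, whence the factors 8 and 64. Collisions are counted
  over all of \<open>P\<close>, so that the index set no longer depends on \<open>d\<close> and the
  sum over \<open>d\<close> can be taken.\<close>

lemma class_torsion_le_split:
  fixes P :: "nat set"
  assumes d: "d > 1" "squarefree d" and l: "l \<ge> 1" and P: "finite P" "\<And>p. p \<in> P \<Longrightarrow> p > 0" and c: "card P > 0"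
    and good: "card P \<le> 8 * card (split_primes P d)"
  shows "real (class_torsion l d) \<le> torsion_factor l d *
     (8 / real (card P) + 64 * real (card {(p, q) \<in> P \<times> P. p \<noteq> q \<and> norm_solvable d l (int p) (int q)}) / (real (card P))\<^sup>2)"
proof -
  let ?S = "split_primes P d"
  define E where "E = real (card {(p, q) \<in> P \<times> P. p \<noteq> q \<and> norm_solvable d l (int p) (int q)})"
  define M where "M = real (card ?S)"
  define c where "c = real (card P)"
  have SP: "?S \<subseteq> P" "finite ?S" using P by (auto simp: split_primes_def)
  have c0: "c > 0" and Mc: "c \<le> 8 * M" using c good by (simp_all add: c_def M_def)
  have M0: "M > 0" using c0 Mc by linarith
  have ci: "card (int ` ?S) = card ?S" by (simp add: card_image)
  have "card {(p, q) \<in> int ` ?S \<times> int ` ?S. p \<noteq> q \<and> norm_solvable d l p q}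
     \<le> card {(p, q) \<in> P \<times> P. p \<noteq> q \<and> norm_solvable d l (int p) (int q)}"
  proof (rule surj_card_le)
    show "finite {(p, q) \<in> P \<times> P. p \<noteq> q \<and> norm_solvable d l (int p) (int q)}"
      by (rule finite_subset[of _ "P \<times> P"]) (use P in auto)
    show "{(p, q) \<in> int ` ?S \<times> int ` ?S. p \<noteq> q \<and> norm_solvable d l p q}
       \<subseteq> (\<lambda>(p, q). (int p, int q)) ` {(p, q) \<in> P \<times> P. p \<noteq> q \<and> norm_solvable d l (int p) (int q)}"
      using SP(1) by (force simp: image_iff)
  qed
  then have E: "real (card {(p, q) \<in> int ` ?S \<times> int ` ?S. p \<noteq> q \<and> norm_solvable d l p q}) \<le> E" by (simp add: E_def)
  have "\<exists>r. split_pair d p r" if "p \<in> int ` ?S" for p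
    using that P(2) by (auto simp: split_primes_def split_pair_def)
  then have "real (class_torsion l d) * M\<^sup>2 \<le> torsion_factor l d *
      (M + real (card {(p, q) \<in> int ` ?S \<times> int ` ?S. p \<noteq> q \<and> norm_solvable d l p q}))"
    using class_torsion_le_factor[OF d l, of "int ` ?S"] SP(2) by (simp add: ci M_def)
  moreover have T0: "torsion_factor l d \<ge> 0"
    using class_torsion_le_trivial[OF d l] by (rule order_trans[OF of_nat_0_le_iff])
  ultimately have "real (class_torsion l d) * M\<^sup>2 \<le> torsion_factor l d * (M + E)"
    using E by (meson add_left_mono mult_left_mono order_trans)
  then have "real (class_torsion l d) \<le> torsion_factor l d * (M + E) / M\<^sup>2" using M0 by (simp add: field_simps)
  also have "\<dots> = torsion_factor l d * (1 / M + E / M\<^sup>2)" using M0 by (simp add: field_simps power2_eq_square)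
  also have "\<dots> \<le> torsion_factor l d * (8 / c + 64 * E / c\<^sup>2)"
  proof (intro mult_left_mono add_mono T0)
    show "1 / M \<le> 8 / c" using Mc M0 c0 by (simp add: field_simps)
    have "c\<^sup>2 \<le> (8 * M)\<^sup>2" using Mc c0 by (intro power_mono) auto
    then have "E * c\<^sup>2 \<le> E * (64 * M\<^sup>2)" by (intro mult_left_mono) (auto simp: power_mult_distrib E_def)
    then show "E / M\<^sup>2 \<le> 64 * E / c\<^sup>2" using M0 c0 by (simp add: field_simps)
  qed
  finally show ?thesis by (simp add: E_def c_def)
qed

text \<open>There are at most 2 sqrt d + 1 choices of b, and k is a divisor of d - b^2. This number
  is nonzero, since d > 1 is not a square, and has absolute value at most 4d, so the divisor bound
  applies.\<close>

lemma card_forms_le: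
  fixes C \<delta> :: real
  assumes C: "\<forall>n>0. real (card {k::nat. k dvd n}) \<le> C * real n powr \<delta>" "C \<ge> 0" "\<delta> \<ge> 0"
    and d: "d > 1" "squarefree d"
  shows "real (card (forms d)) \<le> (2 * sqrt (of_int d) + 1) * (C * (4 * of_int d) powr \<delta>)"
proof -
  define m where "m = \<lfloor>2 * sqrt (real_of_int d)\<rfloor>"
  have m0: "m \<ge> 0" using d by (simp add: m_def)
  define G where "G b = {k. 0 < k \<and> k dvd d - b\<^sup>2}" for b :: int
  have bd: "k \<le> m \<and> b\<^sup>2 < 4 * d" if "(k, b) \<in> forms d" for k b
  proof -
    have *: "1 \<le> k" "k\<^sup>2 \<le> 4 * d" "0 \<le> b" "b < k" using that by (auto simp: forms_def)
    have "(real_of_int k)\<^sup>2 \<le> (2 * sqrt (real_of_int d))\<^sup>2" using *(2) d by (simp add: power_mult_distrib flip: of_int_power)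
    then have "real_of_int k \<le> 2 * sqrt (real_of_int d)" by (rule power2_le_imp_le) (use d in simp)
    then have "k \<le> m" by (simp add: m_def le_floor_iff)
    moreover have "b\<^sup>2 < k\<^sup>2" using *(3,4) by (intro power_strict_mono) auto
    ultimately show ?thesis using *(2) by linarith
  qed
  have G: "finite (G b) \<and> real (card (G b)) \<le> C * (4 * of_int d) powr \<delta>" if b: "b\<^sup>2 < 4 * d" for b
  proof -
    define n where "n = nat \<bar>d - b\<^sup>2\<bar>"
    have nz: "d - b\<^sup>2 \<noteq> 0"
    proof
      assume "d - b\<^sup>2 = 0"
      then have "b\<^sup>2 dvd d" by simp
      then have "b dvd 1" using d(2) squarefreeD by blast
      then have "\<bar>b\<bar> = 1" by simp
      then have "b\<^sup>2 = 1" by (metis one_power2 power2_abs)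
      then show False using \<open>d - b\<^sup>2 = 0\<close> d(1) by simp
    qed
    then have n0: "n > 0" by (simp add: n_def)
    have "\<bar>d - b\<^sup>2\<bar> \<le> 4 * d" using b d(1) zero_le_power2[of b] by linarith
    then have "int n \<le> 4 * d" by (simp add: n_def)
    then have "real_of_int (int n) \<le> real_of_int (4 * d)" by (rule of_int_le_iff[THEN iffD2])
    then have n4: "real n \<le> 4 * of_int d" by simp
    have "G b \<subseteq> int ` {k. k dvd n}"
    proof
      fix k assume k: "k \<in> G b"
      then have "k = int (nat k)" "nat k dvd n" by (auto simp: G_def n_def nat_dvd_iff)
      then show "k \<in> int ` {k. k dvd n}" by blast
    qed
    moreover have "finite (int ` {k. k dvd n})" using n0 by simp
    ultimately have "finite (G b)" "card (G b) \<le> card (int ` {k. k dvd n})"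
      using finite_subset card_mono by metis+
    moreover have "card (int ` {k. k dvd n}) = card {k. k dvd n}" by (simp add: card_image)
    moreover have "real (card {k. k dvd n}) \<le> C * real n powr \<delta>" using C(1) n0 by blast
    moreover have "C * real n powr \<delta> \<le> C * (4 * of_int d) powr \<delta>" using C n4 by (intro mult_left_mono powr_mono2) auto
    ultimately show ?thesis by linarith
  qed
  define B where "B = {b \<in> {0..m}. b\<^sup>2 < 4 * d}"
  have finB: "finite B" by (rule finite_subset[of _ "{0..m}"]) (auto simp: B_def)
  have "forms d \<subseteq> (\<lambda>(b, k). (k, b)) ` (SIGMA b:B. G b)"
  proof
    fix x assume x: "x \<in> forms d"
    obtain k b where kb: "x = (k, b)" by (cases x)
    have "b \<in> B" "k \<in> G b" using x bd[of k b] unfolding kb by (auto simp: forms_def B_def G_def)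
    then show "x \<in> (\<lambda>(b, k). (k, b)) ` (SIGMA b:B. G b)" unfolding kb by force
  qed
  moreover have finG: "finite (SIGMA b:B. G b)" using finB G by (intro finite_SigmaI) (auto simp: B_def)
  ultimately have "card (forms d) \<le> card (SIGMA b:B. G b)" by (rule surj_card_le[rotated])
  also have "\<dots> = (\<Sum>b\<in>B. card (G b))" using finB G by (intro card_SigmaI) (auto simp: B_def)
  finally have "real (card (forms d)) \<le> (\<Sum>b\<in>B. real (card (G b)))" by (simp flip: of_nat_sum)
  also have "\<dots> \<le> (\<Sum>b\<in>B. C * (4 * of_int d) powr \<delta>)" using G by (intro sum_mono) (auto simp: B_def)
  also have "\<dots> = real (card B) * (C * (4 * of_int d) powr \<delta>)" by simp
  also have "\<dots> \<le> (2 * sqrt (of_int d) + 1) * (C * (4 * of_int d) powr \<delta>)"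
  proof (rule mult_right_mono)
    have "card B \<le> card {0..m}" by (intro card_mono) (auto simp: B_def)
    then have "real (card B) \<le> real_of_int (m + 1)" using m0 by simp
    also have "\<dots> \<le> 2 * sqrt (of_int d) + 1" unfolding m_def by simp
    finally show "real (card B) \<le> 2 * sqrt (of_int d) + 1" .
  qed (use C in auto)
  finally show ?thesis .
qed

lemma torsion_factor_le:
  fixes C \<delta> Y :: real
  assumes C: "\<forall>n>0. real (card {k::nat. k dvd n}) \<le> C * real n powr \<delta>" "C \<ge> 0" "\<delta> \<ge> 0"
    and d: "d > 1" "squarefree d" "of_int d \<le> 2 * Y"
  shows "torsion_factor l d \<le> (2 * sqrt (2 * Y) + 1) * (C * (8 * Y) powr \<delta>) * (2 * real l * (log 2 (2 * sqrt (2 * Y)) + 1) + 1)"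
proof -
  have "real (card (forms d)) \<le> (2 * sqrt (of_int d) + 1) * (C * (4 * of_int d) powr \<delta>)"
    by (rule card_forms_le[OF C d(1,2)])
  also have "\<dots> \<le> (2 * sqrt (2 * Y) + 1) * (C * (8 * Y) powr \<delta>)"
  proof -
    have "(4 * real_of_int d) powr \<delta> \<le> (8 * Y) powr \<delta>" using d C by (intro powr_mono2) auto
    moreover have "sqrt (real_of_int d) \<le> sqrt (2 * Y)" using d by simp
    ultimately show ?thesis using d C by (intro mult_mono) auto
  qed
  finally have 1: "real (card (forms d)) \<le> (2 * sqrt (2 * Y) + 1) * (C * (8 * Y) powr \<delta>)" .
  have "1 * 1 \<le> 2 * sqrt (real_of_int d)" using d(1) by (intro mult_mono) auto
  then have lg: "log 2 (2 * sqrt (real_of_int d)) \<ge> 0" using d(1) by (subst zero_le_log_cancel_iff) auto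
  have "log 2 (2 * sqrt (real_of_int d)) \<le> log 2 (2 * sqrt (2 * Y))" using d by (subst log_le_cancel_iff) auto
  then have 2: "2 * real l * (log 2 (2 * sqrt (real_of_int d)) + 1) + 1 \<le> 2 * real l * (log 2 (2 * sqrt (2 * Y)) + 1) + 1"
    by (intro add_mono mult_left_mono) auto
  show ?thesis unfolding torsion_factor_def
    using d C lg by (intro mult_mono[OF 1 2]) auto
qed

text \<open>A discriminant with few split primes costs \<open>T\<close>, any other T (8/c + 64
  E/c^2). The at most 4 (2Y/c + Z^2) bad ones and the 2Y good ones give 24 Y/c + 4 Z^2, and the
  factor c^2 in the collision count cancels.\<close>

lemma dyadic_sum_le:
  fixes P :: "nat set" and Y Z T D :: real
  assumes l: "odd l" and Y: "Y \<ge> 2" and Z: "Z \<ge> 0"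
    and P: "finite P" "\<And>p. p \<in> P \<Longrightarrow> prime p \<and> odd p" "\<And>p. p \<in> P \<Longrightarrow> real p \<le> Z" "card P > 0"
    and lg: "log 2 (3 * Y) \<le> real (card P) / 8"
    and T: "\<And>d. d > 1 \<Longrightarrow> squarefree d \<Longrightarrow> of_int d \<le> 2 * Y \<Longrightarrow> torsion_factor l d \<le> T"
    and D: "\<And>v. 0 < v \<Longrightarrow> of_int v \<le> sqrt 8 * Z ^ l / sqrt Y \<Longrightarrow> real (card {k. k dvd nat (v\<^sup>2)}) \<le> D"
  shows "(\<Sum>d | Y \<le> of_int d \<and> of_int d < 2 * Y \<and> squarefree d. real (class_torsion l d)) \<le>
    T * (24 * Y / real (card P) + 4 * Z\<^sup>2 +
      128 * (real l + 1)\<^sup>2 * D\<^sup>2 * (16 * sqrt Y * (1 + ln (1 + sqrt 8 * Z ^ l / sqrt Y)) + sqrt 8 * Z ^ l / sqrt Y))"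
proof -
  define A where "A = {d. Y \<le> of_int d \<and> of_int d < 2 * Y \<and> squarefree d}"
  define a where "a = \<lceil>Y\<rceil>"
  define n where "n = nat (\<lceil>2 * Y\<rceil> - \<lceil>Y\<rceil>)"
  define c where "c = real (card P)"
  define V where "V = sqrt 8 * Z ^ l / sqrt Y"
  have c0: "c > 0" using P by (simp add: c_def)
  have an: "a + int n = \<lceil>2 * Y\<rceil>" using Y ceiling_mono[of Y "2 * Y"] by (simp add: a_def n_def)
  have nY: "real n \<le> 2 * Y"
  proof -
    have "real n = real_of_int (\<lceil>2 * Y\<rceil> - \<lceil>Y\<rceil>)" using Y ceiling_mono[of Y "2 * Y"] by (simp add: n_def)
    also have "\<dots> \<le> 2 * Y" using Y by simp linarith
    finally show ?thesis .
  qed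
  have win: "{a..<a + int n} = {d. Y \<le> of_int d \<and> of_int d < 2 * Y}"
  proof -
    have "{a..<a + int n} = {\<lceil>Y\<rceil>..<\<lceil>2 * Y\<rceil>}" by (simp only: an) (simp only: a_def)
    then show ?thesis by (simp add: set_eq_iff ceiling_le_iff less_ceiling_iff)
  qed
  have finwin: "finite {d. Y \<le> real_of_int d \<and> real_of_int d < 2 * Y}" unfolding win[symmetric] by simp
  have finA: "finite A" by (rule finite_subset[OF _ finwin]) (auto simp: A_def)
  have Ad: "d > 1" "squarefree d" "of_int d \<le> 2 * Y" if "d \<in> A" for d using that Y by (auto simp: A_def)
  define E where "E d = {(p, q) \<in> P \<times> P. p \<noteq> q \<and> norm_solvable d l (int p) (int q)}" for d
  define B where "B = {d \<in> A. 8 * card (split_primes P d) < card P}"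
  have l1: "l \<ge> 1" using l by (cases l) auto
  have finE: "finite (E d)" for d by (rule finite_subset[of _ "P \<times> P"]) (use P in \<open>auto simp: E_def\<close>)
  have pt: "real (class_torsion l d) \<le> T * ((if d \<in> B then 1 else 0) + 8 / c + 64 * real (card (E d)) / c\<^sup>2)"
    if "d \<in> A" for d
  proof -
    have Td: "torsion_factor l d \<le> T" using T Ad[OF that] by blast
    have Tn: "torsion_factor l d \<ge> 0"
      using class_torsion_le_trivial[OF Ad(1,2)[OF that] l1] by (rule order_trans[OF of_nat_0_le_iff])
    have pos: "8 / c \<ge> 0" "64 * real (card (E d)) / c\<^sup>2 \<ge> 0" using c0 by auto
    show ?thesis
    proof (cases "d \<in> B")
      case True
      have "real (class_torsion l d) \<le> torsion_factor l d" by (rule class_torsion_le_trivial[OF Ad(1,2)[OF that] l1])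
      also have "\<dots> \<le> T * 1" using Td by simp
      also have "\<dots> \<le> T * ((if d \<in> B then 1 else 0) + 8 / c + 64 * real (card (E d)) / c\<^sup>2)"
        using True pos Tn Td by (intro mult_left_mono) auto
      finally show ?thesis .
    next
      case False
      then have "card P \<le> 8 * card (split_primes P d)" using that by (simp add: B_def)
      then have "real (class_torsion l d) \<le> torsion_factor l d * (8 / c + 64 * real (card (E d)) / c\<^sup>2)"
        unfolding c_def E_def using P prime_gt_0_nat by (intro class_torsion_le_split[OF Ad(1,2)[OF that] l1]) auto
      also have "\<dots> \<le> T * (8 / c + 64 * real (card (E d)) / c\<^sup>2)" using Td pos by (intro mult_right_mono) auto
      finally show ?thesis using False by simp
    qed
  qed
  have T0: "T \<ge> 0"
  proof -
    \<comment> \<open>Nonnegativity of \<open>T\<close> is read off from one admissible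
      discriminant; 2 qualifies because \<open>Y \<ge> 2\<close>.\<close>
    have sq2: "squarefree (2::int)" by (intro squarefree_prime_elem prime_imp_prime_elem) simp
    have "0 \<le> torsion_factor l 2"
      using class_torsion_le_trivial[OF _ sq2 l1] by (rule order_trans[OF of_nat_0_le_iff]) simp
    also have "\<dots> \<le> T" using Y by (intro T sq2) auto
    finally show ?thesis .
  qed
  have bad: "real (card B) \<le> 4 * (2 * Y / c + Z\<^sup>2)"
  proof -
    have "real (card {d \<in> {a..<a + int n}. 8 * card (split_primes P d) < card P}) \<le> 4 * (real n / real (card P) + Z\<^sup>2)"
    proof (rule few_bad_discriminants[OF P])
      show "a > 0" using Y by (simp add: a_def)
      have "real_of_int a + real n = real_of_int (a + int n)" by simp
      \<comment> \<open>Rounding 2Y up costs at most 1, which is below Y.\<close>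
      also have "\<dots> \<le> 3 * Y" unfolding an using Y by linarith
      finally have "log 2 (real_of_int a + real n) \<le> log 2 (3 * Y)" using \<open>a > 0\<close> Y by (subst log_le_cancel_iff) auto
      then show "log 2 (real_of_int a + real n) \<le> real (card P) / 8" using lg by linarith
    qed
    also have "\<dots> \<le> 4 * (2 * Y / c + Z\<^sup>2)" unfolding c_def[symmetric] using nY c0 by (intro mult_left_mono add_mono divide_right_mono) auto
    finally have *: "real (card {d \<in> {a..<a + int n}. 8 * card (split_primes P d) < card P}) \<le> 4 * (2 * Y / c + Z\<^sup>2)" .
    have "card B \<le> card {d \<in> {a..<a + int n}. 8 * card (split_primes P d) < card P}"
      unfolding win by (intro card_mono finite_subset[OF _ finwin]) (auto simp: A_def B_def)
    then show ?thesis using * by linarith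
  qed
  have cA: "real (card A) \<le> 2 * Y"
  proof -
    have "card A \<le> card {a..<a + int n}" unfolding win by (rule card_mono[OF finwin]) (auto simp: A_def)
    then show ?thesis using nY by simp
  qed
  have coll: "(\<Sum>d\<in>A. real (card (E d))) \<le> c\<^sup>2 * (2 * (real l + 1)\<^sup>2) * D\<^sup>2 * (16 * sqrt Y * (1 + ln (1 + V)) + V)"
  proof -
    let ?S = "{(d, p, q). Y \<le> of_int d \<and> of_int d < 2 * Y \<and> p \<in> P \<and> q \<in> P \<and> p \<noteq> q \<and> norm_solvable d l (int p) (int q)}"
    have "(\<Sum>d\<in>A. card (E d)) = card (SIGMA d:A. E d)" using finA finE by (intro card_SigmaI[symmetric]) auto
    also have "\<dots> \<le> card ?S"
    proof (rule card_mono)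
      show "finite ?S" by (rule finite_subset[of _ "{d. Y \<le> of_int d \<and> of_int d < 2 * Y} \<times> P \<times> P"]) (use finwin P in auto)
      show "(SIGMA d:A. E d) \<subseteq> ?S" by (auto simp: A_def E_def)
    qed
    finally have "(\<Sum>d\<in>A. real (card (E d))) \<le> real (card ?S)" by (simp flip: of_nat_sum)
    also have "\<dots> \<le> c\<^sup>2 * (2 * (real l + 1)\<^sup>2) * D\<^sup>2 * (16 * sqrt Y * (1 + ln (1 + V)) + V)"
      unfolding c_def V_def by (rule collision_count[OF P(1-3) l _ Z D]) (use Y in auto)
    finally show ?thesis .
  qed
  have "(\<Sum>d\<in>A. real (class_torsion l d)) \<le> (\<Sum>d\<in>A. T * ((if d \<in> B then 1 else 0) + 8 / c + 64 * real (card (E d)) / c\<^sup>2))"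
    by (intro sum_mono pt)
  also have "\<dots> = T * (real (card B) + real (card A) * (8 / c) + 64 / c\<^sup>2 * (\<Sum>d\<in>A. real (card (E d))))"
  proof -
    have "(\<Sum>d\<in>A. (if d \<in> B then 1 else 0 :: real)) = real (card B)"
      using finA by (simp add: sum.If_cases B_def Int_def)
    then show ?thesis by (simp add: sum_distrib_left[symmetric] sum.distrib sum_divide_distrib[symmetric])
  qed
  also have "\<dots> \<le> T * (4 * (2 * Y / c + Z\<^sup>2) + 2 * Y * (8 / c) +
      64 / c\<^sup>2 * (c\<^sup>2 * (2 * (real l + 1)\<^sup>2) * D\<^sup>2 * (16 * sqrt Y * (1 + ln (1 + V)) + V)))"
    using bad cA coll c0 by (intro mult_left_mono[OF _ T0] add_mono mult_right_mono mult_left_mono) auto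
  also have "\<dots> = T * (24 * Y / c + 4 * Z\<^sup>2 + 128 * (real l + 1)\<^sup>2 * D\<^sup>2 * (16 * sqrt Y * (1 + ln (1 + V)) + V))"
    using c0 by (simp add: field_simps)
  finally show ?thesis unfolding A_def c_def V_def .
qed

section \<open>Choice of parameters and summation over dyadic ranges\<close>

text \<open>The divisor bound uses one power of Y^\<delta>, constants and the logarithm a second;
  the third is slack.\<close>

lemma torsion_factor_asymp:
  fixes C l \<delta> :: real
  assumes "C > 0" "l > 0" "\<delta> > 0"
  shows "\<forall>\<^sub>F Y in at_top. (2 * sqrt (2 * Y) + 1) * (C * (8 * Y) powr \<delta>) * (2 * l * (log 2 (2 * sqrt (2 * Y)) + 1) + 1)
    \<le> Y powr (1 / 2 + 3 * \<delta>)"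
proof -
  define A where "A = 4 * (C * 8 powr \<delta>)"
  have A: "A > 0" using assms by (simp add: A_def)
  have "\<forall>\<^sub>F Y in at_top. A * (2 * l * (5 / 2 + ln Y / (2 * ln 2)) + 1) \<le> Y powr \<delta>"
    using A assms by real_asymp
  moreover have "\<forall>\<^sub>F Y::real in at_top. Y \<ge> 2" by (rule eventually_ge_at_top)
  ultimately show ?thesis
  proof eventually_elim
    case (elim Y)
    have "sqrt (2 * Y) \<le> sqrt ((3 / 2)\<^sup>2 * Y)" using elim(2) by (intro real_sqrt_le_mono mult_right_mono) (auto simp: power2_eq_square)
    also have "\<dots> = 3 / 2 * sqrt Y" by (simp add: real_sqrt_mult)
    finally have 1: "2 * sqrt (2 * Y) + 1 \<le> 4 * Y powr (1 / 2)" 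
      using elim(2) by (simp add: powr_half_sqrt)
        (smt (verit) real_sqrt_ge_one)
    have "log 2 (2 * sqrt (2 * Y)) = 3 / 2 + ln Y / (2 * ln 2)"
      using elim(2) by (simp add: log_def ln_mult ln_sqrt field_simps)
    then have "(2 * sqrt (2 * Y) + 1) * (C * (8 * Y) powr \<delta>) * (2 * l * (log 2 (2 * sqrt (2 * Y)) + 1) + 1)
      = ((2 * sqrt (2 * Y) + 1) * Y powr \<delta>) * (C * 8 powr \<delta> * (2 * l * (5 / 2 + ln Y / (2 * ln 2)) + 1))"
      using elim(2) by (simp add: powr_mult)
    also have "\<dots> \<le> ((4 * Y powr (1 / 2)) * Y powr \<delta>) * (C * 8 powr \<delta> * (2 * l * (5 / 2 + ln Y / (2 * ln 2)) + 1))"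
      using 1 assms elim(2) by (intro mult_right_mono) auto
    also have "\<dots> = Y powr (1 / 2) * Y powr \<delta> * (A * (2 * l * (5 / 2 + ln Y / (2 * ln 2)) + 1))"
      by (simp add: A_def)
    also have "\<dots> \<le> Y powr (1 / 2) * Y powr \<delta> * Y powr \<delta>" using elim(1) by (intro mult_left_mono) auto
    also have "\<dots> = Y powr (1 / 2 + \<delta> + \<delta>)" by (simp only: powr_add)
    also have "\<dots> \<le> Y powr (1 / 2 + 3 * \<delta>)" using elim(2) assms by (intro powr_mono) auto
    finally show ?case .
  qed
qed

text \<open>With t = Y^\<delta>, the squared divisor bound at an argument of size Y^2 gives t^4, the
  logarithm and the constants give t, and t^2 absorbs the remaining factor 29 = 24 + 4 + 1.\<close>

lemma collision_factor_asymp: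
  fixes C l \<delta> :: real
  assumes "C > 0" "l > 0" "\<delta> > 0"
  shows "\<forall>\<^sub>F Y in at_top. 24 * Y powr \<delta> + 4 + 128 * (l + 1)\<^sup>2 * (C * (8 * Y\<^sup>2) powr \<delta>)\<^sup>2 *
      (16 * (1 + ln (1 + sqrt 8 * Y)) + sqrt 8) \<le> Y powr (7 * \<delta>)"
proof -
  define A where "A = 128 * (l + 1)\<^sup>2 * (C * 8 powr \<delta>)\<^sup>2"
  have A: "A > 0" using assms by (simp add: A_def)
  have "\<forall>\<^sub>F Y in at_top. A * (16 * (1 + ln (1 + sqrt 8 * Y)) + sqrt 8) \<le> Y powr \<delta>"
    using A assms by real_asymp
  moreover have "\<forall>\<^sub>F Y in at_top. 29 \<le> Y powr \<delta>" using assms by real_asymp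
  moreover have "\<forall>\<^sub>F Y::real in at_top. Y \<ge> 1" by (rule eventually_ge_at_top)
  ultimately show ?thesis
  proof eventually_elim
    case (elim Y)
    define t where "t = Y powr \<delta>"
    have t: "t \<ge> 29" using elim(2) by (simp add: t_def)
    have p: "Y powr (real n * \<delta>) = t ^ n" for n
      using elim(3) t by (simp add: t_def powr_realpow[symmetric] powr_powr mult.commute)
    have "((Y\<^sup>2) powr \<delta>)\<^sup>2 = t ^ 4"
      using elim(3) by (simp add: t_def power2_eq_square powr_mult power4_eq_xxxx)
    then have "(C * (8 * Y\<^sup>2) powr \<delta>)\<^sup>2 = (C * 8 powr \<delta>)\<^sup>2 * t ^ 4"
      by (simp add: powr_mult power_mult_distrib)
    then have "128 * (l + 1)\<^sup>2 * (C * (8 * Y\<^sup>2) powr \<delta>)\<^sup>2 * (16 * (1 + ln (1 + sqrt 8 * Y)) + sqrt 8)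
      = t ^ 4 * (A * (16 * (1 + ln (1 + sqrt 8 * Y)) + sqrt 8))" by (simp add: A_def)
    also have "\<dots> \<le> t ^ 4 * t" using elim(1) t by (intro mult_left_mono) (auto simp: t_def)
    finally have 1: "128 * (l + 1)\<^sup>2 * (C * (8 * Y\<^sup>2) powr \<delta>)\<^sup>2 * (16 * (1 + ln (1 + sqrt 8 * Y)) + sqrt 8) \<le> t ^ 5"
      by (simp add: eval_nat_numeral)
    have "24 * t + 4 \<le> 28 * t" using t by simp
    also have "\<dots> \<le> 28 * t ^ 5" using t by (intro mult_left_mono) (auto simp: self_le_power)
    finally have "24 * t + 4 + t ^ 5 \<le> 29 * t ^ 5" by simp
    also have "\<dots> \<le> t ^ 2 * t ^ 5" using t by (intro mult_right_mono order_trans[OF t]) (auto simp: self_le_power)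
    also have "\<dots> = Y powr (7 * \<delta>)" using p[of 7] by (simp add: power_add[symmetric])
    finally show ?case using 1 by (simp add: t_def)
  qed
qed

text \<open>Inside the bracket the terms are Y/Z, Z^2, sqrt Y and V, up to small powers; all of them
  are at most Y^(1 - \<theta>) for the chosen \<theta>, and the factor \<open>T\<close> contributes
  Y^(1/2).\<close>

lemma dyadic_asymp:
  fixes l :: nat and \<epsilon> :: real
  assumes l: "odd l" "l \<ge> 5" and e: "\<epsilon> > 0"
  shows "\<forall>\<^sub>F Y in at_top. (\<Sum>d | Y \<le> of_int d \<and> of_int d < 2 * Y \<and> squarefree d. real (class_torsion l d))
     \<le> Y powr (3 / 2 - 3 / (2 * real l + 2) + \<epsilon>)"
proof -
  define \<theta> where "\<theta> = 3 / (2 * real l + 2)"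
  \<comment> \<open>The bound 1/4, from \<open>l \<ge> 5\<close>, keeps Z^2 = Y^(2 \<theta>) and
    sqrt Y below Y^(1 - \<theta>).\<close>
  have th: "\<theta> > 0" "\<theta> \<le> 1 / 4" using l by (auto simp: \<theta>_def field_simps)
  \<comment> \<open>The losses Y^(3 \<delta>) and Y^(7 \<delta>) of the two factors must fit into
    Y^\<epsilon>; \<delta> < \<theta> keeps the lower bound Y^(\<theta> - \<delta>) for the number
    of primes growing.\<close>
  define \<delta> where "\<delta> = min (\<epsilon> / 10) (\<theta> / 2)"
  have de: "\<delta> > 0" "10 * \<delta> \<le> \<epsilon>" "\<delta> < \<theta>" using e th by (auto simp: \<delta>_def)
  \<comment> \<open>This balance makes V = sqrt 8 * Z^l / sqrt Y equal to sqrt 8 * Y^(1 - \<theta>),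
    the size of Y/Z.\<close>
  have lth: "real l * \<theta> = 3 / 2 - \<theta>" by (simp add: \<theta>_def field_simps)
  obtain C where C: "C \<ge> 1" "\<forall>n>0. real (card {k::nat. k dvd n}) \<le> C * real n powr \<delta>"
    using divisor_bound[OF de(1)] by blast
  define P where "P Y = {p. prime p \<and> odd p \<and> real p \<le> Y powr \<theta>}" for Y
  have "filterlim (\<lambda>Y. Y powr \<theta>) at_top at_top" using th by real_asymp
  from eventually_compose_filterlim[OF odd_prime_count[OF de(1)] this]
  have ev1: "\<forall>\<^sub>F Y in at_top. (Y powr \<theta>) powr (1 - \<delta>) \<le> real (card (P Y))" by (simp add: P_def)
  have ev2: "\<forall>\<^sub>F Y::real in at_top. log 2 (3 * Y) \<le> Y powr (\<theta> - \<delta>) / 8"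
  proof -
    define \<eta> where "\<eta> = \<theta> - \<delta>"
    have "\<eta> > 0" using de by (simp add: \<eta>_def)
    then have "\<forall>\<^sub>F Y::real in at_top. log 2 (3 * Y) \<le> Y powr \<eta> / 8" by real_asymp
    then show ?thesis by (simp add: \<eta>_def)
  qed
  have C0: "C > 0" "C \<ge> 0" and l0: "real l > 0" using C l by auto
  note ev3 = torsion_factor_asymp[OF C0(1) l0 de(1)]
  note ev4 = collision_factor_asymp[OF C0(1) l0 de(1)]
  have ev5: "\<forall>\<^sub>F Y::real in at_top. Y \<ge> 2" by (rule eventually_ge_at_top)
  from ev1 ev2 ev3 ev4 ev5 show ?thesis
  proof eventually_elim
    case (elim Y)
    note Y = elim(5)
    define Z where "Z = Y powr \<theta>"
    define c where "c = real (card (P Y))"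
    define V where "V = sqrt 8 * Z ^ l / sqrt Y"
    have Y1: "Y \<ge> 1" "Y > 0" using Y by auto
    have mono: "Y powr a \<le> Y powr b" if "a \<le> b" for a b using that Y1 by (intro powr_mono) auto
    have finP: "finite (P Y)"
    proof (rule finite_subset)
      show "P Y \<subseteq> {..nat \<lceil>Y powr \<theta>\<rceil>}" by (auto simp: P_def) linarith
    qed auto
    have cY: "Y powr (\<theta> - \<delta>) \<le> c"
    proof -
      have "Y powr (\<theta> - \<delta>) \<le> Y powr (\<theta> * (1 - \<delta>))" using th de by (intro mono) (simp add: algebra_simps mult_left_le_one_le)
      then show ?thesis using elim(1) by (simp add: powr_powr c_def)
    qed
    have "Y powr (\<theta> - \<delta>) > 0" using Y1 by simp
    then have c0: "c > 0" using cY by linarith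
    have V: "V = sqrt 8 * Y powr (1 - \<theta>)"
    proof -
      have "Z ^ l = Y powr (real l * \<theta>)" using Y1 by (simp add: Z_def powr_realpow[symmetric] powr_powr mult.commute)
      then have "V = sqrt 8 * (Y powr (3 / 2 - \<theta>) / Y powr (1 / 2))" using Y1 by (simp add: V_def lth powr_half_sqrt)
      also have "Y powr (3 / 2 - \<theta>) / Y powr (1 / 2) = Y powr (3 / 2 - \<theta> - 1 / 2)" by (rule powr_diff[symmetric])
      finally show ?thesis by simp
    qed
    have VY: "V \<le> sqrt 8 * Y" unfolding V using mono[of "1 - \<theta>" 1] th Y1 by simp
    have V0: "V \<ge> 0" by (simp add: V)
    define D where "D = C * (8 * Y\<^sup>2) powr \<delta>"
    have D: "real (card {k. k dvd nat (v\<^sup>2)}) \<le> D" if v: "0 < v" "of_int v \<le> sqrt 8 * Z ^ l / sqrt Y" for v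
    proof -
      have n: "nat (v\<^sup>2) > 0" using v by simp
      have "real (nat (v\<^sup>2)) = (real_of_int v)\<^sup>2" by simp
      also have "\<dots> \<le> (sqrt 8 * Y)\<^sup>2" using v VY by (intro power_mono) (auto simp: V_def)
      also have "\<dots> = 8 * Y\<^sup>2" by (simp add: power_mult_distrib)
      finally have "real (nat (v\<^sup>2)) powr \<delta> \<le> (8 * Y\<^sup>2) powr \<delta>" using de by (intro powr_mono2) auto
      then have "C * real (nat (v\<^sup>2)) powr \<delta> \<le> D" unfolding D_def using C0 by (intro mult_left_mono) auto
      moreover have "real (card {k. k dvd nat (v\<^sup>2)}) \<le> C * real (nat (v\<^sup>2)) powr \<delta>" using C(2) n by blast
      ultimately show ?thesis by linarith
    qed
    define T where "T = Y powr (1 / 2 + 3 * \<delta>)"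
    have T: "torsion_factor l d \<le> T" if "d > 1" "squarefree d" "of_int d \<le> 2 * Y" for d
      using torsion_factor_le[OF C(2) C0(2) _ that, of l] de elim(3) by (simp add: T_def)
    have "(\<Sum>d | Y \<le> of_int d \<and> of_int d < 2 * Y \<and> squarefree d. real (class_torsion l d)) \<le>
        T * (24 * Y / c + 4 * Z\<^sup>2 + 128 * (real l + 1)\<^sup>2 * D\<^sup>2 * (16 * sqrt Y * (1 + ln (1 + V)) + V))"
      unfolding c_def V_def
    proof (rule dyadic_sum_le[OF l(1) Y _ finP _ _ _ _ T D])
      show "Z \<ge> 0" by (simp add: Z_def)
      show "card (P Y) > 0" using c0 by (simp add: c_def)
      show "log 2 (3 * Y) \<le> real (card (P Y)) / 8" using elim(2) cY by (simp add: c_def)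
    qed (auto simp: P_def Z_def)
    also have "\<dots> \<le> T * (Y powr (1 - \<theta>) * Y powr (7 * \<delta>))"
    proof (rule mult_left_mono)
      have a1: "24 * Y / c \<le> Y powr (1 - \<theta>) * (24 * Y powr \<delta>)"
      proof -
        have "24 * Y / c \<le> 24 * Y / Y powr (\<theta> - \<delta>)" using cY Y1 c0 by (intro divide_left_mono) auto
        also have "\<dots> = 24 * (Y powr 1 / Y powr (\<theta> - \<delta>))" using Y1 by simp
        also have "Y powr 1 / Y powr (\<theta> - \<delta>) = Y powr (1 - (\<theta> - \<delta>))" by (rule powr_diff[symmetric])
        also have "1 - (\<theta> - \<delta>) = (1 - \<theta>) + \<delta>" by simp
        finally show ?thesis by (simp add: powr_add)
      qed
      have a2: "4 * Z\<^sup>2 \<le> Y powr (1 - \<theta>) * 4"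
      proof -
        have "Z\<^sup>2 = Y powr (\<theta> + \<theta>)" by (simp only: Z_def power2_eq_square powr_add)
        also have "\<dots> \<le> Y powr (1 - \<theta>)" using th by (intro mono) simp
        finally show ?thesis by simp
      qed
      have sY: "sqrt Y \<le> Y powr (1 - \<theta>)" using mono[of "1 / 2" "1 - \<theta>"] th Y1 by (simp add: powr_half_sqrt)
      have lnV: "1 + ln (1 + V) \<le> 1 + ln (1 + sqrt 8 * Y)" "1 + ln (1 + V) \<ge> 0"
        using VY V0 Y1 by (auto intro: add_nonneg_nonneg ln_ge_zero)
      have a3: "16 * sqrt Y * (1 + ln (1 + V)) + V \<le> Y powr (1 - \<theta>) * (16 * (1 + ln (1 + sqrt 8 * Y)) + sqrt 8)"
      proof -
        have "sqrt Y * (1 + ln (1 + V)) \<le> Y powr (1 - \<theta>) * (1 + ln (1 + sqrt 8 * Y))"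
          using sY lnV by (intro mult_mono) auto
        then show ?thesis unfolding V by (simp add: algebra_simps)
      qed
      have "128 * (real l + 1)\<^sup>2 * D\<^sup>2 * (16 * sqrt Y * (1 + ln (1 + V)) + V)
         \<le> 128 * (real l + 1)\<^sup>2 * D\<^sup>2 * (Y powr (1 - \<theta>) * (16 * (1 + ln (1 + sqrt 8 * Y)) + sqrt 8))"
        by (intro mult_left_mono a3) auto
      then have "24 * Y / c + 4 * Z\<^sup>2 + 128 * (real l + 1)\<^sup>2 * D\<^sup>2 * (16 * sqrt Y * (1 + ln (1 + V)) + V)
        \<le> Y powr (1 - \<theta>) * (24 * Y powr \<delta>) + Y powr (1 - \<theta>) * 4
          + 128 * (real l + 1)\<^sup>2 * D\<^sup>2 * (Y powr (1 - \<theta>) * (16 * (1 + ln (1 + sqrt 8 * Y)) + sqrt 8))"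
        using a1 a2 by linarith
      also have "\<dots> = Y powr (1 - \<theta>) * (24 * Y powr \<delta> + 4 + 128 * (real l + 1)\<^sup>2 * D\<^sup>2 * (16 * (1 + ln (1 + sqrt 8 * Y)) + sqrt 8))"
        by (simp add: algebra_simps)
      also have "\<dots> \<le> Y powr (1 - \<theta>) * Y powr (7 * \<delta>)"
        using elim(4) by (intro mult_left_mono) (simp_all add: D_def)
      finally show "24 * Y / c + 4 * Z\<^sup>2 + 128 * (real l + 1)\<^sup>2 * D\<^sup>2 * (16 * sqrt Y * (1 + ln (1 + V)) + V)
         \<le> Y powr (1 - \<theta>) * Y powr (7 * \<delta>)" .
    qed (simp add: T_def)
    also have "\<dots> = Y powr ((1 / 2 + 3 * \<delta>) + ((1 - \<theta>) + 7 * \<delta>))" unfolding T_def by (simp only: powr_add)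
    also have "\<dots> \<le> Y powr (3 / 2 - \<theta> + \<epsilon>)" using de by (intro mono) simp
    finally show ?case by (simp add: \<theta>_def)
  qed
qed

text \<open>The exponent is positive, so the dyadic bounds grow geometrically and their sum is a
  constant multiple of the last one.\<close>

theorem theorem1p2:
  fixes l :: nat and \<epsilon> :: real
  assumes "prime l" and "l \<ge> 5" and "\<epsilon> > 0"
  shows "\<exists>C>0. \<forall>X::real. X \<ge> 1 \<longrightarrow>
    (\<Sum>d | 0 < d \<and> real_of_int d < X \<and> squarefree d. real (class_torsion l d))
      \<le> C * X powr (3 / 2 - 3 / (2 * real l + 2) + \<epsilon>)"
proof -
  define \<beta> where "\<beta> = 3 / 2 - 3 / (2 * real l + 2) + \<epsilon>"
  have "3 / (2 * real l + 2) \<le> 1 / 4" using assms(2) by (simp add: field_simps)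
  then have b: "\<beta> > 0" using assms(3) unfolding \<beta>_def by linarith
  have "odd l" using assms(1,2) prime_odd_nat[of l] by simp
  from dyadic_asymp[OF this assms(2,3)] obtain Y0 where
    Y0: "\<And>Y. Y \<ge> Y0 \<Longrightarrow> (\<Sum>d | Y \<le> of_int d \<and> of_int d < 2 * Y \<and> squarefree d. real (class_torsion l d)) \<le> Y powr \<beta>"
    unfolding eventually_at_top_linorder \<beta>_def by blast
  obtain j0 :: nat where "Y0 < 2 ^ j0" using real_arch_pow[of 2 Y0] by auto
  then have j0: "Y0 \<le> 2 ^ j0" by simp
  define G where "G X = (\<Sum>d | 0 < d \<and> real_of_int d < X \<and> squarefree d. real (class_torsion l d))" for X :: real
  have fin: "finite {d. 0 < d \<and> real_of_int d < X \<and> squarefree d}" for X :: real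
    by (rule finite_subset[of _ "{0..\<lceil>X\<rceil>}"]) (auto, linarith)
  have Gmono: "G X \<le> G X'" if "X \<le> X'" for X X'
    unfolding G_def by (rule sum_mono2[OF fin]) (use that in auto)
  have G0: "G X \<ge> 0" for X unfolding G_def by (rule sum_nonneg) simp
  have step: "G (2 * Y) \<le> G Y + Y powr \<beta>" if "Y \<ge> Y0" "Y > 0" for Y
  proof -
    let ?A = "{d. 0 < d \<and> real_of_int d < Y \<and> squarefree d}" and ?B = "{d. Y \<le> real_of_int d \<and> real_of_int d < 2 * Y \<and> squarefree d}"
    have finB: "finite ?B" by (rule finite_subset[OF _ fin[of "2 * Y"]]) (use that in auto)
    have "{d. 0 < d \<and> real_of_int d < 2 * Y \<and> squarefree d} = ?A \<union> ?B" using that by auto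
    then have "G (2 * Y) = G Y + (\<Sum>d\<in>?B. real (class_torsion l d))"
      unfolding G_def using finB fin by (simp only:) (intro sum.union_disjoint; auto)
    then show ?thesis using Y0[OF that(1)] by simp
  qed
  \<comment> \<open>The constant of the geometric series: \<open>B + 1 = B * 2 powr \<beta>\<close>
    is what one doubling step requires.\<close>
  define B where "B = 1 / (2 powr \<beta> - 1)"
  have "2 powr 0 < 2 powr \<beta>" using b by (intro powr_less_mono) auto
  then have q: "2 powr \<beta> > 1" by simp
  then have B0: "B > 0" by (simp add: B_def)
  have "B * (2 powr \<beta> - 1) = 1" using q b by (simp add: B_def)
  then have Bq: "B + 1 = B * 2 powr \<beta>" by (simp add: algebra_simps)
  \<comment> \<open>Absorbs the initial range, where the asymptotic dyadic bound is not yet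
    available.\<close>
  define Kc where "Kc = G (2 ^ j0)"
  have bound: "G (2 ^ j) \<le> Kc + B * (2 ^ j) powr \<beta>" for j
  proof (cases "j \<le> j0")
    case True
    have "G (2 ^ j) \<le> Kc" unfolding Kc_def using True by (intro Gmono power_increasing) auto
    also have "\<dots> \<le> Kc + B * (2 ^ j) powr \<beta>" using B0 by simp
    finally show ?thesis .
  next
    case False
    then have "j0 \<le> j" by simp
    then show ?thesis
    proof (induction j rule: dec_induct)
      case base
      then show ?case using B0 by (simp add: Kc_def)
    next
      case (step j)
      have "Y0 \<le> 2 ^ j0" by (rule j0)
      also have "(2::real) ^ j0 \<le> 2 ^ j" using step.hyps by (intro power_increasing) auto
      finally have "G (2 * 2 ^ j) \<le> G (2 ^ j) + (2 ^ j) powr \<beta>" by (intro \<open>\<And>Y. Y0 \<le> Y \<Longrightarrow> 0 < Y \<Longrightarrow> G (2 * Y) \<le> G Y + Y powr \<beta>\<close>) auto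
      also have "\<dots> \<le> Kc + (B + 1) * (2 ^ j) powr \<beta>" using step.IH by (simp add: algebra_simps)
      also have "\<dots> = Kc + B * (2 * 2 ^ j) powr \<beta>" unfolding Bq by (simp add: powr_mult)
      finally show ?case by simp
    qed
  qed
  have "G X \<le> (Kc + B * 2 powr \<beta> + 1) * X powr \<beta>" if X: "X \<ge> 1" for X
  proof -
    define j where "j = nat \<lceil>log 2 X\<rceil>"
    have lg: "log 2 X \<ge> 0" using X by simp
    have j1: "log 2 X \<le> real j" "real j \<le> log 2 X + 1" using lg unfolding j_def by linarith+
    have "X = 2 powr log 2 X" using X by simp
    also have "\<dots> \<le> 2 powr real j" using j1 by simp
    finally have Xj: "X \<le> 2 ^ j" by (simp add: powr_realpow)
    have "(2::real) ^ j = 2 powr real j" by (simp add: powr_realpow)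
    also have "\<dots> \<le> 2 powr (log 2 X + 1)" using j1 by simp
    also have "\<dots> = 2 * X" using X by (simp add: powr_add)
    finally have jX: "(2::real) ^ j \<le> 2 * X" .
    have X1: "X powr \<beta> \<ge> 1" using X b by (simp add: ge_one_powr_ge_zero)
    have "G X \<le> G (2 ^ j)" by (rule Gmono[OF Xj])
    also have "\<dots> \<le> Kc + B * (2 ^ j) powr \<beta>" by (rule bound)
    also have "\<dots> \<le> Kc + B * (2 * X) powr \<beta>" using jX b B0 by (intro add_left_mono mult_left_mono powr_mono2) auto
    also have "\<dots> = Kc * 1 + B * 2 powr \<beta> * X powr \<beta>" using X by (simp add: powr_mult)
    also have "\<dots> \<le> Kc * X powr \<beta> + B * 2 powr \<beta> * X powr \<beta>"
      using X1 G0[of "2 ^ j0"] by (intro add_right_mono mult_left_mono) (auto simp: Kc_def)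
    also have "\<dots> \<le> (Kc + B * 2 powr \<beta> + 1) * X powr \<beta>" by (simp add: algebra_simps)
    finally show ?thesis .
  qed
  moreover have "Kc + B * 2 powr \<beta> + 1 > 0" using G0[of "2 ^ j0"] B0 by (simp add: Kc_def add_nonneg_pos)
  ultimately show ?thesis unfolding G_def \<beta>_def by blast
qed

end
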